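(* Let $G$ be a finite graph and let $\mathcal{C}(G)$ be the chain complex of graded modules, with grading-preserving differential, constructed in the context. Then: (i) The homology groups of $\mathcal{C}(G)$ are invariants of the graph $G$: as graded modules, up to isomorphism, they do not depend on the ordering of the vertices or on the ordering of the edges of $G$ used in the construction (a change of the ordering of the vertices being accompanied by the corresponding relabeling of the variables of the polynomial ring). (ii) The graded Euler characteristic of $\mathcal{C}(G)$ is equal to the chromatic polynomial $P_G(q)$, i.e. $$\sum_{i\ge 0}(-1)^i\, q\dim \mathcal{C}^i(G)=P_G(q).$$
   Context: A graph $G$ has a finite vertex set $V(G)$ and a finite edge set $E(G)$; put $n=|V(G)|$, $m=|E(G)|$. For an edge $e$, $G-e$ denotes $G$ with $e$ deleted and $G/e$ denotes $G$ with $e$ contracted (identify the endpoints of $e$ and delete $e$). Chromatic polynomial, in the parametrization used here: $P_G(q)$ is determined by $P_G=P_{G-e}-P_{G/e}$ for every edge $e$, and $P_{N_k}=(1-q)^{-k}$, where $N_k$ is the graph with $k$ vertices and no edges (so it is the usual chromatic polynomial evaluated at $1/(1-q)$, $|q|<1$, or as a power series in $q$). Graded dimension: for a graded $\mathbb{Q}$-vector space $M=\bigoplus_j M_j$ with finite-dimensional pieces, $q\dim M=\sum_j q^j\dim_{\mathbb{Q}} M_j$. Construction of $\mathcal{C}(G)$: Order the vertices of $G$ and let $R=\mathbb{Q}[x_1,\dots,x_n]$, graded with $\deg x_i=1$, the variable $x_i$ being assigned to the $i$-th vertex. For an edge $e$ with endpoints the $i_e$-th and $j_e$-th vertices let $m_e=x_{i_e}-x_{j_e}$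 (the sign is irrelevant). For $s\subset E(G)$ let $I_s\subset R$ be the ideal generated by the $m_e$, $e\in s$, and let $R_s=R/I_s$, a graded $R$-module. Fix an ordering $(e_1,\dots,e_m)$ of $E(G)$. For $0\le i\le m$ put $\mathcal{C}^i(G)=\bigoplus_{s\subset E(G),\,|s|=i}R_s$. The differential $d^i:\mathcal{C}^i(G)\to\mathcal{C}^{i+1}(G)$ is the sum of maps $R_s\to R_{s\cup\{e\}}$ over all $s$ with $|s|=i$ and all $e\in E(G)\setminus s$, where the map $R_s\to R_{s\cup\{e\}}$ is $f+I_s\mapsto (-1)^{\nu(s,e)}(f+I_{s\cup\{e\}})$ for $f\in R$, with $\nu(s,e)$ the number of edges of $s$ that precede $e$ in the chosen ordering; all other components of $d^i$ are zero. *)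

theory Defs
  imports
    "HOL-Library.Poly_Mapping"
    "HOL-Combinatorics.Multiset_Permutations"
    "HOL-Computational_Algebra.Formal_Power_Series"
    "HOL-Algebra.Ideal"
    "HOL-Algebra.Module"
    "Jordan_Normal_Form.VS_Connect"
begin

text \<open>Undirected multigraphs. An edge is mapped to the set of its endpoints, which has one
  element for a loop; contraction can create both loops and parallel edges.\<close>

record ('v, 'e) graph =
  verts :: "'v set"
  edges :: "'e set"
  ends :: "'e \<Rightarrow> 'v set"

locale finite_graph =
  fixes G :: "('v, 'e) graph"
  assumes finite_verts: "finite (verts G)"
    and finite_edges: "finite (edges G)"
    and ends_verts: "e \<in> edges G \<Longrightarrow> ends G e \<subseteq> verts G"
    and card_ends: "e \<in> edges G \<Longrightarrow> card (ends G e) \<in> {1, 2}"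

definition delete_edge :: "('v, 'e) graph \<Rightarrow> 'e \<Rightarrow> ('v, 'e) graph" where
  "delete_edge G e = G\<lparr>edges := edges G - {e}\<rparr>"

text \<open>The endpoints of the contracted edge are identified by mapping them to one of them.\<close>

definition merge_ends :: "'v set \<Rightarrow> 'v \<Rightarrow> 'v" where
  "merge_ends A v = (if v \<in> A then SOME w. w \<in> A else v)"

definition contract_edge :: "('v, 'e) graph \<Rightarrow> 'e \<Rightarrow> ('v, 'e) graph" where
  "contract_edge G e =
     \<lparr>verts = merge_ends (ends G e) ` verts G,
      edges = edges G - {e},
      ends = (\<lambda>a. merge_ends (ends G e) ` ends G a)\<rparr>"

definition chromatic_family :: "(('v, 'e) graph \<Rightarrow> rat fps) \<Rightarrow> bool" where
  "chromatic_family P \<longleftrightarrow>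
     (\<forall>G. finite_graph G \<longrightarrow>
        (\<forall>e\<in>edges G. P G = P (delete_edge G e) - P (contract_edge G e)) \<and>
        (edges G = {} \<longrightarrow> P G = inverse (1 - fps_X) ^ card (verts G)))"

text \<open>The chromatic polynomial evaluated at \<open>1 / (1 - q)\<close>, as a power series in \<open>q\<close>.\<close>

definition chromatic :: "('v, 'e) graph \<Rightarrow> rat fps" where
  "chromatic G = (THE p. \<exists>P. chromatic_family P \<and> P G = p)"

text \<open>The variable \<open>x\<^sub>i\<close> of a polynomial ring in \<open>n\<close> variables is indexed by \<open>i < n\<close>.\<close>

type_synonym qpoly = "(nat \<Rightarrow>\<^sub>0 nat) \<Rightarrow>\<^sub>0 rat"

definition poly_ring :: "nat \<Rightarrow> qpoly ring" where
  "poly_ring n =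
     \<lparr>carrier = {p. \<forall>m\<in>Poly_Mapping.keys p. Poly_Mapping.keys m \<subseteq> {..<n}},
      mult = (*), one = 1, ring.zero = 0, add = (+)\<rparr>"

definition pvar :: "nat \<Rightarrow> qpoly" where
  "pvar i = Poly_Mapping.single (Poly_Mapping.single i 1) 1"

definition pconst :: "rat \<Rightarrow> qpoly" where
  "pconst c = Poly_Mapping.single 0 c"

definition monom_deg :: "(nat \<Rightarrow>\<^sub>0 nat) \<Rightarrow> nat" where
  "monom_deg m = (\<Sum>i\<in>Poly_Mapping.keys m. Poly_Mapping.lookup m i)"

definition homogeneous :: "nat \<Rightarrow> nat \<Rightarrow> qpoly set" where
  "homogeneous n j = {p \<in> carrier (poly_ring n). \<forall>m\<in>Poly_Mapping.keys p. monom_deg m = j}"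

text \<open>The substitution \<open>x\<^sub>i \<mapsto> x\<^bsub>\<pi> i\<^esub>\<close>.\<close>

definition relabel :: "(nat \<Rightarrow> nat) \<Rightarrow> qpoly \<Rightarrow> qpoly" where
  "relabel \<pi> p =
     (\<Sum>m\<in>Poly_Mapping.keys p. Poly_Mapping.single
        (\<Sum>i\<in>Poly_Mapping.keys m. Poly_Mapping.single (\<pi> i) (Poly_Mapping.lookup m i))
        (Poly_Mapping.lookup p m))"

record ('a, 'b) graded_module = "('a, 'b) module" +
  piece :: "nat \<Rightarrow> 'b set"

text \<open>Only the additive structure and the scalar multiplication of a module record are
  meaningful; its multiplication and unit are left undefined below.\<close>

locale graded_module =
  fixes n :: nat and M :: "(qpoly, 'b) graded_module" (structure)
  assumes is_module: "module (poly_ring n) M"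
    and piece_subgroup: "subgroup (piece M j) (add_monoid M)"
    and piece_smult: "a \<in> homogeneous n i \<Longrightarrow> x \<in> piece M j \<Longrightarrow> a \<odot> x \<in> piece M (i + j)"
    and piece_decomposition: "x \<in> carrier M \<Longrightarrow>
      \<exists>!f. (\<forall>j. f j \<in> piece M j) \<and> finite {j. f j \<noteq> \<zero>} \<and>
           x = (\<Oplus>j\<in>{j. f j \<noteq> \<zero>}. f j)"

definition base_module :: "nat \<Rightarrow> (qpoly, qpoly) graded_module" where
  "base_module n =
     \<lparr>carrier = carrier (poly_ring n), mult = undefined, one = undefined, ring.zero = 0, add = (+),
      smult = (*), piece = homogeneous n\<rparr>"

definition submodule_on ::
    "('a, 'b) graded_module \<Rightarrow> 'b set \<Rightarrow> ('a, 'b) graded_module" where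
  "submodule_on M N = M\<lparr>carrier := N, piece := (\<lambda>j. piece M j \<inter> N)\<rparr>"

definition quotient_module ::
    "('a, 'b) graded_module \<Rightarrow> 'b set \<Rightarrow> ('a, 'b set) graded_module" where
  "quotient_module M N =
     \<lparr>carrier = a_rcosets\<^bsub>M\<^esub> N, mult = undefined, one = undefined,
      ring.zero = N, add = set_add M,
      smult = (\<lambda>a C. \<Union>x\<in>C. N +>\<^bsub>M\<^esub> (a \<odot>\<^bsub>M\<^esub> x)),
      piece = (\<lambda>j. (\<lambda>x. N +>\<^bsub>M\<^esub> x) ` piece M j)\<rparr>"

text \<open>No finite support condition is imposed, so the index set has to be finite.\<close>

definition direct_sum ::
    "'i set \<Rightarrow> ('i \<Rightarrow> ('a, 'b) graded_module) \<Rightarrow> ('a, 'i \<Rightarrow> 'b) graded_module" where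
  "direct_sum S M =
     \<lparr>carrier = (\<Pi>\<^sub>E s\<in>S. carrier (M s)), mult = undefined, one = undefined,
      ring.zero = (\<lambda>s\<in>S. \<zero>\<^bsub>M s\<^esub>),
      add = (\<lambda>x y. \<lambda>s\<in>S. x s \<oplus>\<^bsub>M s\<^esub> y s),
      smult = (\<lambda>a x. \<lambda>s\<in>S. a \<odot>\<^bsub>M s\<^esub> x s),
      piece = (\<lambda>j. \<Pi>\<^sub>E s\<in>S. piece (M s) j)\<rparr>"

text \<open>Isomorphism of graded modules along a map \<open>\<sigma>\<close> of the polynomial ring: the scalar \<open>a\<close> acts
  on \<open>M\<close> as \<open>\<sigma> a\<close> does on \<open>M'\<close>.\<close>

definition graded_isomorphic ::
    "nat \<Rightarrow> (qpoly \<Rightarrow> qpoly) \<Rightarrow> (qpoly, 'b) graded_module \<Rightarrow> (qpoly, 'c) graded_module \<Rightarrow> bool"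
  where
  "graded_isomorphic n \<sigma> M M' \<longleftrightarrow>
     graded_module n M \<and> graded_module n M' \<and>
     (\<exists>\<phi>. bij_betw \<phi> (carrier M) (carrier M') \<and>
        (\<forall>x\<in>carrier M. \<forall>y\<in>carrier M. \<phi> (x \<oplus>\<^bsub>M\<^esub> y) = \<phi> x \<oplus>\<^bsub>M'\<^esub> \<phi> y) \<and>
        (\<forall>a\<in>carrier (poly_ring n). \<forall>x\<in>carrier M. \<phi> (a \<odot>\<^bsub>M\<^esub> x) = \<sigma> a \<odot>\<^bsub>M'\<^esub> \<phi> x) \<and>
        (\<forall>j. \<phi> ` piece M j = piece M' j))"

definition piece_space :: "(qpoly, 'b) graded_module \<Rightarrow> nat \<Rightarrow> (rat, 'b) module" where
  "piece_space M j =
     \<lparr>carrier = piece M j, mult = undefined, one = undefined,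
      ring.zero = \<zero>\<^bsub>M\<^esub>, add = add M, smult = (\<lambda>c x. pconst c \<odot>\<^bsub>M\<^esub> x)\<rparr>"

definition qdim :: "(qpoly, 'b) graded_module \<Rightarrow> rat fps" where
  "qdim M = Abs_fps (\<lambda>j. of_nat (vectorspace.dim class_ring (piece_space M j)))"

text \<open>Orderings of the vertices and of the edges are duplicate-free lists \<open>vs\<close> and \<open>es\<close>.\<close>

definition pos :: "'a list \<Rightarrow> 'a \<Rightarrow> nat" where
  "pos xs x = (THE i. i < length xs \<and> xs ! i = x)"

text \<open>The two ends of \<open>e\<close> are ordered by position, which only fixes the irrelevant sign;
  the polynomial is zero for a loop.\<close>

definition edge_poly :: "('v, 'e) graph \<Rightarrow> 'v list \<Rightarrow> 'e \<Rightarrow> qpoly" where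
  "edge_poly G vs e = pvar (Min (pos vs ` ends G e)) - pvar (Max (pos vs ` ends G e))"

definition edge_ideal :: "('v, 'e) graph \<Rightarrow> 'v list \<Rightarrow> 'e set \<Rightarrow> qpoly set" where
  "edge_ideal G vs s = genideal (poly_ring (card (verts G))) (edge_poly G vs ` s)"

definition edge_module :: "('v, 'e) graph \<Rightarrow> 'v list \<Rightarrow> 'e set \<Rightarrow> (qpoly, qpoly set) graded_module"
  where
  "edge_module G vs s = quotient_module (base_module (card (verts G))) (edge_ideal G vs s)"

definition edge_sets :: "('v, 'e) graph \<Rightarrow> nat \<Rightarrow> 'e set set" where
  "edge_sets G i = {s. s \<subseteq> edges G \<and> card s = i}"

definition chain_module ::
    "('v, 'e) graph \<Rightarrow> 'v list \<Rightarrow> nat \<Rightarrow> (qpoly, 'e set \<Rightarrow> qpoly set) graded_module" where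
  "chain_module G vs i = direct_sum (edge_sets G i) (edge_module G vs)"

definition preceding :: "'e list \<Rightarrow> 'e set \<Rightarrow> 'e \<Rightarrow> nat" where
  "preceding es s e = card {a \<in> s. pos es a < pos es e}"

text \<open>The map \<open>R\<^sub>s \<rightarrow> R\<^bsub>s \<union> {e}\<^esub>\<close> on cosets; the union does not depend on the representative \<open>f\<close>.\<close>

definition edge_map ::
    "('v, 'e) graph \<Rightarrow> 'v list \<Rightarrow> 'e list \<Rightarrow> 'e set \<Rightarrow> 'e \<Rightarrow> qpoly set \<Rightarrow> qpoly set" where
  "edge_map G vs es s e C =
     (-1) ^ preceding es s e \<odot>\<^bsub>edge_module G vs (insert e s)\<^esub>
       (\<Union>f\<in>C. edge_ideal G vs (insert e s) +>\<^bsub>poly_ring (card (verts G))\<^esub> f)"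

text \<open>The component at \<open>t\<close> collects the contributions of all pairs \<open>(s, e)\<close> with
  \<open>e \<notin> s\<close> and \<open>s \<union> {e} = t\<close>.\<close>

definition differential ::
    "('v, 'e) graph \<Rightarrow> 'v list \<Rightarrow> 'e list \<Rightarrow> nat \<Rightarrow>
     ('e set \<Rightarrow> qpoly set) \<Rightarrow> ('e set \<Rightarrow> qpoly set)" where
  "differential G vs es i x =
     (\<lambda>t\<in>edge_sets G (Suc i).
        \<Oplus>\<^bsub>edge_module G vs t\<^esub>e\<in>t. edge_map G vs es (t - {e}) e (x (t - {e})))"

definition cycles ::
    "('v, 'e) graph \<Rightarrow> 'v list \<Rightarrow> 'e list \<Rightarrow> nat \<Rightarrow> ('e set \<Rightarrow> qpoly set) set" where
  "cycles G vs es i =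
     {x \<in> carrier (chain_module G vs i).
        differential G vs es i x = \<zero>\<^bsub>chain_module G vs (Suc i)\<^esub>}"

definition boundaries ::
    "('v, 'e) graph \<Rightarrow> 'v list \<Rightarrow> 'e list \<Rightarrow> nat \<Rightarrow> ('e set \<Rightarrow> qpoly set) set" where
  "boundaries G vs es i =
     (case i of
        0 \<Rightarrow> {\<zero>\<^bsub>chain_module G vs 0\<^esub>}
      | Suc k \<Rightarrow> differential G vs es k ` carrier (chain_module G vs k))"

definition homology ::
    "('v, 'e) graph \<Rightarrow> 'v list \<Rightarrow> 'e list \<Rightarrow> nat \<Rightarrow>
     (qpoly, ('e set \<Rightarrow> qpoly set) set) graded_module" where
  "homology G vs es i =
     quotient_module (submodule_on (chain_module G vs i) (cycles G vs es i))
       (boundaries G vs es i)"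

end

theory Submission
  imports Defs
begin

text \<open>
  Changing the vertex order relabels the variables, which maps every ideal \<open>I\<^sub>s\<close> to its counterpart;
  changing the edge order is absorbed by the sign \<open>(-1)\<^bsup>k\<^esup>\<close> on the summand of \<open>s\<close>, where \<open>k\<close> is the
  number of pairs of edges of \<open>s\<close> that the two orders compare differently. Together they give an
  isomorphism of complexes, hence of homology.

  The substitution of a representative of its component in \<open>(V, s)\<close> for each variable has kernel
  exactly \<open>I\<^sub>s\<close>, so \<open>R\<^sub>s\<close> is a polynomial ring in \<open>c(s)\<close> variables, \<open>c(s)\<close> being the number of
  components, and its graded dimension is \<open>(1 - q)\<^bsup>-c(s)\<^esup>\<close>. The Euler characteristic is therefore the
  state sum \<open>\<Sum>\<^sub>s (-1)\<^bsup>|s|\<^esup> (1 - q)\<^bsup>-c(s)\<^esup>\<close>, which satisfies deletion-contraction.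
\<close>

section \<open>Components and the chromatic polynomial\<close>

text \<open>The ideals are given only as generated ideals, so neither membership nor homogeneity can
  be read off from them. Describing them as kernels settles both: membership becomes an equation,
  and replacing variables by variables preserves the degree, so the kernel is graded. The
  substitution is also idempotent. Hence the polynomials in the representative variables form a
  complement of the ideal, and their monomials can be counted.

  The sign works because removing \<open>e\<close> from \<open>t\<close> loses exactly those
  differently compared pairs that contain \<open>e\<close>, and their number has the parity of the
  two counts of edges preceding \<open>e\<close>, taken together.

  \<open>graded_isomorphic\<close> requires both sides to be graded modules, and homology is a
  subquotient of a direct sum of quotients. So a grading has to be carried through each of these
  constructions, and a criterion by projections serves them all. Since a change of the vertex order
  also acts on scalars, maps are semilinear throughout.

  \<open>chromatic\<close> is a definite description, so the state sum has to be shown to be a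
  chromatic family and the only one on finite graphs.\<close>

definition joined :: "'v set set \<Rightarrow> ('v \<times> 'v) set" where
  "joined A = (\<Union>a\<in>A. a \<times> a)\<^sup>*"

definition comp_rep :: "'v set set \<Rightarrow> 'v \<Rightarrow> 'v" where
  "comp_rep A v = (SOME w. (v, w) \<in> joined A)"

text \<open>Only the family of endpoint sets enters: parallel edges coincide in it, and a loop
  contributes nothing but a diagonal pair.\<close>

definition ncomp :: "'v set \<Rightarrow> 'v set set \<Rightarrow> nat" where
  "ncomp V A = card (comp_rep A ` V)"

lemma equiv_joined: "equiv UNIV (joined A)"
proof -
  have "sym (\<Union>a\<in>A. a \<times> a)" by (auto intro: symI)
  then show ?thesis
    unfolding joined_def equiv_def by (simp add: refl_rtrancl sym_rtrancl trans_rtrancl)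
qed

lemma joined_sym: "(u, v) \<in> joined A \<Longrightarrow> (v, u) \<in> joined A"
  using equiv_joined by (meson equivE symE)

lemma joined_trans: "(u, v) \<in> joined A \<Longrightarrow> (v, w) \<in> joined A \<Longrightarrow> (u, w) \<in> joined A"
  using equiv_joined by (meson equivE transE)

lemma joined_refl [simp]: "(u, u) \<in> joined A"
  by (simp add: joined_def)

lemma joined_step: "a \<in> A \<Longrightarrow> u \<in> a \<Longrightarrow> v \<in> a \<Longrightarrow> (u, v) \<in> joined A"
  unfolding joined_def by (intro r_into_rtrancl) blast

lemma joined_induct [consumes 1, case_names refl step]:
  assumes "(u, v) \<in> joined A" and "P u"
    and "\<And>x y a. (u, x) \<in> joined A \<Longrightarrow> a \<in> A \<Longrightarrow> x \<in> a \<Longrightarrow> y \<in> a \<Longrightarrow> P x \<Longrightarrow> P y"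
  shows "P v"
  using assms(1) unfolding joined_def
  by (induction rule: rtrancl_induct) (use assms(2,3) in \<open>auto simp: joined_def\<close>)

lemma comp_rep_joined: "(v, comp_rep A v) \<in> joined A"
  unfolding comp_rep_def by (rule someI[of _ v]) simp

text \<open>The chosen representative depends on the vertex only through the predicate that
  describes its class, so members of one class receive the very same choice.\<close>

lemma comp_rep_eq_iff: "comp_rep A u = comp_rep A v \<longleftrightarrow> (u, v) \<in> joined A"
proof
  assume "comp_rep A u = comp_rep A v"
  then show "(u, v) \<in> joined A"
    by (metis comp_rep_joined joined_sym joined_trans)
next
  assume "(u, v) \<in> joined A"
  then have "(u, w) \<in> joined A \<longleftrightarrow> (v, w) \<in> joined A" for w
    by (meson joined_sym joined_trans)
  then show "comp_rep A u = comp_rep A v"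
    by (simp add: comp_rep_def)
qed

lemma joined_closed:
  assumes "(u, v) \<in> joined A" "u \<in> V" "\<And>a. a \<in> A \<Longrightarrow> a \<subseteq> V"
  shows "v \<in> V"
  using assms(1) by (induction rule: joined_induct) (use assms in auto)

lemma comp_rep_closed:
  assumes "v \<in> V" "\<And>a. a \<in> A \<Longrightarrow> a \<subseteq> V"
  shows "comp_rep A v \<in> V"
  using joined_closed[OF comp_rep_joined] assms by metis

lemma comp_rep_empty [simp]: "comp_rep {} v = v"
  by (simp add: comp_rep_def joined_def)

text \<open>Both images are in bijection with the quotient of \<open>V\<close> by the common fibre
  relation.\<close>

lemma card_image_eq_if_same_fibres:
  assumes "\<And>u v. u \<in> V \<Longrightarrow> v \<in> V \<Longrightarrow> f u = f v \<longleftrightarrow> g u = g v"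
  shows "card (f ` V) = card (g ` V)"
proof -
  have "bij_betw (\<lambda>y. f (SOME v. v \<in> V \<and> g v = y)) (g ` V) (f ` V)"
  proof -
    have *: "f (SOME v. v \<in> V \<and> g v = g u) = f u" if "u \<in> V" for u
    proof -
      have "(SOME v. v \<in> V \<and> g v = g u) \<in> V \<and> g (SOME v. v \<in> V \<and> g v = g u) = g u"
        by (rule someI[of _ u]) (use that in simp)
      then show ?thesis using assms that by blast
    qed
    show ?thesis
      unfolding bij_betw_def inj_on_def using * assms by force
  qed
  then show ?thesis by (simp add: bij_betw_same_card)
qed

lemma merge_ends_mem: "a \<noteq> {} \<Longrightarrow> v \<in> a \<Longrightarrow> merge_ends a v \<in> a"
  by (simp add: merge_ends_def some_in_eq)

text \<open>Collapsing \<open>a\<close> to one of its points has the same effect on connectivity as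
  adding \<open>a\<close> as a further block: merging never leaves a class of the larger family, and
  a step inside \<open>a\<close> becomes trivial after merging.\<close>

lemma joined_merge_ends:
  assumes "a \<noteq> {}"
  shows "(merge_ends a u, merge_ends a v) \<in> joined ((`) (merge_ends a) ` A)
    \<longleftrightarrow> (u, v) \<in> joined (insert a A)"
proof
  \<comment> \<open>Merging moves a vertex only inside \<open>a\<close>, which is itself a block of
    \<open>insert a A\<close>.\<close>
  have merge: "(w, merge_ends a w) \<in> joined (insert a A)" for w
  proof (cases "w \<in> a")
    case True
    then show ?thesis using joined_step[of a "insert a A"] merge_ends_mem[OF assms] by simp
  qed (simp add: merge_ends_def)
  assume "(merge_ends a u, merge_ends a v) \<in> joined ((`) (merge_ends a) ` A)"
  then have "(merge_ends a u, merge_ends a v) \<in> joined (insert a A)"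
  proof (induction rule: joined_induct)
    case (step x y b)
    then obtain c x' y' where "c \<in> A" "x' \<in> c" "y' \<in> c" "x = merge_ends a x'" "y = merge_ends a y'"
      by blast
    then show ?case
      using step.IH merge joined_sym joined_trans joined_step[of c "insert a A"]
      by (metis insertCI)
  qed simp
  then show "(u, v) \<in> joined (insert a A)"
    using merge joined_sym joined_trans by metis
next
  assume "(u, v) \<in> joined (insert a A)"
  then show "(merge_ends a u, merge_ends a v) \<in> joined ((`) (merge_ends a) ` A)"
  proof (induction rule: joined_induct)
    case (step x y b)
    show ?case
    proof (cases "b = a")
      case True
      then have "merge_ends a x = merge_ends a y"
        using step by (simp add: merge_ends_def)
      then show ?thesis using step.IH by simp
    next
      case False
      then have "(merge_ends a x, merge_ends a y) \<in> joined ((`) (merge_ends a) ` A)"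
        using step by (intro joined_step[of "merge_ends a ` b"]) auto
      then show ?thesis using step.IH joined_trans by metis
    qed
  qed simp
qed

lemma ncomp_empty [simp]: "ncomp V {} = card V"
  by (simp add: ncomp_def)

text \<open>Matches the states of a graph that contain an edge with the states of the contracted
  graph; this is the contraction term of the recursion.\<close>

lemma ncomp_contract:
  assumes "a \<noteq> {}"
  shows "ncomp (merge_ends a ` V) ((`) (merge_ends a) ` A) = ncomp V (insert a A)"
proof -
  have "card ((\<lambda>v. comp_rep ((`) (merge_ends a) ` A) (merge_ends a v)) ` V) = card (comp_rep (insert a A) ` V)"
    using joined_merge_ends[OF assms] by (intro card_image_eq_if_same_fibres) (simp add: comp_rep_eq_iff)
  then show ?thesis by (simp add: ncomp_def image_image)
qed

text \<open>Whitney's subset expansion of the chromatic polynomial, taken at the value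
  \<open>1 / (1 - q)\<close>.\<close>

definition state_sum :: "('v, 'e) graph \<Rightarrow> rat fps" where
  "state_sum G = (\<Sum>s\<in>Pow (edges G). (-1) ^ card s * inverse (1 - fps_X) ^ ncomp (verts G) (ends G ` s))"

lemma sum_Pow_split:
  fixes f :: "'e set \<Rightarrow> 'a::comm_monoid_add"
  assumes "finite E" "e \<in> E"
  shows "(\<Sum>s\<in>Pow E. f s) = (\<Sum>s\<in>Pow (E - {e}). f s) + (\<Sum>s\<in>Pow (E - {e}). f (insert e s))"
proof -
  have E: "Pow E = Pow (E - {e}) \<union> insert e ` Pow (E - {e})"
    using assms(2) Pow_insert[of e "E - {e}"] by (simp add: insert_absorb)
  have inj: "inj_on (insert e) (Pow (E - {e}))"
    by (rule inj_onI) blast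
  show ?thesis
    unfolding E using assms(1)
    by (subst sum.union_disjoint) (auto simp: sum.reindex[OF inj])
qed

lemma (in finite_graph) ends_nonempty: "e \<in> edges G \<Longrightarrow> ends G e \<noteq> {}"
  using card_ends[of e] by auto

lemma (in finite_graph) finite_graph_delete: "finite_graph (delete_edge G e)"
  using finite_verts finite_edges ends_verts card_ends
  by (auto simp: finite_graph_def delete_edge_def)

text \<open>Edges parallel to the contracted one turn into loops, so the number of ends may drop
  from two to one, but never to zero.\<close>

lemma (in finite_graph) finite_graph_contract: "finite_graph (contract_edge G e)"
proof -
  have "card (merge_ends (ends G e) ` ends G a) \<in> {1, 2}" if "a \<in> edges G" for a
  proof -
    have fin: "finite (ends G a)" using ends_verts[OF that] finite_verts finite_subset by blast
    have "card (merge_ends (ends G e) ` ends G a) \<le> 2"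
      using card_image_le[OF fin, of "merge_ends (ends G e)"] card_ends[OF that] by auto
    moreover have "card (merge_ends (ends G e) ` ends G a) > 0"
      using fin ends_nonempty[OF that] by (simp add: card_gt_0_iff)
    ultimately show ?thesis by auto
  qed
  then show ?thesis
    using finite_verts finite_edges ends_verts by (auto simp: finite_graph_def contract_edge_def)
qed

text \<open>States without \<open>e\<close> are the states of the deletion. States with
  \<open>e\<close> keep their number of components under contraction but lose one edge, and this
  sign is the minus in the recursion. Loops are covered by the same argument.\<close>

lemma (in finite_graph) state_sum_delete_contract:
  assumes "e \<in> edges G"
  shows "state_sum G = state_sum (delete_edge G e) - state_sum (contract_edge G e)"
proof -
  have "(\<Sum>s\<in>Pow (edges G - {e}). (-1) ^ card (insert e s) *
      inverse (1 - fps_X :: rat fps) ^ ncomp (verts G) (ends G ` insert e s))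
    = - state_sum (contract_edge G e)"
    unfolding state_sum_def sum_negf[symmetric]
  proof (rule sum.cong, goal_cases)
    case 1
    then show ?case by (simp add: contract_edge_def)
  next
    case (2 s)
    then have "s \<subseteq> edges G" "e \<notin> s" by (auto simp: contract_edge_def)
    moreover from this have "finite s" using finite_edges finite_subset by blast
    ultimately show ?case
      using ncomp_contract[OF ends_nonempty[OF assms], of "verts G" "ends G ` s"]
      by (simp add: contract_edge_def image_image)
  qed
  moreover have "state_sum (delete_edge G e)
    = (\<Sum>s\<in>Pow (edges G - {e}). (-1) ^ card s * inverse (1 - fps_X) ^ ncomp (verts G) (ends G ` s))"
    unfolding state_sum_def delete_edge_def by simp
  ultimately show ?thesis
    unfolding state_sum_def[of G] sum_Pow_split[OF finite_edges assms]
    by (simp only: diff_conv_add_uminus)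
qed

lemma chromatic_family_state_sum: "chromatic_family state_sum"
proof -
  have "state_sum G = inverse (1 - fps_X) ^ card (verts G)" if "edges G = {}" for G :: "('a, 'b) graph"
    using that by (simp add: state_sum_def)
  then show ?thesis
    unfolding chromatic_family_def by (simp add: finite_graph.state_sum_delete_contract)
qed

text \<open>Deletion and contraction both remove an edge and stay within the same vertex and edge
  types, so the recursion descends to edgeless graphs, where the value is prescribed.\<close>

lemma chromatic_family_unique:
  assumes "chromatic_family P" "chromatic_family Q" "finite_graph G"
  shows "P G = Q G"
  using assms(3)
proof (induction "card (edges G)" arbitrary: G rule: less_induct)
  case less
  interpret finite_graph G by fact
  show ?case
  proof (cases "edges G = {}")
    case True
    then show ?thesis using assms(1,2) less.prems by (auto simp: chromatic_family_def)
  next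
    case False
    then obtain e where e: "e \<in> edges G" by blast
    have "card (edges G - {e}) < card (edges G)"
      using e finite_edges by (meson card_Diff1_less)
    then have "P (delete_edge G e) = Q (delete_edge G e)" "P (contract_edge G e) = Q (contract_edge G e)"
      using less.hyps[OF _ finite_graph_delete, of e] less.hyps[OF _ finite_graph_contract, of e]
      by (simp_all add: delete_edge_def contract_edge_def)
    moreover have "R G = R (delete_edge G e) - R (contract_edge G e)" if "chromatic_family R" for R
      using that less.prems e by (auto simp: chromatic_family_def)
    ultimately show ?thesis using assms(1,2) by metis
  qed
qed

lemma chromatic_eq_state_sum:
  assumes "finite_graph G"
  shows "chromatic G = state_sum G"
  unfolding chromatic_def
  using chromatic_family_state_sum chromatic_family_unique[OF _ _ assms]
  by (intro the_equality) blast+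

section \<open>Substitutions and the grading of the polynomial ring\<close>

text \<open>The variable set is arbitrary so that the same facts serve the whole ring and the
  subring in the variables of the component representatives.\<close>

definition polys_in :: "nat set \<Rightarrow> qpoly set" where
  "polys_in S = {p. \<forall>m\<in>Poly_Mapping.keys p. Poly_Mapping.keys m \<subseteq> S}"

lemma carrier_poly_ring: "carrier (poly_ring n) = polys_in {..<n}"
  by (simp add: poly_ring_def polys_in_def)

lemma poly_ring_simps [simp]:
  "mult (poly_ring n) = (*)" "one (poly_ring n) = 1"
  "ring.zero (poly_ring n) = 0" "add (poly_ring n) = (+)"
  by (simp_all add: poly_ring_def)

lemma poly_mapping_add_induct [case_names zero add_single]:
  fixes p :: "'a \<Rightarrow>\<^sub>0 'b::comm_monoid_add"
  assumes "P 0" "\<And>p m c. P p \<Longrightarrow> P (p + Poly_Mapping.single m c)"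
  shows "P p"
proof (induction p rule: update_induct)
  case (update f a b)
  have "Poly_Mapping.update a b f = f + Poly_Mapping.single a b"
    using update(1)
    by (intro poly_mapping_eqI) (auto simp: lookup_update lookup_add lookup_single when_def in_keys_iff)
  then show ?case using assms(2) update(3) by simp
qed (rule assms(1))

lemma zero_in_polys_in [simp]: "0 \<in> polys_in S"
  by (simp add: polys_in_def)

lemma single_in_polys_in: "Poly_Mapping.keys m \<subseteq> S \<Longrightarrow> Poly_Mapping.single m c \<in> polys_in S"
  by (simp add: polys_in_def)

lemma pconst_in_polys_in [simp]: "pconst c \<in> polys_in S"
  by (simp add: pconst_def single_in_polys_in)

lemma pvar_in_polys_in: "i \<in> S \<Longrightarrow> pvar i \<in> polys_in S"
  by (simp add: pvar_def single_in_polys_in)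

lemma add_in_polys_in: "p \<in> polys_in S \<Longrightarrow> q \<in> polys_in S \<Longrightarrow> p + q \<in> polys_in S"
  using keys_add[of p q] by (fastforce simp: polys_in_def)

lemma uminus_in_polys_in: "p \<in> polys_in S \<Longrightarrow> - p \<in> polys_in S"
  by (simp add: polys_in_def)

lemma diff_in_polys_in: "p \<in> polys_in S \<Longrightarrow> q \<in> polys_in S \<Longrightarrow> p - q \<in> polys_in S"
  using add_in_polys_in[of p S "- q"] uminus_in_polys_in by simp

lemma mult_in_polys_in: 
  assumes "p \<in> polys_in S" "q \<in> polys_in S" 
  shows "p * q \<in> polys_in S"
proof -
  have "Poly_Mapping.keys m \<subseteq> S" if m: "m \<in> Poly_Mapping.keys (p * q)" for m
  proof -
    obtain a b where "m = a + b" "a \<in> Poly_Mapping.keys p" "b \<in> Poly_Mapping.keys q"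
      using subsetD[OF keys_mult m] by blast
    then show ?thesis using assms keys_add[of a b] by (fastforce simp: polys_in_def)
  qed
  then show ?thesis by (simp add: polys_in_def)
qed

lemma one_in_polys_in [simp]: "1 \<in> polys_in S"
  by (simp add: polys_in_def)

lemma power_in_polys_in: "p \<in> polys_in S \<Longrightarrow> p ^ k \<in> polys_in S"
  by (induction k) (auto intro: mult_in_polys_in)

lemma sum_in_polys_in: "(\<And>i. i \<in> A \<Longrightarrow> f i \<in> polys_in S) \<Longrightarrow> sum f A \<in> polys_in S"
  by (induction A rule: infinite_finite_induct) (auto intro: add_in_polys_in)

lemma polys_in_mono: "S \<subseteq> T \<Longrightarrow> polys_in S \<subseteq> polys_in T"
  by (force simp: polys_in_def)

lemma cring_poly_ring: "cring (poly_ring n)"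
proof (rule cringI)
  show "abelian_group (poly_ring n)"
  proof (rule abelian_groupI)
    show "\<exists>y\<in>carrier (poly_ring n). y \<oplus>\<^bsub>poly_ring n\<^esub> x = \<zero>\<^bsub>poly_ring n\<^esub>"
      if "x \<in> carrier (poly_ring n)" for x
      by (rule bexI[of _ "- x"]) (use that in \<open>simp_all add: carrier_poly_ring uminus_in_polys_in\<close>)
  qed (simp_all add: carrier_poly_ring add_in_polys_in)
  show "comm_monoid (poly_ring n)"
    by (rule comm_monoidI) (simp_all add: carrier_poly_ring mult_in_polys_in)
qed (simp add: algebra_simps)

lemma a_inv_poly_ring [simp]: "p \<in> carrier (poly_ring n) \<Longrightarrow> \<ominus>\<^bsub>poly_ring n\<^esub> p = - p"
proof -
  assume p: "p \<in> carrier (poly_ring n)"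
  interpret cring "poly_ring n" by (rule cring_poly_ring)
  show ?thesis
    by (rule minus_equality) (use p in \<open>simp_all add: carrier_poly_ring uminus_in_polys_in\<close>)
qed

lemma sum_keys_eq:
  fixes m :: "'a \<Rightarrow>\<^sub>0 'b::comm_monoid_add"
  shows "(\<Sum>i\<in>Poly_Mapping.keys m. Poly_Mapping.single i (Poly_Mapping.lookup m i)) = m"
  by (intro poly_mapping_eqI) (auto simp: lookup_sum lookup_single when_def in_keys_iff)

text \<open>A monomial is built one variable factor at a time. Keeping the coefficient one means
  that only products of variables occur; constants are multiplied in later.\<close>

lemma single_one_in_generated:
  assumes "Poly_Mapping.keys m \<subseteq> S"
    and "P 1" "\<And>i. i \<in> S \<Longrightarrow> P (pvar i)"
    and "\<And>p q. p \<in> polys_in S \<Longrightarrow> q \<in> polys_in S \<Longrightarrow> P p \<Longrightarrow> P q \<Longrightarrow> P (p * q)"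
  shows "P (Poly_Mapping.single m 1)"
  using assms(1)
proof (induction m rule: update_induct)
  case const
  then show ?case using assms(2) by simp
next
  case (update f a b)
  from update have a: "a \<in> S" and f: "Poly_Mapping.keys f \<subseteq> S" by (auto simp: keys_update)
  have "Poly_Mapping.update a b f = f + Poly_Mapping.single a b"
    using update(1)
    by (intro poly_mapping_eqI) (auto simp: lookup_update lookup_add lookup_single when_def in_keys_iff)
  moreover have "P (Poly_Mapping.single (f + Poly_Mapping.single a k) 1)" for k
  proof (induction k)
    case 0
    then show ?case using update.IH f by simp
  next
    case (Suc k)
    have "Poly_Mapping.single (f + Poly_Mapping.single a (Suc k)) (1::rat) 
      = Poly_Mapping.single (f + Poly_Mapping.single a k) 1 * pvar a"
      by (simp add: pvar_def mult_single add.assoc flip: single_add)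
    moreover have "Poly_Mapping.keys (f + Poly_Mapping.single a k) \<subseteq> S"
      using f a keys_add[of f "Poly_Mapping.single a k"] by (auto split: if_splits)
    ultimately show ?case
      using Suc assms(3)[OF a] assms(4) by (simp add: single_in_polys_in pvar_in_polys_in a)
  qed
  ultimately show ?case by simp
qed

text \<open>The variables generate \<open>polys_in S\<close> as an algebra over the rationals, so
  identities between substitutions need checking only on constants and variables.\<close>

lemma polys_in_induct [consumes 1, case_names const var add mult]:
  assumes "p \<in> polys_in S"
    and const: "\<And>c. P (pconst c)" and var: "\<And>i. i \<in> S \<Longrightarrow> P (pvar i)"
    and add: "\<And>p q. p \<in> polys_in S \<Longrightarrow> q \<in> polys_in S \<Longrightarrow> P p \<Longrightarrow> P q \<Longrightarrow> P (p + q)"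
    and mult: "\<And>p q. p \<in> polys_in S \<Longrightarrow> q \<in> polys_in S \<Longrightarrow> P p \<Longrightarrow> P q \<Longrightarrow> P (p * q)"
  shows "P p"
proof -
  have single: "P (Poly_Mapping.single m c)" if "Poly_Mapping.keys m \<subseteq> S" for m c
  proof -
    have "P 1" using const[of 1] by (simp add: pconst_def)
    then have "P (Poly_Mapping.single m 1)"
      by (rule single_one_in_generated[where P = P, OF that _ var mult])
    then have "P (pconst c * Poly_Mapping.single m 1)"
      using const mult single_in_polys_in[OF that] by simp
    then show ?thesis by (simp add: pconst_def mult_single)
  qed
  have "P (\<Sum>m\<in>A. Poly_Mapping.single m (Poly_Mapping.lookup p m))"
    if "A \<subseteq> Poly_Mapping.keys p" for A
  proof -
    have "finite A" using that finite_keys finite_subset by blast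
    then show ?thesis using that
    proof (induction A rule: finite_induct)
      case empty
      then show ?case using const[of 0] by (simp add: pconst_def)
    next
      case (insert m A)
      have "Poly_Mapping.keys m \<subseteq> S" "\<And>m'. m' \<in> A \<Longrightarrow> Poly_Mapping.keys m' \<subseteq> S"
        using insert assms(1) by (auto simp: polys_in_def)
      then show ?case
        using insert single by (auto intro!: add sum_in_polys_in single_in_polys_in)
    qed
  qed
  from this[of "Poly_Mapping.keys p"] show ?thesis by (simp add: sum_keys_eq)
qed

text \<open>The sum adds up exponents that meet at the same index. This happens for the substitution
  of component representatives, where \<open>\<pi>\<close> is usually not injective.\<close>

definition mon_map :: "(nat \<Rightarrow> nat) \<Rightarrow> (nat \<Rightarrow>\<^sub>0 nat) \<Rightarrow> (nat \<Rightarrow>\<^sub>0 nat)" where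
  "mon_map \<pi> m = (\<Sum>i\<in>Poly_Mapping.keys m. Poly_Mapping.single (\<pi> i) (Poly_Mapping.lookup m i))"

lemma mon_map_add: "mon_map \<pi> (m + m') = mon_map \<pi> m + mon_map \<pi> m'"
  unfolding mon_map_def by (rule setsum_keys_plus_distrib) (simp_all add: single_add)

lemma mon_map_zero [simp]: "mon_map \<pi> 0 = 0"
  by (simp add: mon_map_def)

lemma mon_map_single [simp]: "mon_map \<pi> (Poly_Mapping.single i k) = Poly_Mapping.single (\<pi> i) k"
  by (simp add: mon_map_def)

lemma monom_deg_add: "monom_deg (m + m') = monom_deg m + monom_deg m'"
  unfolding monom_deg_def by (rule setsum_keys_plus_distrib) simp_all

lemma monom_deg_zero [simp]: "monom_deg 0 = 0"
  by (simp add: monom_deg_def)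

lemma monom_deg_single [simp]: "monom_deg (Poly_Mapping.single i k) = k"
  by (simp add: monom_deg_def)

lemma monom_deg_mon_map [simp]: "monom_deg (mon_map \<pi> m) = monom_deg m"
  by (induction m rule: poly_mapping_add_induct) (simp_all add: mon_map_add monom_deg_add)

lemma relabel_alt:
  "relabel \<pi> p = (\<Sum>m\<in>Poly_Mapping.keys p. Poly_Mapping.single (mon_map \<pi> m) (Poly_Mapping.lookup p m))"
  by (simp add: relabel_def mon_map_def)

lemma relabel_zero [simp]: "relabel \<pi> 0 = 0"
  by (simp add: relabel_alt)

lemma relabel_single [simp]: "relabel \<pi> (Poly_Mapping.single m c) = Poly_Mapping.single (mon_map \<pi> m) c"
  by (simp add: relabel_alt)

lemma relabel_add: "relabel \<pi> (p + q) = relabel \<pi> p + relabel \<pi> q"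
  unfolding relabel_alt by (rule setsum_keys_plus_distrib) (simp_all add: single_add)

lemma relabel_uminus: "relabel \<pi> (- p) = - relabel \<pi> p"
  using relabel_add[of \<pi> p "- p"] by (simp add: add_eq_0_iff)

lemma relabel_diff: "relabel \<pi> (p - q) = relabel \<pi> p - relabel \<pi> q"
  using relabel_add[of \<pi> p "- q"] by (simp add: relabel_uminus)

lemma relabel_sum: "relabel \<pi> (sum f A) = (\<Sum>a\<in>A. relabel \<pi> (f a))"
  by (induction A rule: infinite_finite_induct) (simp_all add: relabel_add)

lemma relabel_mult: "relabel \<pi> (p * q) = relabel \<pi> p * relabel \<pi> q"
proof (induction p rule: poly_mapping_add_induct)
  case (add_single p m c)
  have "relabel \<pi> (Poly_Mapping.single m c * q) = Poly_Mapping.single (mon_map \<pi> m) c * relabel \<pi> q"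
    by (induction q rule: poly_mapping_add_induct)
      (simp_all add: relabel_add distrib_left mult_single mon_map_add)
  then show ?case using add_single by (simp add: distrib_right relabel_add)
qed simp

lemma relabel_one [simp]: "relabel \<pi> 1 = 1"
  using relabel_single[of \<pi> 0 1] by simp

lemma relabel_pconst [simp]: "relabel \<pi> (pconst c) = pconst c"
  by (simp add: pconst_def)

lemma relabel_pvar [simp]: "relabel \<pi> (pvar i) = pvar (\<pi> i)"
  by (simp add: pvar_def)

lemma relabel_minus_one_power [simp]: "relabel \<pi> ((-1) ^ k) = (-1) ^ k"
  by (induction k) (simp_all add: relabel_mult relabel_uminus)

lemma relabel_in_polys_in:
  assumes "p \<in> polys_in S" "\<pi> ` S \<subseteq> T"
  shows "relabel \<pi> p \<in> polys_in T"
  using assms(1)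
  by (induction rule: polys_in_induct)
    (use assms(2) in \<open>auto simp: relabel_add relabel_mult intro: add_in_polys_in mult_in_polys_in pvar_in_polys_in\<close>)

lemma relabel_relabel: "relabel \<pi> (relabel \<rho> p) = relabel (\<pi> \<circ> \<rho>) p"
proof -
  have "p \<in> polys_in UNIV" by (simp add: polys_in_def)
  then show ?thesis
    by (induction rule: polys_in_induct) (auto simp: relabel_add relabel_mult)
qed

lemma relabel_fixed:
  assumes "p \<in> polys_in S" "\<And>i. i \<in> S \<Longrightarrow> \<pi> i = i"
  shows "relabel \<pi> p = p"
  using assms(1)
  by (induction rule: polys_in_induct) (use assms(2) in \<open>auto simp: relabel_add relabel_mult\<close>)

section \<open>Homogeneous components of polynomials\<close>

definition hom_part :: "nat \<Rightarrow> qpoly \<Rightarrow> qpoly" where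
  "hom_part j p = (\<Sum>m\<in>Poly_Mapping.keys p.
     if monom_deg m = j then Poly_Mapping.single m (Poly_Mapping.lookup p m) else 0)"

lemma lookup_hom_part:
  "Poly_Mapping.lookup (hom_part j p) m = (if monom_deg m = j then Poly_Mapping.lookup p m else 0)"
proof -
  have "Poly_Mapping.lookup (hom_part j p) m =
      (\<Sum>m'\<in>Poly_Mapping.keys p. if m' = m then (if monom_deg m = j then Poly_Mapping.lookup p m else 0) else 0)"
    unfolding hom_part_def lookup_sum by (intro sum.cong) (auto simp: lookup_single when_def)
  then show ?thesis by (auto simp: in_keys_iff)
qed

lemma keys_hom_part: "Poly_Mapping.keys (hom_part j p) = {m \<in> Poly_Mapping.keys p. monom_deg m = j}"
  by (auto simp: in_keys_iff lookup_hom_part split: if_splits)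

lemma hom_part_add: "hom_part j (p + q) = hom_part j p + hom_part j q"
  by (intro poly_mapping_eqI) (simp add: lookup_hom_part lookup_add)

lemma hom_part_single [simp]:
  "hom_part j (Poly_Mapping.single m c) = (if monom_deg m = j then Poly_Mapping.single m c else 0)"
  by (intro poly_mapping_eqI) (auto simp: lookup_hom_part lookup_single when_def)

lemma hom_part_zero [simp]: "hom_part j 0 = 0"
  by (simp add: hom_part_def)

text \<open>A variable is replaced by a variable, so total degrees survive even when monomials
  collide. Kernels of such substitutions are therefore homogeneous.\<close>

lemma hom_part_relabel: "hom_part j (relabel \<pi> p) = relabel \<pi> (hom_part j p)"
  by (induction p rule: poly_mapping_add_induct) (auto simp: relabel_add hom_part_add)

lemma homogeneous_iff: "p \<in> homogeneous n j \<longleftrightarrow> p \<in> polys_in {..<n} \<and> hom_part j p = p"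
proof
  assume p: "p \<in> homogeneous n j"
  then have "hom_part j p = p"
    by (intro poly_mapping_eqI) (auto simp: lookup_hom_part homogeneous_def in_keys_iff)
  with p show "p \<in> polys_in {..<n} \<and> hom_part j p = p"
    by (simp add: homogeneous_def carrier_poly_ring)
next
  assume "p \<in> polys_in {..<n} \<and> hom_part j p = p"
  then show "p \<in> homogeneous n j"
    using keys_hom_part[of j p] by (auto simp: homogeneous_def carrier_poly_ring)
qed

lemma hom_part_in_polys_in: "p \<in> polys_in S \<Longrightarrow> hom_part j p \<in> polys_in S"
  by (auto simp: polys_in_def keys_hom_part)

lemma hom_part_in_homogeneous: "p \<in> polys_in {..<n} \<Longrightarrow> hom_part j p \<in> homogeneous n j"
  by (auto simp: homogeneous_def carrier_poly_ring hom_part_in_polys_in keys_hom_part)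

lemma hom_part_homogeneous:
  "p \<in> homogeneous n i \<Longrightarrow> hom_part j p = (if j = i then p else 0)"
  by (intro poly_mapping_eqI) (auto simp: lookup_hom_part homogeneous_def in_keys_iff)

lemma sum_hom_part:
  assumes "finite D" "monom_deg ` Poly_Mapping.keys p \<subseteq> D"
  shows "(\<Sum>j\<in>D. hom_part j p) = p"
proof (rule poly_mapping_eqI)
  fix m
  have "monom_deg m \<in> D \<or> Poly_Mapping.lookup p m = 0"
    using assms(2) by (meson image_subset_iff in_keys_iff)
  then show "Poly_Mapping.lookup (\<Sum>j\<in>D. hom_part j p) m = Poly_Mapping.lookup p m"
    by (auto simp: lookup_sum lookup_hom_part assms(1))
qed

lemma hom_part_eq_0: "j \<notin> monom_deg ` Poly_Mapping.keys p \<Longrightarrow> hom_part j p = 0"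
  by (intro poly_mapping_eqI) (auto simp: lookup_hom_part in_keys_iff image_iff)

lemma homogeneous_mult:
  assumes "p \<in> homogeneous n i" "q \<in> homogeneous n j"
  shows "p * q \<in> homogeneous n (i + j)"
proof -
  have "monom_deg m = i + j" if m: "m \<in> Poly_Mapping.keys (p * q)" for m
  proof -
    obtain a b where "m = a + b" "a \<in> Poly_Mapping.keys p" "b \<in> Poly_Mapping.keys q"
      using subsetD[OF keys_mult m] by blast
    then show ?thesis using assms by (simp add: homogeneous_def monom_deg_add)
  qed
  then show ?thesis using assms by (auto simp: homogeneous_def carrier_poly_ring mult_in_polys_in)
qed

lemma homogeneous_relabel:
  assumes "p \<in> homogeneous n j" "\<pi> ` {..<n} \<subseteq> {..<n}"
  shows "relabel \<pi> p \<in> homogeneous n j"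
  using assms relabel_in_polys_in[of p "{..<n}" \<pi> "{..<n}"] by (simp add: homogeneous_iff hom_part_relabel)

section \<open>The ideal of an edge set as the kernel of a substitution\<close>

lemma pos_nth: "distinct xs \<Longrightarrow> k < length xs \<Longrightarrow> pos xs (xs ! k) = k"
  unfolding pos_def by (rule the_equality) (auto simp: nth_eq_iff_index_eq)

lemma nth_pos: 
  assumes "distinct xs" "x \<in> set xs" 
  shows "pos xs x < length xs" "xs ! pos xs x = x"
proof -
  obtain k where "k < length xs" "xs ! k = x" using assms(2) by (auto simp: in_set_conv_nth)
  then show "pos xs x < length xs" "xs ! pos xs x = x" using pos_nth[OF assms(1)] by auto
qed

text \<open>Only the vertex order is fixed here: the ideals and chain modules depend on nothing
  else, while the edge order enters as an argument of the differential.\<close>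

locale ordered_graph = finite_graph G for G :: "('v, 'e) graph" +
  fixes vs :: "'v list"
  assumes vs: "vs \<in> permutations_of_set (verts G)"
begin

abbreviation "n \<equiv> card (verts G)"
abbreviation "R \<equiv> poly_ring n"

sublocale R: cring R
  by (rule cring_poly_ring)

lemma distinct_vs: "distinct vs" and set_vs: "set vs = verts G" and length_vs: "length vs = n"
  using vs distinct_card[of vs] by (auto simp: permutations_of_set_def)

lemma pos_less: "v \<in> verts G \<Longrightarrow> pos vs v < n"
  and nth_pos_vs: "v \<in> verts G \<Longrightarrow> vs ! pos vs v = v"
  using nth_pos[OF distinct_vs] by (auto simp: set_vs length_vs)

lemma pos_nth_vs: "k < n \<Longrightarrow> pos vs (vs ! k) = k"
  using pos_nth[OF distinct_vs] by (simp add: length_vs)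

lemma nth_vs: "k < n \<Longrightarrow> vs ! k \<in> verts G"
  using set_vs length_vs by (metis nth_mem)

text \<open>Extracts the two ends behind the minimum and maximum of positions and shows that there
  are no others; for a loop they coincide.\<close>

lemma edge_poly_cases:
  assumes "e \<in> edges G"
  obtains u v where "u \<in> ends G e" "v \<in> ends G e" "edge_poly G vs e = pvar (pos vs u) - pvar (pos vs v)"
    "ends G e = {u, v}"
proof -
  have *: "finite (pos vs ` ends G e)" "pos vs ` ends G e \<noteq> {}"
    using ends_nonempty[OF assms] ends_verts[OF assms] finite_verts finite_subset by auto
  obtain u v where uv: "Min (pos vs ` ends G e) = pos vs u" "u \<in> ends G e"
    "Max (pos vs ` ends G e) = pos vs v" "v \<in> ends G e"
    by (rule imageE[OF Min_in[OF *]], rule imageE[OF Max_in[OF *]])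
  have sub: "ends G e \<subseteq> verts G" using ends_verts assms by blast
  have "ends G e = {u, v}"
  proof (cases "u = v")
    case True
    \<comment> \<open>Every position lies between the minimum and the maximum, which agree here, and
      a position determines its vertex.\<close>
    have "w = u" if w: "w \<in> ends G e" for w
    proof -
      have "pos vs w = pos vs u"
        using uv True Min_le[OF *(1) imageI[OF w]] Max_ge[OF *(1) imageI[OF w]] by simp
      then show ?thesis using w uv(2) sub nth_pos_vs by (metis subsetD)
    qed
    then have "ends G e \<subseteq> {u}" by (intro subsetI) simp
    with uv True show ?thesis by blast
  next
    case False
    have fin: "finite (ends G e)" using sub finite_verts finite_subset by blast
    \<comment> \<open>Two distinct ends already exhaust a set of at most two elements.\<close>
    have "card (ends G e) \<le> card {u, v}" using card_ends[OF assms] False by auto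
    then show ?thesis using card_seteq[OF fin, of "{u, v}"] uv by simp
  qed
  with uv show thesis
    by (intro that[of u v]) (simp_all only: edge_poly_def)
qed

lemma edge_poly_closed:
  assumes "e \<in> edges G"
  shows "edge_poly G vs e \<in> carrier R"
proof -
  obtain u v where "u \<in> ends G e" "v \<in> ends G e" and
    uv: "edge_poly G vs e = pvar (pos vs u) - pvar (pos vs v)"
    using edge_poly_cases[OF assms] by metis
  then have "pos vs u < n" "pos vs v < n"
    using ends_verts[OF assms] pos_less by auto
  then show ?thesis
    unfolding uv by (simp add: carrier_poly_ring diff_in_polys_in pvar_in_polys_in)
qed

lemma edge_ideal_ideal: "s \<subseteq> edges G \<Longrightarrow> ideal (edge_ideal G vs s) R"
  unfolding edge_ideal_def using edge_poly_closed by (intro R.genideal_ideal) blast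

lemma edge_ideal_subset: "s \<subseteq> edges G \<Longrightarrow> edge_ideal G vs s \<subseteq> carrier R"
  using ideal.Icarr[OF edge_ideal_ideal] by auto

lemma edge_poly_in_ideal: "s \<subseteq> edges G \<Longrightarrow> e \<in> s \<Longrightarrow> edge_poly G vs e \<in> edge_ideal G vs s"
  unfolding edge_ideal_def using edge_poly_closed R.genideal_self[of "edge_poly G vs ` s"] by blast

lemma edge_ideal_minimal:
  assumes "s \<subseteq> edges G" "ideal J R" "\<And>e. e \<in> s \<Longrightarrow> edge_poly G vs e \<in> J"
  shows "edge_ideal G vs s \<subseteq> J"
  unfolding edge_ideal_def using assms by (intro R.genideal_minimal) auto

lemma edge_ideal_mono: "s \<subseteq> t \<Longrightarrow> t \<subseteq> edges G \<Longrightarrow> edge_ideal G vs s \<subseteq> edge_ideal G vs t"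
  by (intro edge_ideal_minimal edge_ideal_ideal edge_poly_in_ideal) auto

lemma edge_ideal_zero: "s \<subseteq> edges G \<Longrightarrow> 0 \<in> edge_ideal G vs s"
  using additive_subgroup.zero_closed[OF ideal.axioms(1)[OF edge_ideal_ideal]] by simp

lemma edge_ideal_add:
  "s \<subseteq> edges G \<Longrightarrow> p \<in> edge_ideal G vs s \<Longrightarrow> q \<in> edge_ideal G vs s \<Longrightarrow> p + q \<in> edge_ideal G vs s"
  using additive_subgroup.a_closed[OF ideal.axioms(1)[OF edge_ideal_ideal]] by simp

lemma edge_ideal_mult:
  "s \<subseteq> edges G \<Longrightarrow> p \<in> edge_ideal G vs s \<Longrightarrow> q \<in> polys_in {..<n} \<Longrightarrow> q * p \<in> edge_ideal G vs s"
  using ideal.I_l_closed[OF edge_ideal_ideal] by (simp add: carrier_poly_ring)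

lemma edge_ideal_uminus:
  "s \<subseteq> edges G \<Longrightarrow> p \<in> edge_ideal G vs s \<Longrightarrow> - p \<in> edge_ideal G vs s"
  using edge_ideal_mult[of s p "-1"] by (simp add: uminus_in_polys_in)

text \<open>The retraction of the vertices onto component representatives, transported to variable
  indices so that \<open>relabel\<close> can use it.\<close>

definition rep :: "'e set \<Rightarrow> nat \<Rightarrow> nat" where
  "rep s k = pos vs (comp_rep (ends G ` s) (vs ! k))"

lemma comp_rep_verts: "s \<subseteq> edges G \<Longrightarrow> v \<in> verts G \<Longrightarrow> comp_rep (ends G ` s) v \<in> verts G"
  using ends_verts by (intro comp_rep_closed) auto

lemma rep_less: "s \<subseteq> edges G \<Longrightarrow> k < n \<Longrightarrow> rep s k < n"
  unfolding rep_def using comp_rep_verts nth_vs pos_less by blast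

lemma rep_pos: "v \<in> verts G \<Longrightarrow> rep s (pos vs v) = pos vs (comp_rep (ends G ` s) v)"
  by (simp add: rep_def nth_pos_vs)

text \<open>Idempotence makes \<open>relabel (rep s)\<close> a retraction onto the subring of
  representative variables, which later gives unique normal forms of classes.\<close>

lemma rep_rep: 
  assumes "s \<subseteq> edges G" "k < n" 
  shows "rep s (rep s k) = rep s k"
proof -
  have "comp_rep (ends G ` s) (comp_rep (ends G ` s) (vs ! k)) = comp_rep (ends G ` s) (vs ! k)"
    by (simp add: comp_rep_eq_iff comp_rep_joined joined_sym)
  then show ?thesis
    using rep_pos[OF comp_rep_verts[OF assms(1) nth_vs[OF assms(2)]]] by (simp add: rep_def)
qed

lemma card_rep_image: 
  assumes "s \<subseteq> edges G" 
  shows "card (rep s ` {..<n}) = ncomp (verts G) (ends G ` s)"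
proof -
  have "(!) vs ` {..<n} = verts G"
    by (metis length_vs lessThan_atLeast0 nth_image order_refl set_vs take_all)
  then have "rep s ` {..<n} = pos vs ` comp_rep (ends G ` s) ` verts G"
    unfolding rep_def by (metis (no_types, lifting) image_cong image_image)
  moreover have "inj_on (pos vs) (comp_rep (ends G ` s) ` verts G)"
    using comp_rep_verts[OF assms] nth_pos_vs by (metis (no_types, lifting) imageE inj_onI)
  ultimately show ?thesis by (simp add: ncomp_def card_image)
qed

text \<open>For arbitrary ends in either order the difference is zero or a generator up to sign.
  This makes the sign convention of \<open>edge_poly\<close> harmless, in particular when the vertex
  order changes.\<close>

lemma diff_ends_in_ideal:
  assumes "s \<subseteq> edges G" "e \<in> s" "u \<in> ends G e" "v \<in> ends G e"
  shows "pvar (pos vs u) - pvar (pos vs v) \<in> edge_ideal G vs s"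
proof -
  have "e \<in> edges G" using assms by blast
  then obtain x y where "edge_poly G vs e = pvar (pos vs x) - pvar (pos vs y)" "ends G e = {x, y}"
    using edge_poly_cases by metis
  then have "pvar (pos vs u) - pvar (pos vs v) \<in> {0, edge_poly G vs e, - edge_poly G vs e}"
    using assms by auto
  then show ?thesis
    using edge_ideal_zero edge_poly_in_ideal[of s e] edge_ideal_uminus[of s "edge_poly G vs e"] assms
    by auto
qed

text \<open>The difference telescopes along a path from the vertex to its representative, each step
  being a difference of two ends of an edge in \<open>s\<close>.\<close>

lemma pvar_diff_rep_in_ideal:
  assumes "s \<subseteq> edges G" "k < n"
  shows "pvar k - pvar (rep s k) \<in> edge_ideal G vs s"
proof -
  have "v \<in> verts G \<and> pvar k - pvar (pos vs v) \<in> edge_ideal G vs s"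
    if "(vs ! k, v) \<in> joined (ends G ` s)" for v
    using that
  proof (induction rule: joined_induct)
    case refl
    then show ?case using assms edge_ideal_zero by (simp add: pos_nth_vs nth_vs)
  next
    case (step x y a)
    then obtain e where e: "e \<in> s" "x \<in> ends G e" "y \<in> ends G e" by blast
    then have e': "e \<in> edges G" using assms by blast
    have "pvar (pos vs x) - pvar (pos vs y) \<in> edge_ideal G vs s"
      using diff_ends_in_ideal assms(1) e by blast
    then have "(pvar k - pvar (pos vs x)) + (pvar (pos vs x) - pvar (pos vs y)) \<in> edge_ideal G vs s"
      using step.IH assms(1) edge_ideal_add by blast
    then show ?case using e e' ends_verts by auto
  qed
  from this[OF comp_rep_joined] show ?thesis unfolding rep_def by simp
qed

text \<open>Congruence modulo an ideal respects sums and products, so the case of a single variable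
  suffices.\<close>

lemma diff_relabel_rep_in_ideal:
  assumes "s \<subseteq> edges G" "p \<in> polys_in {..<n}"
  shows "p - relabel (rep s) p \<in> edge_ideal G vs s"
  using assms(2)
proof (induction rule: polys_in_induct)
  case (const c)
  then show ?case using edge_ideal_zero assms(1) by simp
next
  case (var i)
  then show ?case using pvar_diff_rep_in_ideal assms(1) by simp
next
  case (add p q)
  then show ?case
    using edge_ideal_add[OF assms(1) add(3,4)] by (simp add: relabel_add algebra_simps)
next
  case (mult p q)
  have "relabel (rep s) q \<in> polys_in {..<n}"
    by (rule relabel_in_polys_in[OF mult(2)]) (use rep_less[OF assms(1)] in auto)
  then have "p * (q - relabel (rep s) q) + relabel (rep s) q * (p - relabel (rep s) p) \<in> edge_ideal G vs s"
    using mult assms(1) by (intro edge_ideal_add edge_ideal_mult)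
  then show ?case by (simp add: relabel_mult algebra_simps)
qed

text \<open>The kernel is an ideal, and it contains the generators because the ends of an edge in
  \<open>s\<close> share a representative. Conversely, \<open>p\<close> differs from its
  substitution by an element of the ideal, so it lies there itself when the substitution
  vanishes.\<close>

lemma edge_ideal_eq_kernel:
  assumes "s \<subseteq> edges G"
  shows "edge_ideal G vs s = {p \<in> polys_in {..<n}. relabel (rep s) p = 0}" (is "_ = ?K")
proof
  have "ideal ?K R"
  proof (rule idealI)
    show "ring R" by (rule R.ring_axioms)
    show "subgroup ?K (add_monoid R)"
    proof (rule R.add.subgroupI)
      show "?K \<noteq> {}" using zero_in_polys_in relabel_zero by blast
    next
      fix a assume "a \<in> ?K"
      then show "\<ominus>\<^bsub>R\<^esub> a \<in> ?K" by (simp add: carrier_poly_ring uminus_in_polys_in relabel_uminus)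
    qed (auto simp: carrier_poly_ring relabel_add add_in_polys_in)
  qed (simp_all add: carrier_poly_ring mult_in_polys_in relabel_mult)
  moreover have "edge_poly G vs e \<in> ?K" if e: "e \<in> s" for e
  proof -
    have "e \<in> edges G" using assms e by blast
    then obtain u v where uv: "u \<in> ends G e" "v \<in> ends G e"
      "edge_poly G vs e = pvar (pos vs u) - pvar (pos vs v)"
      using edge_poly_cases by metis
    have "comp_rep (ends G ` s) u = comp_rep (ends G ` s) v"
      unfolding comp_rep_eq_iff using uv e by (intro joined_step[of "ends G e"]) auto
    moreover have "u \<in> verts G" "v \<in> verts G" using uv ends_verts \<open>e \<in> edges G\<close> by auto
    ultimately show ?thesis
      using edge_poly_closed[OF \<open>e \<in> edges G\<close>] uv(3)
      by (simp add: relabel_diff rep_pos carrier_poly_ring)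
  qed
  ultimately show "edge_ideal G vs s \<subseteq> ?K"
    using edge_ideal_minimal[OF assms] by blast
  show "?K \<subseteq> edge_ideal G vs s"
    using diff_relabel_rep_in_ideal[OF assms] by force
qed

text \<open>Taking homogeneous parts commutes with the substitution and hence preserves its
  kernel.\<close>

lemma hom_part_edge_ideal:
  "s \<subseteq> edges G \<Longrightarrow> p \<in> edge_ideal G vs s \<Longrightarrow> hom_part j p \<in> edge_ideal G vs s"
  by (simp add: edge_ideal_eq_kernel hom_part_in_polys_in flip: hom_part_relabel)

end

section \<open>Graded modules\<close>

lemma (in abelian_subgroup) rcos_eq_iff:
  assumes "x \<in> carrier G" "y \<in> carrier G"
  shows "H +> x = H +> y \<longleftrightarrow> x \<ominus> y \<in> H"
proof
  assume "H +> x = H +> y"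
  then have "x \<in> H +> y" using a_rcos_self[OF assms(1)] by simp
  then show "x \<ominus> y \<in> H"
    using assms by (simp add: a_minus_def a_rcos_module)
next
  assume "x \<ominus> y \<in> H"
  then have "x \<in> H +> y" using assms by (simp add: a_minus_def a_rcos_module)
  then show "H +> x = H +> y" using a_repr_independence' assms by metis
qed

text \<open>Reads the component off the unique decomposition in \<open>graded_module\<close>, so
  that projections need not be part of the structure.\<close>

definition gpart :: "('a, 'b) graded_module \<Rightarrow> nat \<Rightarrow> 'b \<Rightarrow> 'b" where
  "gpart M j x = (THE f. (\<forall>j. f j \<in> piece M j) \<and> finite {j. f j \<noteq> \<zero>\<^bsub>M\<^esub>} \<and>
     x = (\<Oplus>\<^bsub>M\<^esub>j\<in>{j. f j \<noteq> \<zero>\<^bsub>M\<^esub>}. f j)) j"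

lemma (in abelian_monoid) finsum_support:
  assumes "finite A" "\<And>j. j \<notin> A \<Longrightarrow> f j = \<zero>" "\<And>j. f j \<in> carrier G"
  shows "(\<Oplus>j\<in>{j. f j \<noteq> \<zero>}. f j) = (\<Oplus>j\<in>A. f j)"
  using assms by (intro add.finprod_mono_neutral_cong_left) auto

text \<open>Projections that are additive, the identity on their own piece and zero on all others
  give unique decompositions: applying \<open>pr i\<close> to any decomposition returns its term of
  degree \<open>i\<close>. Each construction below comes with evident projections of this
  kind.\<close>

lemma graded_moduleI:
  fixes M (structure)
  assumes "module (poly_ring n) M"
    and sub: "\<And>j. subgroup (piece M j) (add_monoid M)"
    and smult: "\<And>a x i j. a \<in> homogeneous n i \<Longrightarrow> x \<in> piece M j \<Longrightarrow> a \<odot> x \<in> piece M (i + j)"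
    and pr: "\<And>j x. x \<in> carrier M \<Longrightarrow> pr j x \<in> piece M j"
    and pr_add: "\<And>j x y. x \<in> carrier M \<Longrightarrow> y \<in> carrier M \<Longrightarrow> pr j (x \<oplus> y) = pr j x \<oplus> pr j y"
    and pr_piece: "\<And>i j x. x \<in> piece M i \<Longrightarrow> pr j x = (if j = i then x else \<zero>)"
    and decomp: "\<And>x. x \<in> carrier M \<Longrightarrow>
       \<exists>A. finite A \<and> (\<forall>j. j \<notin> A \<longrightarrow> pr j x = \<zero>) \<and> x = (\<Oplus>j\<in>A. pr j x)"
  shows "graded_module n M"
proof -
  interpret module "poly_ring n" M by fact
  have piece_carrier: "x \<in> piece M j \<Longrightarrow> x \<in> carrier M" for x j
    using subgroup.subset[OF sub] by auto
  have zero_piece: "\<zero> \<in> piece M j" for j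
    using subgroup.one_closed[OF sub] by simp
  show ?thesis
  proof (rule graded_module.intro[OF assms(1) sub smult])
    fix x assume x: "x \<in> carrier M"
    show "\<exists>!f. (\<forall>j. f j \<in> piece M j) \<and> finite {j. f j \<noteq> \<zero>} \<and> x = (\<Oplus>j\<in>{j. f j \<noteq> \<zero>}. f j)"
    proof (rule ex1I)
      obtain A where A: "finite A" "\<And>j. j \<notin> A \<Longrightarrow> pr j x = \<zero>" "x = (\<Oplus>j\<in>A. pr j x)"
        using decomp[OF x] by metis
      have "finite {j. pr j x \<noteq> \<zero>}"
        by (rule finite_subset[OF _ A(1)]) (use A(2) in blast)
      moreover have "(\<Oplus>j\<in>{j. pr j x \<noteq> \<zero>}. pr j x) = (\<Oplus>j\<in>A. pr j x)"
        by (rule M.finsum_support) (use A pr[OF x] piece_carrier in blast)+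
      ultimately show "(\<forall>j. pr j x \<in> piece M j) \<and> finite {j. pr j x \<noteq> \<zero>} \<and>
          x = (\<Oplus>j\<in>{j. pr j x \<noteq> \<zero>}. pr j x)"
        using A(3) pr[OF x] by simp
    next
      fix f assume "(\<forall>j. f j \<in> piece M j) \<and> finite {j. f j \<noteq> \<zero>} \<and> x = (\<Oplus>j\<in>{j. f j \<noteq> \<zero>}. f j)"
      then have f: "\<And>j. f j \<in> piece M j" "finite {j. f j \<noteq> \<zero>}" "x = (\<Oplus>j\<in>{j. f j \<noteq> \<zero>}. f j)"
        by auto
      have pr_sum: "pr i (\<Oplus>j\<in>A. f j) = (\<Oplus>j\<in>A. pr i (f j))" if "finite A" for A i
        using that
      proof (induction A rule: finite_induct)
        case empty
        have "pr i \<zero> = \<zero>" using pr_piece[OF zero_piece[of i], of i] by simp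
        then show ?case by simp
      next
        case (insert a A)
        have "f j \<in> carrier M" "pr i (f j) \<in> carrier M" for j
          using f(1) piece_carrier pr by blast+
        then show ?case using insert by (simp add: pr_add)
      qed
      show "f = (\<lambda>j. pr j x)"
      proof
        fix i
        have "pr i x = (\<Oplus>j\<in>{j. f j \<noteq> \<zero>}. pr i (f j))"
          using pr_sum[OF f(2), of i] f(3) by simp
        also have "\<dots> = (\<Oplus>j\<in>{j. f j \<noteq> \<zero>}. if i = j then f j else \<zero>)"
          using pr_piece[OF f(1)] by simp
        also have "\<dots> = f i"
        proof (cases "f i = \<zero>")
          case True
          then have "(\<Oplus>j\<in>{j. f j \<noteq> \<zero>}. if i = j then f j else \<zero>) = (\<Oplus>j\<in>{j. f j \<noteq> \<zero>}. \<zero>)"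
            by (intro M.finsum_cong') auto
          then show ?thesis using True by simp
        next
          case False
          then show ?thesis
            using f piece_carrier by (intro M.add.finprod_singleton) auto
        qed
        finally show "f i = pr i x" by simp
      qed
    qed
  qed
qed

context graded_module
begin

sublocale module "poly_ring n" M
  by (rule is_module)

lemma piece_carrier: "x \<in> piece M j \<Longrightarrow> x \<in> carrier M"
  using subgroup.subset[OF piece_subgroup] by auto

lemma piece_zero [simp]: "\<zero> \<in> piece M j"
  using subgroup.one_closed[OF piece_subgroup] by simp

lemma piece_add: "x \<in> piece M j \<Longrightarrow> y \<in> piece M j \<Longrightarrow> x \<oplus> y \<in> piece M j"
  using subgroup.m_closed[OF piece_subgroup] by simp

lemma piece_a_inv: "x \<in> piece M j \<Longrightarrow> \<ominus> x \<in> piece M j"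
  using subgroup.m_inv_closed[OF piece_subgroup] by (simp add: a_inv_def)

lemma
  assumes "x \<in> carrier M"
  shows gpart_piece: "gpart M j x \<in> piece M j"
    and gpart_finite: "finite {j. gpart M j x \<noteq> \<zero>}"
    and gpart_sum: "x = (\<Oplus>j\<in>{j. gpart M j x \<noteq> \<zero>}. gpart M j x)"
  using theI'[OF piece_decomposition[OF assms]] by (simp_all add: gpart_def)

lemma gpart_carrier: "x \<in> carrier M \<Longrightarrow> gpart M j x \<in> carrier M"
  using gpart_piece piece_carrier by blast

lemma gpart_unique:
  assumes "finite A" "\<And>j. f j \<in> piece M j" "\<And>j. j \<notin> A \<Longrightarrow> f j = \<zero>" "x = (\<Oplus>j\<in>A. f j)"
  shows "gpart M j x = f j"
proof -
  have f: "\<And>j. f j \<in> carrier M" using assms(2) piece_carrier by blast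
  then have x: "x \<in> carrier M" using assms(4) by simp
  have "finite {j. f j \<noteq> \<zero>}"
    by (rule finite_subset[OF _ assms(1)]) (use assms(3) in blast)
  moreover have "x = (\<Oplus>j\<in>{j. f j \<noteq> \<zero>}. f j)"
    using M.finsum_support[OF assms(1,3) f] assms(4) by simp
  ultimately show ?thesis
    unfolding gpart_def using assms(2) by (subst the1_equality[OF piece_decomposition[OF x], of f]) auto
qed

text \<open>Lets several elements be decomposed over one common finite set of degrees.\<close>

lemma gpart_sum_superset:
  assumes "x \<in> carrier M" "finite A" "{j. gpart M j x \<noteq> \<zero>} \<subseteq> A"
  shows "x = (\<Oplus>j\<in>A. gpart M j x)"
proof -
  have "(\<Oplus>j\<in>{j. gpart M j x \<noteq> \<zero>}. gpart M j x) = (\<Oplus>j\<in>A. gpart M j x)"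
    by (rule M.finsum_support) (use assms gpart_carrier in auto)
  then show ?thesis using gpart_sum[OF assms(1)] by simp
qed

lemma gpart_add:
  assumes "x \<in> carrier M" "y \<in> carrier M"
  shows "gpart M j (x \<oplus> y) = gpart M j x \<oplus> gpart M j y"
proof -
  define A where "A = {j. gpart M j x \<noteq> \<zero>} \<union> {j. gpart M j y \<noteq> \<zero>}"
  have fin: "finite A" using assms gpart_finite by (simp add: A_def)
  have "x = (\<Oplus>j\<in>A. gpart M j x)" "y = (\<Oplus>j\<in>A. gpart M j y)"
    using gpart_sum_superset[OF assms(1) fin] gpart_sum_superset[OF assms(2) fin] by (auto simp: A_def)
  moreover have "(\<Oplus>j\<in>A. gpart M j x \<oplus> gpart M j y) = (\<Oplus>j\<in>A. gpart M j x) \<oplus> (\<Oplus>j\<in>A. gpart M j y)"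
    by (rule M.finsum_addf) (use assms gpart_carrier in auto)
  ultimately have "x \<oplus> y = (\<Oplus>j\<in>A. gpart M j x \<oplus> gpart M j y)" by simp
  then show ?thesis
    by (intro gpart_unique[OF fin]) (use assms gpart_piece piece_add in \<open>auto simp: A_def\<close>)
qed

lemma gpart_of_piece:
  assumes "x \<in> piece M i"
  shows "gpart M j x = (if j = i then x else \<zero>)"
  by (rule gpart_unique[where A = "{i}"]) (use assms piece_carrier in auto)

lemma gpart_zero [simp]: "gpart M j \<zero> = \<zero>"
  using gpart_of_piece[OF piece_zero[of j], of j] by simp

lemma gpart_a_inv:
  assumes "x \<in> carrier M"
  shows "gpart M j (\<ominus> x) = \<ominus> gpart M j x"
proof -
  have "gpart M j (\<ominus> x) \<oplus> gpart M j x = \<zero>"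
    using gpart_add[of "\<ominus> x" x j] assms by (simp add: M.l_neg)
  then show ?thesis using assms gpart_carrier by (intro M.minus_equality[symmetric]) auto
qed

lemma gpart_minus:
  "x \<in> carrier M \<Longrightarrow> y \<in> carrier M \<Longrightarrow> gpart M j (x \<ominus> y) = gpart M j x \<ominus> gpart M j y"
  by (simp add: a_minus_def gpart_add gpart_a_inv)

end

section \<open>Graded submodules and their quotients\<close>

definition graded_submodule :: "nat \<Rightarrow> (qpoly, 'b) graded_module \<Rightarrow> 'b set \<Rightarrow> bool" where
  "graded_submodule n M N \<longleftrightarrow> N \<subseteq> carrier M \<and> \<zero>\<^bsub>M\<^esub> \<in> N \<and>
     (\<forall>x\<in>N. \<forall>y\<in>N. x \<oplus>\<^bsub>M\<^esub> y \<in> N) \<and>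
     (\<forall>a\<in>carrier (poly_ring n). \<forall>x\<in>N. a \<odot>\<^bsub>M\<^esub> x \<in> N) \<and>
     (\<forall>x\<in>N. \<forall>j. gpart M j x \<in> N)"

lemma submodule_on_simps [simp]:
  "carrier (submodule_on M N) = N" "add (submodule_on M N) = add M"
  "ring.zero (submodule_on M N) = ring.zero M" "smult (submodule_on M N) = smult M"
  "piece (submodule_on M N) j = piece M j \<inter> N"
  by (simp_all add: submodule_on_def)

lemma quotient_module_simps [simp]:
  "carrier (quotient_module M N) = a_rcosets\<^bsub>M\<^esub> N" "add (quotient_module M N) = set_add M"
  "ring.zero (quotient_module M N) = N"
  "smult (quotient_module M N) = (\<lambda>a C. \<Union>x\<in>C. N +>\<^bsub>M\<^esub> (a \<odot>\<^bsub>M\<^esub> x))"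
  "piece (quotient_module M N) j = (\<lambda>x. N +>\<^bsub>M\<^esub> x) ` piece M j"
  by (simp_all add: quotient_module_def)

lemma direct_sum_simps [simp]:
  "carrier (direct_sum S M) = (\<Pi>\<^sub>E s\<in>S. carrier (M s))"
  "ring.zero (direct_sum S M) = (\<lambda>s\<in>S. \<zero>\<^bsub>M s\<^esub>)"
  "add (direct_sum S M) = (\<lambda>x y. \<lambda>s\<in>S. x s \<oplus>\<^bsub>M s\<^esub> y s)"
  "smult (direct_sum S M) = (\<lambda>a x. \<lambda>s\<in>S. a \<odot>\<^bsub>M s\<^esub> x s)"
  "piece (direct_sum S M) j = (\<Pi>\<^sub>E s\<in>S. piece (M s) j)"
  by (simp_all add: direct_sum_def)

locale graded_submodule_of = graded_module n M for n and M (structure) +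
  fixes N
  assumes N: "graded_submodule n M N"
begin

lemma N_carrier: "x \<in> N \<Longrightarrow> x \<in> carrier M"
  and N_zero [simp]: "\<zero> \<in> N"
  and N_add: "x \<in> N \<Longrightarrow> y \<in> N \<Longrightarrow> x \<oplus> y \<in> N"
  and N_smult: "a \<in> carrier (poly_ring n) \<Longrightarrow> x \<in> N \<Longrightarrow> a \<odot> x \<in> N"
  and N_gpart: "x \<in> N \<Longrightarrow> gpart M j x \<in> N"
  using N by (auto simp: graded_submodule_def)

text \<open>Negation is multiplication by the scalar \<open>-1\<close>, so closure under negatives
  follows from closure under scalars.\<close>

lemma N_a_inv: 
  assumes "x \<in> N" 
  shows "\<ominus> x \<in> N"
proof -
  have "(\<ominus>\<^bsub>poly_ring n\<^esub> \<one>\<^bsub>poly_ring n\<^esub>) \<odot> x = \<ominus> x"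
    using smult_l_minus[of "\<one>\<^bsub>poly_ring n\<^esub>" x] N_carrier[OF assms] by (simp del: poly_ring_simps)
  then show ?thesis using N_smult[OF R.a_inv_closed[OF R.one_closed] assms] by simp
qed

lemma subgroup_N: "subgroup N (add_monoid M)"
proof (rule M.add.subgroupI)
  show "N \<noteq> {}" by (metis N_zero empty_iff)
qed (use N_carrier N_add N_a_inv in \<open>auto simp: a_inv_def[symmetric]\<close>)

sublocale sub: abelian_subgroup N M
  using subgroup_N M.abelian_group_axioms by (intro abelian_subgroupI3 additive_subgroupI)

lemma module_submodule_on: "module (poly_ring n) (submodule_on M N)"
proof (rule moduleI)
  show "abelian_group (submodule_on M N)"
  proof (rule abelian_groupI)
    fix x assume "x \<in> carrier (submodule_on M N)"
    then show "\<exists>y\<in>carrier (submodule_on M N). y \<oplus>\<^bsub>submodule_on M N\<^esub> x = \<zero>\<^bsub>submodule_on M N\<^esub>"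
      using N_a_inv N_carrier by (intro bexI[of _ "\<ominus> x"]) (simp_all add: M.l_neg)
  qed (auto simp: N_add N_carrier M.a_assoc intro: M.a_comm)
qed (auto simp: N_smult N_carrier smult_l_distr smult_r_distr smult_assoc1 R.cring_axioms
    simp del: poly_ring_simps)

lemma finsum_submodule_on:
  assumes "finite A" "\<And>j. j \<in> A \<Longrightarrow> f j \<in> N"
  shows "finsum (submodule_on M N) f A = finsum M f A"
proof -
  interpret S: module "poly_ring n" "submodule_on M N" by (rule module_submodule_on)
  show ?thesis
    using assms by (induction A rule: finite_induct) (auto simp: N_carrier)
qed

lemma graded_module_submodule_on: "graded_module n (submodule_on M N)"
proof (rule graded_moduleI[where pr = "gpart M"])
  show "module (poly_ring n) (submodule_on M N)" by (rule module_submodule_on)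
  interpret S: module "poly_ring n" "submodule_on M N" by (rule module_submodule_on)
  have inv: "\<ominus>\<^bsub>submodule_on M N\<^esub> x = \<ominus> x" if "x \<in> N" for x
    by (rule S.M.minus_equality) (use that N_a_inv N_carrier in \<open>simp_all add: M.l_neg\<close>)
  show "subgroup (piece (submodule_on M N) j) (add_monoid (submodule_on M N))" for j
  proof (rule S.M.add.subgroupI)
    show "piece (submodule_on M N) j \<noteq> {}"
      by (metis IntI N_zero piece_zero empty_iff submodule_on_simps(5))
  qed (auto simp: a_inv_def[symmetric] inv piece_a_inv N_a_inv piece_add N_add)
  fix x assume x: "x \<in> carrier (submodule_on M N)"
  then have x': "x \<in> N" "x \<in> carrier M" using N_carrier by auto
  show "gpart M j x \<in> piece (submodule_on M N) j" for j
    using x' N_gpart gpart_piece by simp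
  show "\<exists>A. finite A \<and> (\<forall>j. j \<notin> A \<longrightarrow> gpart M j x = \<zero>\<^bsub>submodule_on M N\<^esub>) \<and>
      x = (\<Oplus>\<^bsub>submodule_on M N\<^esub>j\<in>A. gpart M j x)"
  proof (intro exI conjI)
    show "finite {j. gpart M j x \<noteq> \<zero>}" using gpart_finite x' by simp
    have "(\<Oplus>\<^bsub>submodule_on M N\<^esub>j\<in>{j. gpart M j x \<noteq> \<zero>}. gpart M j x)
      = (\<Oplus>j\<in>{j. gpart M j x \<noteq> \<zero>}. gpart M j x)"
      using x' N_gpart by (intro finsum_submodule_on gpart_finite)
    then show "x = (\<Oplus>\<^bsub>submodule_on M N\<^esub>j\<in>{j. gpart M j x \<noteq> \<zero>}. gpart M j x)"
      using gpart_sum[OF x'(2)] by simp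
  qed simp
qed (use N_carrier N_smult piece_smult gpart_add gpart_of_piece in \<open>auto simp: homogeneous_def\<close>)

text \<open>The ambient decomposition of an element of \<open>N\<close> already runs inside
  \<open>N\<close>, and decompositions are unique. Thus gradedness of the boundaries passes from the
  chain module to the module of cycles.\<close>

lemma gpart_submodule_on: 
  assumes "x \<in> N" 
  shows "gpart (submodule_on M N) j x = gpart M j x"
proof (rule graded_module.gpart_unique[OF graded_module_submodule_on gpart_finite])
  show "x \<in> carrier M" using assms N_carrier by simp
  then show "gpart M j x \<in> piece (submodule_on M N) j" for j
    using assms N_gpart gpart_piece by simp
  have "(\<Oplus>\<^bsub>submodule_on M N\<^esub>j\<in>{j. gpart M j x \<noteq> \<zero>}. gpart M j x)
      = (\<Oplus>j\<in>{j. gpart M j x \<noteq> \<zero>}. gpart M j x)"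
    using assms N_gpart N_carrier by (intro finsum_submodule_on gpart_finite)
  then show "x = (\<Oplus>\<^bsub>submodule_on M N\<^esub>j\<in>{j. gpart M j x \<noteq> \<zero>}. gpart M j x)"
    using gpart_sum[OF N_carrier[OF assms]] by simp
qed auto

lemma carrier_quotient: "C \<in> a_rcosets N \<longleftrightarrow> (\<exists>x\<in>carrier M. C = N +> x)"
  by (auto simp: A_RCOSETS_def' )

lemma rcos_in_rcosets: "x \<in> carrier M \<Longrightarrow> N +> x \<in> a_rcosets N"
  using carrier_quotient by blast

lemma set_add_rcos: "x \<in> carrier M \<Longrightarrow> y \<in> carrier M \<Longrightarrow> (N +> x) <+> (N +> y) = N +> (x \<oplus> y)"
  by (rule sub.a_rcos_sum)

lemma rcos_eq_iff: "x \<in> carrier M \<Longrightarrow> y \<in> carrier M \<Longrightarrow> N +> x = N +> y \<longleftrightarrow> x \<ominus> y \<in> N"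
  by (rule sub.rcos_eq_iff)

lemma rcos_mem: "x \<in> carrier M \<Longrightarrow> y \<in> N +> x \<Longrightarrow> y \<in> carrier M \<and> N +> y = N +> x"
  using sub.a_elemrcos_carrier sub.a_repr_independence' by metis

text \<open>All cosets in the union coincide: two representatives differ by an element of
  \<open>N\<close>, and multiplying this difference by \<open>a\<close> stays in
  \<open>N\<close>.\<close>

lemma smult_rcos:
  assumes "a \<in> carrier (poly_ring n)" "x \<in> carrier M"
  shows "(\<Union>y\<in>N +> x. N +> (a \<odot> y)) = N +> (a \<odot> x)"
proof -
  have "N +> (a \<odot> y) = N +> (a \<odot> x)" if "y \<in> N +> x" for y
  proof -
    have y: "y \<in> carrier M" "y \<ominus> x \<in> N" 
      using rcos_mem[OF assms(2) that] rcos_eq_iff assms(2) by auto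
    have "a \<odot> y \<ominus> a \<odot> x = a \<odot> (y \<ominus> x)"
      using y assms by (simp add: a_minus_def smult_r_distr smult_r_minus)
    then show ?thesis using rcos_eq_iff y assms N_smult by simp
  qed
  then show ?thesis using sub.a_rcos_self[OF assms(2)] by blast
qed

lemma rcos_zero [simp]: "N +> \<zero> = N"
  using sub.a_rcos_const N_zero by simp

lemma module_quotient: "module (poly_ring n) (quotient_module M N)"
proof (rule moduleI)
  show "abelian_group (quotient_module M N)"
  proof (rule abelian_groupI)
    fix C assume "C \<in> carrier (quotient_module M N)"
    then obtain x where x: "x \<in> carrier M" "C = N +> x" by (auto simp: carrier_quotient)
    show "\<exists>D\<in>carrier (quotient_module M N). D \<oplus>\<^bsub>quotient_module M N\<^esub> C = \<zero>\<^bsub>quotient_module M N\<^esub>"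
    proof (rule bexI[of _ "N +> (\<ominus> x)"])
      show "N +> (\<ominus> x) \<in> carrier (quotient_module M N)" using x carrier_quotient by auto
      show "(N +> (\<ominus> x)) \<oplus>\<^bsub>quotient_module M N\<^esub> C = \<zero>\<^bsub>quotient_module M N\<^esub>"
        using x by (simp add: set_add_rcos M.l_neg)
    qed
    show "\<zero>\<^bsub>quotient_module M N\<^esub> \<oplus>\<^bsub>quotient_module M N\<^esub> C = C" 
      using set_add_rcos[of \<zero> x] x by simp
  next
    show "\<zero>\<^bsub>quotient_module M N\<^esub> \<in> carrier (quotient_module M N)"
      using carrier_quotient rcos_zero M.zero_closed by (metis quotient_module_simps(1,3))
  next
    fix C D E
    assume "C \<in> carrier (quotient_module M N)" "D \<in> carrier (quotient_module M N)"
      "E \<in> carrier (quotient_module M N)"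
    then obtain x y z where "x \<in> carrier M" "y \<in> carrier M" "z \<in> carrier M"
      "C = N +> x" "D = N +> y" "E = N +> z" by (auto simp: carrier_quotient)
    then show "C \<oplus>\<^bsub>quotient_module M N\<^esub> D \<oplus>\<^bsub>quotient_module M N\<^esub> E =
        C \<oplus>\<^bsub>quotient_module M N\<^esub> (D \<oplus>\<^bsub>quotient_module M N\<^esub> E)"
      by (simp add: set_add_rcos M.a_assoc)
  next
    fix C D
    assume "C \<in> carrier (quotient_module M N)" "D \<in> carrier (quotient_module M N)"
    then obtain x y where "x \<in> carrier M" "y \<in> carrier M" "C = N +> x" "D = N +> y"
      by (auto simp: carrier_quotient)
    then show "C \<oplus>\<^bsub>quotient_module M N\<^esub> D = D \<oplus>\<^bsub>quotient_module M N\<^esub> C"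
      by (simp add: set_add_rcos M.a_comm)
  qed (auto simp: carrier_quotient set_add_rcos)
next
  let ?Q = "quotient_module M N"
  fix a b C D
  assume "C \<in> carrier ?Q" "D \<in> carrier ?Q"
  then obtain x y where x: "x \<in> carrier M" "C = N +> x" and y: "y \<in> carrier M" "D = N +> y"
    by (auto simp: carrier_quotient)
  show "\<one>\<^bsub>poly_ring n\<^esub> \<odot>\<^bsub>?Q\<^esub> C = C"
    using x by (simp add: smult_rcos del: poly_ring_simps)
  assume a: "a \<in> carrier (poly_ring n)"
  show "a \<odot>\<^bsub>?Q\<^esub> C \<in> carrier ?Q"
    using a x rcos_in_rcosets by (simp add: smult_rcos)
  show "a \<odot>\<^bsub>?Q\<^esub> (C \<oplus>\<^bsub>?Q\<^esub> D) = a \<odot>\<^bsub>?Q\<^esub> C \<oplus>\<^bsub>?Q\<^esub> a \<odot>\<^bsub>?Q\<^esub> D"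
    using a x y by (simp add: smult_rcos set_add_rcos smult_r_distr)
  assume b: "b \<in> carrier (poly_ring n)"
  show "(a \<oplus>\<^bsub>poly_ring n\<^esub> b) \<odot>\<^bsub>?Q\<^esub> C = a \<odot>\<^bsub>?Q\<^esub> C \<oplus>\<^bsub>?Q\<^esub> b \<odot>\<^bsub>?Q\<^esub> C"
    using a b x by (simp add: smult_rcos set_add_rcos smult_l_distr del: poly_ring_simps)
  show "(a \<otimes>\<^bsub>poly_ring n\<^esub> b) \<odot>\<^bsub>?Q\<^esub> C = a \<odot>\<^bsub>?Q\<^esub> (b \<odot>\<^bsub>?Q\<^esub> C)"
    using a b x by (simp add: smult_rcos smult_assoc1 del: poly_ring_simps)
qed (rule R.cring_axioms)

lemma finsum_quotient:
  assumes "finite A" "\<And>j. j \<in> A \<Longrightarrow> f j \<in> carrier M"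
  shows "(\<Oplus>\<^bsub>quotient_module M N\<^esub>j\<in>A. N +> f j) = N +> (\<Oplus>j\<in>A. f j)"
proof -
  interpret Q: module "poly_ring n" "quotient_module M N" by (rule module_quotient)
  show ?thesis
    using assms
  proof (induction A rule: finite_induct)
    case (insert a A)
    have "N +> f j \<in> carrier (quotient_module M N)" if "j \<in> insert a A" for j
      using insert.prems[OF that] carrier_quotient by auto
    then have "(\<Oplus>\<^bsub>quotient_module M N\<^esub>j\<in>insert a A. N +> f j)
      = (N +> f a) <+> (\<Oplus>\<^bsub>quotient_module M N\<^esub>j\<in>A. N +> f j)"
      using insert.hyps by (subst Q.M.finsum_insert) auto
    then show ?case using insert by (simp add: set_add_rcos)
  qed simp
qed

text \<open>The projection of a coset is defined through a chosen representative. The choice does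
  not matter exactly because \<open>N\<close> is closed under \<open>gpart\<close>: representatives
  differ by an element of \<open>N\<close>, and so do their components.\<close>

lemma graded_module_quotient: "graded_module n (quotient_module M N)"
proof -
  define pr where "pr j C = N +> gpart M j (SOME x. x \<in> carrier M \<and> C = N +> x)" for j C
  have pr: "pr j (N +> x) = N +> gpart M j x" if "x \<in> carrier M" for j x
  proof -
    define y where "y = (SOME y. y \<in> carrier M \<and> N +> x = N +> y)"
    have y: "y \<in> carrier M" "N +> x = N +> y"
      using someI[of "\<lambda>y. y \<in> carrier M \<and> N +> x = N +> y" x] that by (auto simp: y_def)
    then have "gpart M j (y \<ominus> x) \<in> N" using N_gpart rcos_eq_iff that by metis
    then have "gpart M j y \<ominus> gpart M j x \<in> N" using gpart_minus y that by simp
    then show ?thesis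
      using rcos_eq_iff gpart_carrier y(1) that by (simp add: pr_def y_def[symmetric])
  qed
  interpret Q: module "poly_ring n" "quotient_module M N" by (rule module_quotient)
  have inv: "\<ominus>\<^bsub>quotient_module M N\<^esub> (N +> x) = N +> (\<ominus> x)" if "x \<in> carrier M" for x
    by (rule Q.M.minus_equality) (use that in \<open>auto simp: carrier_quotient set_add_rcos M.l_neg\<close>)
  show ?thesis
  proof (rule graded_moduleI[where pr = pr])
    show "module (poly_ring n) (quotient_module M N)" by (rule module_quotient)
    show "subgroup (piece (quotient_module M N) j) (add_monoid (quotient_module M N))" for j
    proof (rule Q.M.add.subgroupI)
      show "piece (quotient_module M N) j \<noteq> {}"
        by (metis piece_zero empty_iff image_is_empty quotient_module_simps(5))
      show "piece (quotient_module M N) j \<subseteq> carrier (quotient_module M N)"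
        using piece_carrier rcos_in_rcosets by auto
    next
      fix C assume "C \<in> piece (quotient_module M N) j"
      then obtain x where "x \<in> piece M j" "C = N +> x" by auto
      then show "\<ominus>\<^bsub>quotient_module M N\<^esub> C \<in> piece (quotient_module M N) j"
        using inv piece_carrier piece_a_inv by auto
    next
      fix C D assume "C \<in> piece (quotient_module M N) j" "D \<in> piece (quotient_module M N) j"
      then obtain x y where "x \<in> piece M j" "C = N +> x" "y \<in> piece M j" "D = N +> y" by auto
      then show "C \<oplus>\<^bsub>quotient_module M N\<^esub> D \<in> piece (quotient_module M N) j"
        using piece_carrier piece_add by (auto simp: set_add_rcos)
    qed
    show "a \<odot>\<^bsub>quotient_module M N\<^esub> C \<in> piece (quotient_module M N) (i + j)"
      if a: "a \<in> homogeneous n i" and C: "C \<in> piece (quotient_module M N) j" for a C i j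
    proof -
      obtain x where x: "x \<in> piece M j" "C = N +> x" using C by auto
      have "a \<in> carrier (poly_ring n)" using a by (simp add: homogeneous_def)
      then show ?thesis
        using x piece_carrier[OF x(1)] piece_smult[OF a x(1)] by (simp add: smult_rcos)
    qed
    fix C assume C: "C \<in> carrier (quotient_module M N)"
    then obtain x where x: "x \<in> carrier M" "C = N +> x" by (auto simp: carrier_quotient)
    show "pr j C \<in> piece (quotient_module M N) j" for j
      using x pr gpart_piece by auto
    show "pr j (C \<oplus>\<^bsub>quotient_module M N\<^esub> D) = pr j C \<oplus>\<^bsub>quotient_module M N\<^esub> pr j D"
      if D: "D \<in> carrier (quotient_module M N)" for j D
    proof -
      obtain y where "y \<in> carrier M" "D = N +> y" using D by (auto simp: carrier_quotient)
      then show ?thesis using x by (simp add: set_add_rcos pr gpart_add gpart_carrier)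
    qed
    show "\<exists>A. finite A \<and> (\<forall>j. j \<notin> A \<longrightarrow> pr j C = \<zero>\<^bsub>quotient_module M N\<^esub>) \<and>
      C = (\<Oplus>\<^bsub>quotient_module M N\<^esub>j\<in>A. pr j C)"
      using gpart_finite[OF x(1)] gpart_sum[OF x(1)] x gpart_carrier
      by (intro exI[of _ "{j. gpart M j x \<noteq> \<zero>}"]) (simp add: pr finsum_quotient)
  qed (auto simp: pr gpart_of_piece piece_carrier)
qed

end

section \<open>Direct sums\<close>

lemma module_direct_sum:
  assumes "\<And>s. s \<in> S \<Longrightarrow> module (poly_ring n) (M s)"
  shows "module (poly_ring n) (direct_sum S M)"
proof -
  note ax = assms[THEN module.axioms(2)] assms[THEN module.axioms(1)]
  have mem: "x s \<in> carrier (M s)" if "x \<in> carrier (direct_sum S M)" "s \<in> S" for x s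
    using that by (auto simp: PiE_def)
  have ext: "(\<lambda>s\<in>S. x s) = x" if "x \<in> carrier (direct_sum S M)" for x
    using that by (auto simp: PiE_def extensional_restrict)
  show ?thesis
  proof (rule moduleI)
    show "abelian_group (direct_sum S M)"
    proof (rule abelian_groupI)
      fix x assume x: "x \<in> carrier (direct_sum S M)"
      have "(\<lambda>s\<in>S. \<zero>\<^bsub>M s\<^esub> \<oplus>\<^bsub>M s\<^esub> x s) = (\<lambda>s\<in>S. x s)"
        using mem[OF x] ax(1) by (intro restrict_ext) (simp add: abelian_group_def abelian_monoid.l_zero)
      then show "\<zero>\<^bsub>direct_sum S M\<^esub> \<oplus>\<^bsub>direct_sum S M\<^esub> x = x"
        using ext[OF x] by (simp cong: restrict_cong)
      show "\<exists>y\<in>carrier (direct_sum S M). y \<oplus>\<^bsub>direct_sum S M\<^esub> x = \<zero>\<^bsub>direct_sum S M\<^esub>"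
      proof (rule bexI)
        show "(\<lambda>s\<in>S. \<ominus>\<^bsub>M s\<^esub> x s) \<in> carrier (direct_sum S M)"
          using mem[OF x] ax(1) by (auto simp: abelian_group.a_inv_closed)
        show "(\<lambda>s\<in>S. \<ominus>\<^bsub>M s\<^esub> x s) \<oplus>\<^bsub>direct_sum S M\<^esub> x = \<zero>\<^bsub>direct_sum S M\<^esub>"
          using mem[OF x] ax(1) by (auto simp: abelian_group.l_neg intro!: restrict_ext)
      qed
    next
      fix x y assume "x \<in> carrier (direct_sum S M)" "y \<in> carrier (direct_sum S M)"
      note xy = mem[OF this(1)] mem[OF this(2)]
      show "x \<oplus>\<^bsub>direct_sum S M\<^esub> y \<in> carrier (direct_sum S M)"
        using xy ax(1) by (auto intro!: abelian_monoid.a_closed simp: abelian_group_def)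
      show "x \<oplus>\<^bsub>direct_sum S M\<^esub> y = y \<oplus>\<^bsub>direct_sum S M\<^esub> x"
        using xy ax(1) by (auto intro!: restrict_ext abelian_monoid.a_comm simp: abelian_group_def)
      fix z assume "z \<in> carrier (direct_sum S M)"
      note z = mem[OF this]
      show "x \<oplus>\<^bsub>direct_sum S M\<^esub> y \<oplus>\<^bsub>direct_sum S M\<^esub> z = x \<oplus>\<^bsub>direct_sum S M\<^esub> (y \<oplus>\<^bsub>direct_sum S M\<^esub> z)"
        using xy z ax(1) by (auto intro!: restrict_ext abelian_monoid.a_assoc simp: abelian_group_def)
    next
      show "\<zero>\<^bsub>direct_sum S M\<^esub> \<in> carrier (direct_sum S M)"
        using ax(1) by (auto intro!: abelian_monoid.zero_closed simp: abelian_group_def)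
    qed
  next
    fix a x assume a: "a \<in> carrier (poly_ring n)" and x: "x \<in> carrier (direct_sum S M)"
    show "a \<odot>\<^bsub>direct_sum S M\<^esub> x \<in> carrier (direct_sum S M)"
      using a mem[OF x] assms by (auto intro!: module.smult_closed)
    fix b assume b: "b \<in> carrier (poly_ring n)"
    show "(a \<oplus>\<^bsub>poly_ring n\<^esub> b) \<odot>\<^bsub>direct_sum S M\<^esub> x =
        a \<odot>\<^bsub>direct_sum S M\<^esub> x \<oplus>\<^bsub>direct_sum S M\<^esub> b \<odot>\<^bsub>direct_sum S M\<^esub> x"
      using a b mem[OF x] assms
      by (auto intro!: restrict_ext module.smult_l_distr simp del: poly_ring_simps)
    show "(a \<otimes>\<^bsub>poly_ring n\<^esub> b) \<odot>\<^bsub>direct_sum S M\<^esub> x =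
        a \<odot>\<^bsub>direct_sum S M\<^esub> (b \<odot>\<^bsub>direct_sum S M\<^esub> x)"
      using a b mem[OF x] assms
      by (auto intro!: restrict_ext module.smult_assoc1 simp del: poly_ring_simps)
  next
    fix a x y assume a: "a \<in> carrier (poly_ring n)" and x: "x \<in> carrier (direct_sum S M)"
      and y: "y \<in> carrier (direct_sum S M)"
    show "a \<odot>\<^bsub>direct_sum S M\<^esub> (x \<oplus>\<^bsub>direct_sum S M\<^esub> y) =
        a \<odot>\<^bsub>direct_sum S M\<^esub> x \<oplus>\<^bsub>direct_sum S M\<^esub> a \<odot>\<^bsub>direct_sum S M\<^esub> y"
      using a mem[OF x] mem[OF y] assms by (auto intro!: restrict_ext module.smult_r_distr)
  next
    fix x assume x: "x \<in> carrier (direct_sum S M)"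
    have "(\<lambda>s\<in>S. \<one>\<^bsub>poly_ring n\<^esub> \<odot>\<^bsub>M s\<^esub> x s) = (\<lambda>s\<in>S. x s)"
      using mem[OF x] assms by (auto intro!: restrict_ext module.smult_one simp del: poly_ring_simps)
    then show "\<one>\<^bsub>poly_ring n\<^esub> \<odot>\<^bsub>direct_sum S M\<^esub> x = x" using ext[OF x] by simp
  qed (rule cring_poly_ring)
qed

lemma finsum_direct_sum:
  assumes M: "\<And>s. s \<in> S \<Longrightarrow> module (poly_ring n) (M s)"
    and "finite A" "\<And>j. j \<in> A \<Longrightarrow> f j \<in> carrier (direct_sum S M)"
  shows "finsum (direct_sum S M) f A = (\<lambda>s\<in>S. \<Oplus>\<^bsub>M s\<^esub>j\<in>A. f j s)"
proof -
  interpret D: module "poly_ring n" "direct_sum S M" by (rule module_direct_sum[OF M])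
  have mon: "abelian_monoid (M s)" if "s \<in> S" for s
    using M[OF that] by (simp add: module_def abelian_group_def)
  show ?thesis
    using assms(2,3)
  proof (induction A rule: finite_induct)
    case empty
    then show ?case using mon by (auto simp: abelian_monoid.finsum_empty intro!: restrict_ext)
  next
    case (insert a A)
    have "finsum (direct_sum S M) f (insert a A) = f a \<oplus>\<^bsub>direct_sum S M\<^esub> finsum (direct_sum S M) f A"
      using insert.prems by (intro D.finsum_insert insert.hyps) auto
    also have "\<dots> = (\<lambda>s\<in>S. f a s \<oplus>\<^bsub>M s\<^esub> (\<Oplus>\<^bsub>M s\<^esub>j\<in>A. f j s))"
      using insert.IH insert.prems by (auto intro!: restrict_ext)
    also have "\<dots> = (\<lambda>s\<in>S. \<Oplus>\<^bsub>M s\<^esub>j\<in>insert a A. f j s)"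
    proof (intro restrict_ext)
      fix s assume s: "s \<in> S"
      have "f j s \<in> carrier (M s)" if "j \<in> insert a A" for j
        using insert.prems[OF that] s by auto
      then show "f a s \<oplus>\<^bsub>M s\<^esub> (\<Oplus>\<^bsub>M s\<^esub>j\<in>A. f j s) = (\<Oplus>\<^bsub>M s\<^esub>j\<in>insert a A. f j s)"
        using insert.hyps by (subst abelian_monoid.finsum_insert[OF mon[OF s]]) auto
    qed
    finally show ?case .
  qed
qed

lemma graded_module_direct_sum:
  assumes "finite S" and M: "\<And>s. s \<in> S \<Longrightarrow> graded_module n (M s)"
  shows "graded_module n (direct_sum S M)"
proof -
  note mod = graded_module.is_module[OF M]
  note grp = mod[THEN module.axioms(2)]
  interpret D: module "poly_ring n" "direct_sum S M" by (rule module_direct_sum[OF mod])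
  have mem: "x s \<in> carrier (M s)" if "x \<in> carrier (direct_sum S M)" "s \<in> S" for x s
    using that by (auto simp: PiE_def)
  have memp: "x s \<in> piece (M s) j" if "x \<in> piece (direct_sum S M) j" "s \<in> S" for x s j
    using that by (auto simp: PiE_def)
  have inv: "\<ominus>\<^bsub>direct_sum S M\<^esub> x = (\<lambda>s\<in>S. \<ominus>\<^bsub>M s\<^esub> x s)" if x: "x \<in> carrier (direct_sum S M)" for x
  proof (rule D.M.minus_equality[OF _ x])
    show "(\<lambda>s\<in>S. \<ominus>\<^bsub>M s\<^esub> x s) \<in> carrier (direct_sum S M)"
      using mem[OF x] grp by (auto simp: abelian_group.a_inv_closed)
    show "(\<lambda>s\<in>S. \<ominus>\<^bsub>M s\<^esub> x s) \<oplus>\<^bsub>direct_sum S M\<^esub> x = \<zero>\<^bsub>direct_sum S M\<^esub>"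
      using mem[OF x] grp by (auto simp: abelian_group.l_neg intro!: restrict_ext)
  qed
  have piece_carrier: "piece (direct_sum S M) j \<subseteq> carrier (direct_sum S M)" for j
    using M graded_module.piece_carrier by (fastforce simp: PiE_def)
  show ?thesis
  proof (rule graded_moduleI[where pr = "\<lambda>j x. \<lambda>s\<in>S. gpart (M s) j (x s)"])
    show "module (poly_ring n) (direct_sum S M)" by (rule module_direct_sum[OF mod])
    show "subgroup (piece (direct_sum S M) j) (add_monoid (direct_sum S M))" for j
    proof (rule D.M.add.subgroupI[OF piece_carrier])
      have "(\<lambda>s\<in>S. \<zero>\<^bsub>M s\<^esub>) \<in> piece (direct_sum S M) j"
        using M by (auto intro: graded_module.piece_zero)
      then show "piece (direct_sum S M) j \<noteq> {}" by blast
    next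
      fix x assume x: "x \<in> piece (direct_sum S M) j"
      then show "\<ominus>\<^bsub>direct_sum S M\<^esub> x \<in> piece (direct_sum S M) j"
        using inv[OF subsetD[OF piece_carrier x]] memp[OF x] M by (auto intro!: graded_module.piece_a_inv)
    next
      fix x y assume "x \<in> piece (direct_sum S M) j" "y \<in> piece (direct_sum S M) j"
      then show "x \<oplus>\<^bsub>direct_sum S M\<^esub> y \<in> piece (direct_sum S M) j"
        using M by (auto intro!: graded_module.piece_add)
    qed
    show "a \<odot>\<^bsub>direct_sum S M\<^esub> x \<in> piece (direct_sum S M) (i + j)"
      if "a \<in> homogeneous n i" "x \<in> piece (direct_sum S M) j" for a x i j
      using that M by (auto intro!: graded_module.piece_smult)
    show "(\<lambda>s\<in>S. gpart (M s) j (x s)) = (if j = i then x else \<zero>\<^bsub>direct_sum S M\<^esub>)"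
      if x: "x \<in> piece (direct_sum S M) i" for i j x
    proof -
      have "(\<lambda>s\<in>S. x s) = x" using x by (auto simp: PiE_def extensional_restrict)
      moreover have "(\<lambda>s\<in>S. gpart (M s) j (x s)) = (\<lambda>s\<in>S. if j = i then x s else \<zero>\<^bsub>M s\<^esub>)"
        using graded_module.gpart_of_piece[OF M memp[OF x]] by (intro restrict_ext) simp
      ultimately show ?thesis by simp
    qed
  next
    fix x assume x: "x \<in> carrier (direct_sum S M)"
    show "(\<lambda>s\<in>S. gpart (M s) j (x s)) \<in> piece (direct_sum S M) j" for j
      using graded_module.gpart_piece[OF M mem[OF x]] by auto
    then have gp: "(\<lambda>s\<in>S. gpart (M s) j (x s)) \<in> carrier (direct_sum S M)" for j
      using piece_carrier by blast
    show "(\<lambda>s\<in>S. gpart (M s) j ((x \<oplus>\<^bsub>direct_sum S M\<^esub> y) s)) =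
        (\<lambda>s\<in>S. gpart (M s) j (x s)) \<oplus>\<^bsub>direct_sum S M\<^esub> (\<lambda>s\<in>S. gpart (M s) j (y s))"
      if y: "y \<in> carrier (direct_sum S M)" for j y
      using graded_module.gpart_add[OF M mem[OF x] mem[OF y]] by (auto intro!: restrict_ext)
    \<comment> \<open>One finite set of degrees that serves all summands at once; it is finite
      because there are only finitely many summands.\<close>
    define A where "A = (\<Union>s\<in>S. {j. gpart (M s) j (x s) \<noteq> \<zero>\<^bsub>M s\<^esub>})"
    have A: "finite A"
      unfolding A_def using assms(1) graded_module.gpart_finite[OF M mem[OF x]] by (intro finite_UN_I)
    have "x = (\<lambda>s\<in>S. x s)" using x by (auto simp: PiE_def extensional_restrict)
    also have "\<dots> = (\<lambda>s\<in>S. \<Oplus>\<^bsub>M s\<^esub>j\<in>A. gpart (M s) j (x s))"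
      using mem[OF x] by (intro restrict_ext graded_module.gpart_sum_superset[OF M] A) (auto simp: A_def)
    also have "\<dots> = (\<Oplus>\<^bsub>direct_sum S M\<^esub>j\<in>A. (\<lambda>s\<in>S. gpart (M s) j (x s)))"
      using finsum_direct_sum[OF mod A gp] by (simp cong: restrict_cong)
    finally have sum: "x = (\<Oplus>\<^bsub>direct_sum S M\<^esub>j\<in>A. (\<lambda>s\<in>S. gpart (M s) j (x s)))" .
    have "\<forall>j. j \<notin> A \<longrightarrow> (\<lambda>s\<in>S. gpart (M s) j (x s)) = \<zero>\<^bsub>direct_sum S M\<^esub>"
      by (auto simp: A_def intro!: restrict_ext)
    with A sum show "\<exists>A. finite A \<and> (\<forall>j. j \<notin> A \<longrightarrow> (\<lambda>s\<in>S. gpart (M s) j (x s)) = \<zero>\<^bsub>direct_sum S M\<^esub>) \<and>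
      x = (\<Oplus>\<^bsub>direct_sum S M\<^esub>j\<in>A. (\<lambda>s\<in>S. gpart (M s) j (x s)))" by blast
  qed
qed

section \<open>Graded homomorphisms, semilinear along a map of scalars\<close>

definition graded_hom ::
    "nat \<Rightarrow> (qpoly \<Rightarrow> qpoly) \<Rightarrow> (qpoly, 'b) graded_module \<Rightarrow> (qpoly, 'c) graded_module \<Rightarrow> ('b \<Rightarrow> 'c) \<Rightarrow> bool"
  where
  "graded_hom n \<sigma> M M' \<phi> \<longleftrightarrow>
     \<phi> \<in> carrier M \<rightarrow> carrier M' \<and>
     (\<forall>x\<in>carrier M. \<forall>y\<in>carrier M. \<phi> (x \<oplus>\<^bsub>M\<^esub> y) = \<phi> x \<oplus>\<^bsub>M'\<^esub> \<phi> y) \<and>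
     (\<forall>a\<in>carrier (poly_ring n). \<forall>x\<in>carrier M. \<phi> (a \<odot>\<^bsub>M\<^esub> x) = \<sigma> a \<odot>\<^bsub>M'\<^esub> \<phi> x) \<and>
     (\<forall>j. \<phi> ` piece M j \<subseteq> piece M' j)"

text \<open>Semilinearity covers two uses: the differential, where \<open>\<sigma>\<close> is the
  identity, and a change of the vertex order, where it is a relabelling.\<close>

locale graded_homomorphism =
  M: graded_module n M + M': graded_module n M'
  for n :: nat and \<sigma> :: "qpoly \<Rightarrow> qpoly" and M :: "(qpoly, 'b) graded_module"
    and M' :: "(qpoly, 'c) graded_module" +
  fixes \<phi> :: "'b \<Rightarrow> 'c"
  assumes \<sigma>: "\<sigma> \<in> carrier (poly_ring n) \<rightarrow> carrier (poly_ring n)"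
    and hom: "graded_hom n \<sigma> M M' \<phi>"
begin

lemma closed: "x \<in> carrier M \<Longrightarrow> \<phi> x \<in> carrier M'"
  and add: "x \<in> carrier M \<Longrightarrow> y \<in> carrier M \<Longrightarrow> \<phi> (x \<oplus>\<^bsub>M\<^esub> y) = \<phi> x \<oplus>\<^bsub>M'\<^esub> \<phi> y"
  and smult: "a \<in> carrier (poly_ring n) \<Longrightarrow> x \<in> carrier M \<Longrightarrow> \<phi> (a \<odot>\<^bsub>M\<^esub> x) = \<sigma> a \<odot>\<^bsub>M'\<^esub> \<phi> x"
  and piece: "x \<in> piece M j \<Longrightarrow> \<phi> x \<in> piece M' j"
  using hom unfolding graded_hom_def by (blast dest: funcset_mem)+

lemma zero: "\<phi> \<zero>\<^bsub>M\<^esub> = \<zero>\<^bsub>M'\<^esub>"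
proof -
  have "\<phi> \<zero>\<^bsub>M\<^esub> \<oplus>\<^bsub>M'\<^esub> \<phi> \<zero>\<^bsub>M\<^esub> = \<phi> \<zero>\<^bsub>M\<^esub>"
    using add[of "\<zero>\<^bsub>M\<^esub>" "\<zero>\<^bsub>M\<^esub>"] by simp
  then show ?thesis using closed[of "\<zero>\<^bsub>M\<^esub>"] by simp
qed

lemma finsum:
  assumes "finite A" "\<And>j. j \<in> A \<Longrightarrow> f j \<in> carrier M"
  shows "\<phi> (\<Oplus>\<^bsub>M\<^esub>j\<in>A. f j) = (\<Oplus>\<^bsub>M'\<^esub>j\<in>A. \<phi> (f j))"
  using assms
proof (induction A rule: finite_induct)
  case (insert a A)
  then show ?case by (simp add: Pi_def add closed)
qed (simp add: zero)

text \<open>An additive map that preserves pieces carries a decomposition to a decomposition, and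
  decompositions in \<open>M'\<close> are unique.\<close>

lemma gpart:
  assumes "x \<in> carrier M"
  shows "gpart M' j (\<phi> x) = \<phi> (gpart M j x)"
proof (rule M'.gpart_unique[OF M.gpart_finite[OF assms]])
  show "\<phi> (gpart M j x) \<in> piece M' j" for j
    using assms M.gpart_piece piece by blast
  show "\<phi> x = (\<Oplus>\<^bsub>M'\<^esub>j\<in>{j. gpart M j x \<noteq> \<zero>\<^bsub>M\<^esub>}. \<phi> (gpart M j x))"
    using finsum[OF M.gpart_finite[OF assms], of "\<lambda>j. gpart M j x"] M.gpart_carrier[OF assms]
      M.gpart_sum[OF assms] by simp
qed (simp add: zero)

lemma graded_submodule_kernel: "graded_submodule n M {x \<in> carrier M. \<phi> x = \<zero>\<^bsub>M'\<^esub>}"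
  unfolding graded_submodule_def
  using \<sigma> by (auto simp: zero add smult gpart[symmetric] M.gpart_carrier M'.gpart_zero M'.smult_r_null
      Pi_def)

end

text \<open>Taken along the identity because closure of the image under a scalar uses that this
  scalar is a value of the scalar map.\<close>

lemma graded_submodule_image:
  assumes "graded_homomorphism n (\<lambda>a. a) M M' \<phi>"
  shows "graded_submodule n M' (\<phi> ` carrier M)"
proof -
  interpret graded_homomorphism n "\<lambda>a. a" M M' \<phi> by fact
  have "\<zero>\<^bsub>M'\<^esub> \<in> \<phi> ` carrier M" using zero[symmetric] by (rule image_eqI) simp
  moreover have "\<phi> x \<oplus>\<^bsub>M'\<^esub> \<phi> y \<in> \<phi> ` carrier M" if "x \<in> carrier M" "y \<in> carrier M" for x y
    using add[OF that, symmetric] by (rule image_eqI) (use that in simp)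
  moreover have "a \<odot>\<^bsub>M'\<^esub> \<phi> x \<in> \<phi> ` carrier M" if "a \<in> carrier (poly_ring n)" "x \<in> carrier M" for a x
    using smult[OF that, symmetric] by (rule image_eqI) (use that in simp)
  moreover have "gpart M' j (\<phi> x) \<in> \<phi> ` carrier M" if "x \<in> carrier M" for j x
    using gpart[OF that] by (rule image_eqI) (use that M.gpart_carrier in simp)
  ultimately show ?thesis
    unfolding graded_submodule_def using closed by auto
qed

lemma graded_submodule_zero:
  assumes "graded_module n M"
  shows "graded_submodule n M {\<zero>\<^bsub>M\<^esub>}"
proof -
  interpret graded_module n M by fact
  show ?thesis by (simp add: graded_submodule_def)
qed

lemma graded_submodule_of_submodule:
  assumes "graded_module n M" "graded_submodule n M Z" "graded_submodule n M B" "B \<subseteq> Z"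
  shows "graded_submodule n (submodule_on M Z) B"
proof -
  interpret graded_submodule_of n M Z by (simp add: assms graded_submodule_of_axioms_def graded_submodule_of_def)
  have "gpart (submodule_on M Z) j x = gpart M j x" if "x \<in> B" for x j
    using that assms(4) by (intro gpart_submodule_on) auto
  then show ?thesis using assms(3,4) by (auto simp: graded_submodule_def)
qed

locale graded_isomorphism = graded_homomorphism +
  assumes bij: "bij_betw \<phi> (carrier M) (carrier M')"
begin

text \<open>A homomorphism maps pieces into pieces; for a bijection they are hit completely, since
  the component of degree \<open>j\<close> of any preimage of a homogeneous element is again a
  preimage of it.\<close>

lemma graded_isomorphic: "graded_isomorphic n \<sigma> M M'"
proof -
  have "piece M' j \<subseteq> \<phi> ` piece M j" for j
  proof
    fix y assume y: "y \<in> piece M' j"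
    then obtain x where x: "x \<in> carrier M" "y = \<phi> x"
      using bij M'.piece_carrier by (metis bij_betw_imp_surj_on imageE)
    have "\<phi> (gpart M j x) = y"
      using gpart[OF x(1), of j] M'.gpart_of_piece[OF y, of j] x(2) by simp
    then show "y \<in> \<phi> ` piece M j" using M.gpart_piece[OF x(1)] by blast
  qed
  then have "\<phi> ` piece M j = piece M' j" for j using piece by blast
  then show ?thesis
    unfolding graded_isomorphic_def
    using M.graded_module_axioms M'.graded_module_axioms bij add smult by (intro conjI exI[of _ \<phi>]) auto
qed

lemma graded_isomorphism_submodule:
  assumes "graded_submodule n M Z" "graded_submodule n M' Z'" "\<phi> ` Z = Z'"
  shows "graded_isomorphism n \<sigma> (submodule_on M Z) (submodule_on M' Z') \<phi>"
proof -
  interpret Z: graded_submodule_of n M Z using assms(1) by unfold_locales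
  interpret Z': graded_submodule_of n M' Z' using assms(2) by unfold_locales
  interpret S: graded_module n "submodule_on M Z" by (rule Z.graded_module_submodule_on)
  interpret S': graded_module n "submodule_on M' Z'" by (rule Z'.graded_module_submodule_on)
  have "graded_hom n \<sigma> (submodule_on M Z) (submodule_on M' Z') \<phi>"
    using assms(3) Z.N_carrier add smult piece by (auto simp: graded_hom_def)
  moreover have "bij_betw \<phi> Z Z'"
    by (rule bij_betw_subset[OF bij _ assms(3)]) (use Z.N_carrier in blast)
  ultimately show ?thesis
    using \<sigma> by unfold_locales auto
qed

text \<open>The induced map is the direct image of cosets, so no representative has to be chosen,
  and its injectivity is that of taking images of subsets under an injective map.\<close>

lemma graded_isomorphism_quotient:
  assumes "graded_submodule n M N" "graded_submodule n M' N'" "\<phi> ` N = N'"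
  shows "graded_isomorphism n \<sigma> (quotient_module M N) (quotient_module M' N') ((`) \<phi>)"
    and "\<And>x. x \<in> carrier M \<Longrightarrow> \<phi> ` (N +>\<^bsub>M\<^esub> x) = N' +>\<^bsub>M'\<^esub> \<phi> x"
proof -
  interpret N: graded_submodule_of n M N using assms(1) by unfold_locales
  interpret N': graded_submodule_of n M' N' using assms(2) by unfold_locales
  interpret Q: graded_module n "quotient_module M N" by (rule N.graded_module_quotient)
  interpret Q': graded_module n "quotient_module M' N'" by (rule N'.graded_module_quotient)
  show rcos: "\<phi> ` (N +>\<^bsub>M\<^esub> x) = N' +>\<^bsub>M'\<^esub> \<phi> x" if "x \<in> carrier M" for x
  proof -
    have "\<phi> ` (N +>\<^bsub>M\<^esub> x) = (\<Union>h\<in>N. {\<phi> (h \<oplus>\<^bsub>M\<^esub> x)})"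
      by (auto simp: a_r_coset_def')
    also have "\<dots> = (\<Union>h\<in>N. {\<phi> h \<oplus>\<^bsub>M'\<^esub> \<phi> x})"
      using that N.N_carrier add by auto
    also have "\<dots> = N' +>\<^bsub>M'\<^esub> \<phi> x"
      by (auto simp: a_r_coset_def' assms(3)[symmetric])
    finally show ?thesis .
  qed
  have "graded_hom n \<sigma> (quotient_module M N) (quotient_module M' N') ((`) \<phi>)"
    unfolding graded_hom_def
  proof (intro conjI ballI allI)
    show "(`) \<phi> \<in> carrier (quotient_module M N) \<rightarrow> carrier (quotient_module M' N')"
      using N'.rcos_in_rcosets closed by (auto simp: N.carrier_quotient rcos)
    show "(`) \<phi> ` piece (quotient_module M N) j \<subseteq> piece (quotient_module M' N') j" for j
      using M.piece_carrier piece by (auto simp: rcos)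
  next
    fix C D assume "C \<in> carrier (quotient_module M N)" "D \<in> carrier (quotient_module M N)"
    then obtain x y where "x \<in> carrier M" "C = N +>\<^bsub>M\<^esub> x" "y \<in> carrier M" "D = N +>\<^bsub>M\<^esub> y"
      by (auto simp: N.carrier_quotient)
    then show "\<phi> ` (C \<oplus>\<^bsub>quotient_module M N\<^esub> D) = \<phi> ` C \<oplus>\<^bsub>quotient_module M' N'\<^esub> \<phi> ` D"
      by (simp add: N.set_add_rcos N'.set_add_rcos rcos add closed)
  next
    fix a C assume a: "a \<in> carrier (poly_ring n)" and "C \<in> carrier (quotient_module M N)"
    then obtain x where "x \<in> carrier M" "C = N +>\<^bsub>M\<^esub> x" by (auto simp: N.carrier_quotient)
    moreover have "\<sigma> a \<in> carrier (poly_ring n)" using \<sigma> a by auto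
    ultimately show "\<phi> ` (a \<odot>\<^bsub>quotient_module M N\<^esub> C) = \<sigma> a \<odot>\<^bsub>quotient_module M' N'\<^esub> \<phi> ` C"
      using a by (simp add: N.smult_rcos N'.smult_rcos rcos smult closed del: image_UN)
  qed
  moreover have "bij_betw ((`) \<phi>) (carrier (quotient_module M N)) (carrier (quotient_module M' N'))"
  proof (rule bij_betw_imageI)
    have "C \<subseteq> carrier M" if "C \<in> carrier (quotient_module M N)" for C
      using that N.sub.a_rcosets_carrier by auto
    then show "inj_on ((`) \<phi>) (carrier (quotient_module M N))"
      using inj_on_image_eq_iff[OF bij_betw_imp_inj_on[OF bij]] by (intro inj_onI) metis
    have "(`) \<phi> ` carrier (quotient_module M N) = (\<lambda>x. N' +>\<^bsub>M'\<^esub> \<phi> x) ` carrier M"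
    proof -
      have "carrier (quotient_module M N) = (\<lambda>x. N +>\<^bsub>M\<^esub> x) ` carrier M"
        by (auto simp: N.carrier_quotient)
      then show ?thesis using rcos by (simp add: image_image cong: image_cong)
    qed
    also have "\<dots> = (\<lambda>y. N' +>\<^bsub>M'\<^esub> y) ` carrier M'"
      by (simp only: bij_betw_imp_surj_on[OF bij, symmetric] image_image)
    also have "\<dots> = carrier (quotient_module M' N')"
      by (auto simp: N'.carrier_quotient)
    finally show "(`) \<phi> ` carrier (quotient_module M N) = carrier (quotient_module M' N')" .
  qed
  ultimately show "graded_isomorphism n \<sigma> (quotient_module M N) (quotient_module M' N') ((`) \<phi>)"
    using \<sigma> by unfold_locales
qed

end

lemma graded_isomorphism_direct_sum:
  assumes "finite S" and iso: "\<And>s. s \<in> S \<Longrightarrow> graded_isomorphism n \<sigma> (M s) (M' s) (\<psi> s)"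
    and \<sigma>: "\<sigma> \<in> carrier (poly_ring n) \<rightarrow> carrier (poly_ring n)"
  shows "graded_isomorphism n \<sigma> (direct_sum S M) (direct_sum S M') (\<lambda>x. \<lambda>s\<in>S. \<psi> s (x s))"
proof -
  note hom = iso[THEN graded_isomorphism.axioms(1)]
  have "graded_module n (M s)" "graded_module n (M' s)" if "s \<in> S" for s
    using hom[OF that] by (simp_all add: graded_homomorphism_def)
  then interpret D: graded_module n "direct_sum S M" + D': graded_module n "direct_sum S M'"
    using assms(1) by (auto intro: graded_module_direct_sum)
  have "graded_hom n \<sigma> (direct_sum S M) (direct_sum S M') (\<lambda>x. \<lambda>s\<in>S. \<psi> s (x s))"
    unfolding graded_hom_def
    by (auto simp: PiE_iff hom[THEN graded_homomorphism.closed] hom[THEN graded_homomorphism.add]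
        hom[THEN graded_homomorphism.smult] hom[THEN graded_homomorphism.piece] intro!: restrict_ext)
  moreover have "bij_betw (\<lambda>x. \<lambda>s\<in>S. \<psi> s (x s)) (carrier (direct_sum S M)) (carrier (direct_sum S M'))"
  proof (rule bij_betw_byWitness[where f' = "\<lambda>y. \<lambda>s\<in>S. inv_into (carrier (M s)) (\<psi> s) (y s)"])
    have bij: "bij_betw (\<psi> s) (carrier (M s)) (carrier (M' s))" if "s \<in> S" for s
      using iso[OF that] by (rule graded_isomorphism.bij)
    show "\<forall>x\<in>carrier (direct_sum S M). (\<lambda>s\<in>S. inv_into (carrier (M s)) (\<psi> s) ((\<lambda>s\<in>S. \<psi> s (x s)) s)) = x"
      using bij_betw_inv_into_left[OF bij] by (auto simp: PiE_iff fun_eq_iff extensional_def)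
    show "\<forall>x\<in>carrier (direct_sum S M'). (\<lambda>s\<in>S. \<psi> s ((\<lambda>s\<in>S. inv_into (carrier (M s)) (\<psi> s) (x s)) s)) = x"
      using bij_betw_inv_into_right[OF bij] by (auto simp: PiE_iff fun_eq_iff extensional_def)
    show "(\<lambda>x. \<lambda>s\<in>S. \<psi> s (x s)) ` carrier (direct_sum S M) \<subseteq> carrier (direct_sum S M')"
      using bij_betw_apply[OF bij] by (auto simp: PiE_iff)
    show "(\<lambda>y. \<lambda>s\<in>S. inv_into (carrier (M s)) (\<psi> s) (y s)) ` carrier (direct_sum S M') \<subseteq> carrier (direct_sum S M)"
      using bij_betw_apply[OF bij_betw_inv_into[OF bij]] by (auto simp: PiE_iff)
  qed
  ultimately show ?thesis
    using \<sigma> by unfold_locales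
qed

section \<open>The polynomial ring as a graded module over itself\<close>

lemma base_module_simps [simp]:
  "carrier (base_module n) = polys_in {..<n}" "ring.zero (base_module n) = 0"
  "add (base_module n) = (+)" "smult (base_module n) = (*)" "piece (base_module n) = homogeneous n"
  by (simp_all add: base_module_def carrier_poly_ring)

lemma module_base: "module (poly_ring n) (base_module n)"
proof (rule moduleI)
  show "abelian_group (base_module n)"
  proof (rule abelian_groupI)
    fix x assume "x \<in> carrier (base_module n)"
    then show "\<exists>y\<in>carrier (base_module n). y \<oplus>\<^bsub>base_module n\<^esub> x = \<zero>\<^bsub>base_module n\<^esub>"
      by (intro bexI[of _ "- x"]) (simp_all add: uminus_in_polys_in)
  qed (simp_all add: add_in_polys_in)
qed (auto simp: carrier_poly_ring mult_in_polys_in algebra_simps intro: cring_poly_ring)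

lemma finsum_base:
  assumes "finite A" "\<And>j. j \<in> A \<Longrightarrow> f j \<in> polys_in {..<n}"
  shows "finsum (base_module n) f A = sum f A"
proof -
  interpret B: module "poly_ring n" "base_module n" by (rule module_base)
  show ?thesis
    using assms by (induction A rule: finite_induct) (auto simp: Pi_def)
qed

lemma graded_module_base: "graded_module n (base_module n)"
proof -
  interpret B: module "poly_ring n" "base_module n" by (rule module_base)
  have inv: "\<ominus>\<^bsub>base_module n\<^esub> x = - x" if "x \<in> polys_in {..<n}" for x
    by (rule B.M.minus_equality) (use that uminus_in_polys_in in auto)
  show ?thesis
  proof (rule graded_moduleI[where pr = hom_part])
    show "subgroup (piece (base_module n) j) (add_monoid (base_module n))" for j
    proof (rule B.M.add.subgroupI)
      show "piece (base_module n) j \<noteq> {}"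
        using homogeneous_iff[of 0 n j] by auto
    next
      fix p assume "p \<in> piece (base_module n) j"
      then have p: "p \<in> homogeneous n j" by simp
      then have "hom_part j (- p) = - p"
        using hom_part_homogeneous[OF p, of j] hom_part_add[of j p "- p"] by (simp add: add_eq_0_iff)
      then show "\<ominus>\<^bsub>base_module n\<^esub> p \<in> piece (base_module n) j"
        using p by (simp add: inv homogeneous_iff uminus_in_polys_in)
    qed (auto simp: homogeneous_iff add_in_polys_in hom_part_add)
    show "\<exists>A. finite A \<and> (\<forall>j. j \<notin> A \<longrightarrow> hom_part j x = \<zero>\<^bsub>base_module n\<^esub>) \<and>
      x = (\<Oplus>\<^bsub>base_module n\<^esub>j\<in>A. hom_part j x)" if "x \<in> carrier (base_module n)" for x
      using that
      by (intro exI[of _ "monom_deg ` Poly_Mapping.keys x"])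
        (simp add: finsum_base hom_part_in_polys_in sum_hom_part hom_part_eq_0)
  qed (simp_all add: module_base homogeneous_mult hom_part_in_homogeneous hom_part_add hom_part_homogeneous)
qed

lemma gpart_base:
  assumes "p \<in> polys_in {..<n}"
  shows "gpart (base_module n) j p = hom_part j p"
  using assms
  by (intro graded_module.gpart_unique[OF graded_module_base, where A = "monom_deg ` Poly_Mapping.keys p"])
    (simp_all add: hom_part_in_homogeneous hom_part_eq_0 finsum_base hom_part_in_polys_in sum_hom_part)

lemma (in ordered_graph) graded_submodule_edge_ideal:
  assumes "s \<subseteq> edges G"
  shows "graded_submodule n (base_module n) (edge_ideal G vs s)"
  unfolding graded_submodule_def
proof (intro conjI ballI allI)
  show sub: "edge_ideal G vs s \<subseteq> carrier (base_module n)"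
    using edge_ideal_subset[OF assms] by (simp add: carrier_poly_ring)
  fix p j assume "p \<in> edge_ideal G vs s"
  then show "gpart (base_module n) j p \<in> edge_ideal G vs s"
    using gpart_base[of p n j] hom_part_edge_ideal[OF assms] sub by auto
qed (use assms edge_ideal_zero edge_ideal_add edge_ideal_mult in \<open>auto simp: carrier_poly_ring\<close>)

section \<open>The chain complex\<close>

context ordered_graph
begin

abbreviation cls :: "'e set \<Rightarrow> qpoly \<Rightarrow> qpoly set" where
  "cls s p \<equiv> edge_ideal G vs s +>\<^bsub>base_module n\<^esub> p"

abbreviation polys :: "qpoly set" where
  "polys \<equiv> polys_in {..<n}"

lemma graded_submodule_of_edge_ideal:
  "s \<subseteq> edges G \<Longrightarrow> graded_submodule_of n (base_module n) (edge_ideal G vs s)"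
  by (simp add: graded_submodule_of_def graded_submodule_of_axioms_def graded_module_base
      graded_submodule_edge_ideal)

lemma graded_module_edge_module: "s \<subseteq> edges G \<Longrightarrow> graded_module n (edge_module G vs s)"
  unfolding edge_module_def
  by (intro graded_submodule_of.graded_module_quotient graded_submodule_of_edge_ideal)

lemma carrier_edge_module: "s \<subseteq> edges G \<Longrightarrow> carrier (edge_module G vs s) = cls s ` polys"
  using graded_submodule_of.carrier_quotient[OF graded_submodule_of_edge_ideal]
  by (auto simp: edge_module_def)

lemma piece_edge_module: "piece (edge_module G vs s) j = cls s ` homogeneous n j"
  by (simp add: edge_module_def)

lemma zero_edge_module: "s \<subseteq> edges G \<Longrightarrow> \<zero>\<^bsub>edge_module G vs s\<^esub> = cls s 0"
  using graded_submodule_of.rcos_zero[OF graded_submodule_of_edge_ideal] by (simp add: edge_module_def)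

lemma add_cls:
  "s \<subseteq> edges G \<Longrightarrow> p \<in> polys \<Longrightarrow> q \<in> polys \<Longrightarrow> cls s p \<oplus>\<^bsub>edge_module G vs s\<^esub> cls s q = cls s (p + q)"
  using graded_submodule_of.set_add_rcos[OF graded_submodule_of_edge_ideal] by (simp add: edge_module_def)

lemma smult_cls:
  "s \<subseteq> edges G \<Longrightarrow> a \<in> polys \<Longrightarrow> p \<in> polys \<Longrightarrow> a \<odot>\<^bsub>edge_module G vs s\<^esub> cls s p = cls s (a * p)"
  using graded_submodule_of.smult_rcos[OF graded_submodule_of_edge_ideal]
  by (simp add: edge_module_def carrier_poly_ring)

lemma finsum_cls:
  assumes "s \<subseteq> edges G" "finite A" "\<And>a. a \<in> A \<Longrightarrow> f a \<in> polys"
  shows "(\<Oplus>\<^bsub>edge_module G vs s\<^esub>a\<in>A. cls s (f a)) = cls s (sum f A)"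
  using graded_submodule_of.finsum_quotient[OF graded_submodule_of_edge_ideal[OF assms(1)] assms(2), of f] assms(3)
  by (simp add: edge_module_def finsum_base[OF assms(2,3)])

lemma cls_eq_iff:
  assumes "s \<subseteq> edges G" "p \<in> polys" "q \<in> polys"
  shows "cls s p = cls s q \<longleftrightarrow> p - q \<in> edge_ideal G vs s"
proof -
  interpret graded_submodule_of n "base_module n" "edge_ideal G vs s"
    by (rule graded_submodule_of_edge_ideal[OF assms(1)])
  have "\<ominus>\<^bsub>base_module n\<^esub> q = - q"
    by (rule M.minus_equality) (use assms uminus_in_polys_in in auto)
  then show ?thesis using rcos_eq_iff[of p q] assms by (simp add: a_minus_def)
qed

lemma minus_one_power_polys [simp]: "(- 1) ^ k \<in> polys_in S"
  by (intro power_in_polys_in uminus_in_polys_in) simp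

text \<open>The union over representatives collapses to one coset because the ideal of
  \<open>s\<close> is contained in that of \<open>insert e s\<close>.\<close>

lemma edge_map_cls:
  assumes "insert e s \<subseteq> edges G" "p \<in> polys"
  shows "edge_map G vs es s e (cls s p) = cls (insert e s) ((- 1) ^ preceding es s e * p)"
proof -
  have s: "s \<subseteq> edges G" using assms(1) by simp
  interpret S: graded_submodule_of n "base_module n" "edge_ideal G vs s"
    by (rule graded_submodule_of_edge_ideal[OF s])
  have "(\<Union>f\<in>cls s p. edge_ideal G vs (insert e s) +>\<^bsub>poly_ring n\<^esub> f)
      = (\<Union>f\<in>cls s p. cls (insert e s) f)"
    \<comment> \<open>Cosets in the ring and in its base module agree, as both are formed with the
      same addition.\<close>
    by (simp add: a_r_coset_def')
  also have "\<dots> = (\<Union>f\<in>cls s p. cls (insert e s) p)"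
  proof (rule SUP_cong[OF refl])
    fix f assume "f \<in> cls s p"
    then have f: "f \<in> polys" "cls s f = cls s p" using S.rcos_mem[of p f] assms(2) by auto
    then have "f - p \<in> edge_ideal G vs (insert e s)"
      using cls_eq_iff[OF s f(1) assms(2)] edge_ideal_mono[of s "insert e s"] assms(1) by blast
    then show "cls (insert e s) f = cls (insert e s) p"
      using cls_eq_iff[OF assms(1) f(1) assms(2)] by simp
  qed
  also have "\<dots> = cls (insert e s) p"
    using S.sub.a_rcos_self[of p] assms(2) by auto
  finally show ?thesis
    unfolding edge_map_def using smult_cls[OF assms(1) _ assms(2)] by simp
qed

text \<open>A chain is written as a family of classes of polynomials, on which the differential becomes plain
  arithmetic in the polynomial ring.\<close>

definition chain :: "nat \<Rightarrow> ('e set \<Rightarrow> qpoly) \<Rightarrow> 'e set \<Rightarrow> qpoly set" where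
  "chain i f = (\<lambda>s\<in>edge_sets G i. cls s (f s))"

text \<open>The signed coboundary on representatives, before passing to classes. Its square vanishes
  already at this level, with no ideal involved.\<close>

definition codiff :: "'e list \<Rightarrow> ('e set \<Rightarrow> qpoly) \<Rightarrow> 'e set \<Rightarrow> qpoly" where
  "codiff es f t = (\<Sum>e\<in>t. (- 1) ^ preceding es (t - {e}) e * f (t - {e}))"

lemma edge_sets_subset: "s \<in> edge_sets G i \<Longrightarrow> s \<subseteq> edges G"
  by (simp add: edge_sets_def)

lemma finite_edge_sets: "finite (edge_sets G i)"
  using finite_edges by (auto simp: edge_sets_def intro: finite_subset[OF _ finite_Pow_iff[THEN iffD2]])

lemma edge_sets_remove: 
  assumes "t \<in> edge_sets G (Suc i)" "e \<in> t" 
  shows "t - {e} \<in> edge_sets G i"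
  using assms by (auto simp: edge_sets_def)

lemma codiff_polys: "(\<And>s. f s \<in> polys) \<Longrightarrow> codiff es f t \<in> polys"
  unfolding codiff_def by (intro sum_in_polys_in mult_in_polys_in) simp_all

lemma PiE_image:
  assumes "x \<in> (\<Pi>\<^sub>E s\<in>S. h s ` A)" "A \<noteq> {}"
  shows "\<exists>f. (\<forall>s. f s \<in> A) \<and> x = (\<lambda>s\<in>S. h s (f s))"
proof -
  obtain a where a: "a \<in> A" using assms(2) by blast
  have "\<forall>s\<in>S. \<exists>y\<in>A. x s = h s y" using assms(1) by (auto simp: PiE_iff)
  then obtain g where g: "\<And>s. s \<in> S \<Longrightarrow> g s \<in> A" "\<And>s. s \<in> S \<Longrightarrow> x s = h s (g s)" by metis
  \<comment> \<open>Indices outside \<open>S\<close> receive the default \<open>a\<close>, so that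
    the family of representatives lies in \<open>A\<close> everywhere and later statements can
    quantify over all indices.\<close>
  have "x = (\<lambda>s\<in>S. h s (if s \<in> S then g s else a))"
    using assms(1) g(2) by (auto simp: PiE_iff fun_eq_iff extensional_def)
  with a g(1) show ?thesis by (intro exI[of _ "\<lambda>s. if s \<in> S then g s else a"]) auto
qed

lemma graded_module_chain_module: "graded_module n (chain_module G vs i)"
  unfolding chain_module_def
  by (intro graded_module_direct_sum finite_edge_sets graded_module_edge_module edge_sets_subset)

lemma carrier_chain_module: "carrier (chain_module G vs i) = chain i ` {f. \<forall>s. f s \<in> polys}"
proof -
  have eq: "carrier (chain_module G vs i) = (\<Pi>\<^sub>E s\<in>edge_sets G i. cls s ` polys)"
    unfolding chain_module_def by (simp add: carrier_edge_module[OF edge_sets_subset] cong: PiE_cong)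
  show ?thesis
  proof
    show "carrier (chain_module G vs i) \<subseteq> chain i ` {f. \<forall>s. f s \<in> polys}"
    proof
      fix x assume "x \<in> carrier (chain_module G vs i)"
      then obtain f where "\<forall>s. f s \<in> polys" "x = chain i f"
        using PiE_image[of x "edge_sets G i" cls polys] zero_in_polys_in unfolding eq chain_def by blast
      then show "x \<in> chain i ` {f. \<forall>s. f s \<in> polys}" by blast
    qed
  qed (auto simp: eq chain_def)
qed

lemma piece_chain_module: "piece (chain_module G vs i) j = chain i ` {f. \<forall>s. f s \<in> homogeneous n j}"
proof -
  have eq: "piece (chain_module G vs i) j = (\<Pi>\<^sub>E s\<in>edge_sets G i. cls s ` homogeneous n j)"
    unfolding chain_module_def by (simp add: piece_edge_module)
  have ne: "homogeneous n j \<noteq> {}" using homogeneous_iff[of 0 n j] by auto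
  show ?thesis
  proof
    show "piece (chain_module G vs i) j \<subseteq> chain i ` {f. \<forall>s. f s \<in> homogeneous n j}"
    proof
      fix x assume "x \<in> piece (chain_module G vs i) j"
      then obtain f where "\<forall>s. f s \<in> homogeneous n j" "x = chain i f"
        using PiE_image[of x "edge_sets G i" cls "homogeneous n j"] ne unfolding eq chain_def by blast
      then show "x \<in> chain i ` {f. \<forall>s. f s \<in> homogeneous n j}" by blast
    qed
  qed (auto simp: eq chain_def)
qed

lemma zero_chain: "\<zero>\<^bsub>chain_module G vs i\<^esub> = chain i (\<lambda>_. 0)"
  by (auto simp: chain_module_def chain_def zero_edge_module edge_sets_subset intro!: restrict_ext)

lemma add_chain:
  assumes "\<And>s. f s \<in> polys" "\<And>s. g s \<in> polys"
  shows "chain i f \<oplus>\<^bsub>chain_module G vs i\<^esub> chain i g = chain i (\<lambda>s. f s + g s)"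
  using assms by (auto simp: chain_module_def chain_def add_cls edge_sets_subset intro!: restrict_ext)

lemma smult_chain:
  assumes "a \<in> polys" "\<And>s. f s \<in> polys"
  shows "a \<odot>\<^bsub>chain_module G vs i\<^esub> chain i f = chain i (\<lambda>s. a * f s)"
  using assms by (auto simp: chain_module_def chain_def smult_cls edge_sets_subset intro!: restrict_ext)

lemma differential_chain:
  assumes f: "\<And>s. f s \<in> polys"
  shows "differential G vs es i (chain i f) = chain (Suc i) (codiff es f)"
  unfolding differential_def chain_def[of "Suc i"]
proof (intro restrict_ext)
  fix t assume t: "t \<in> edge_sets G (Suc i)"
  then have sub: "t \<subseteq> edges G" and fin: "finite t"
    using edge_sets_subset finite_edges finite_subset by blast+
  have "edge_map G vs es (t - {e}) e (chain i f (t - {e}))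
    = cls t ((- 1) ^ preceding es (t - {e}) e * f (t - {e}))" if "e \<in> t" for e
    using edge_map_cls[of e "t - {e}" "f (t - {e})" es] f edge_sets_remove[OF t that] sub that
    by (simp add: chain_def insert_absorb)
  then have "(\<Oplus>\<^bsub>edge_module G vs t\<^esub>e\<in>t. edge_map G vs es (t - {e}) e (chain i f (t - {e})))
    = (\<Oplus>\<^bsub>edge_module G vs t\<^esub>e\<in>t. cls t ((- 1) ^ preceding es (t - {e}) e * f (t - {e})))"
    using graded_module_edge_module[OF sub] carrier_edge_module[OF sub] f
    by (intro abelian_monoid.finsum_cong') 
      (auto simp: graded_module_def module_def abelian_group_def intro!: imageI mult_in_polys_in)
  then show "(\<Oplus>\<^bsub>edge_module G vs t\<^esub>e\<in>t. edge_map G vs es (t - {e}) e (chain i f (t - {e})))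
    = cls t (codiff es f t)"
    using finsum_cls[OF sub fin, of "\<lambda>e. (- 1) ^ preceding es (t - {e}) e * f (t - {e})"] f
    by (simp add: codiff_def mult_in_polys_in)
qed

lemma codiff_add: "codiff es (\<lambda>s. f s + g s) = (\<lambda>t. codiff es f t + codiff es g t)"
  by (simp add: codiff_def fun_eq_iff distrib_left sum.distrib)

lemma codiff_smult: "codiff es (\<lambda>s. a * f s) = (\<lambda>t. a * codiff es f t)"
  by (simp add: codiff_def fun_eq_iff sum_distrib_left algebra_simps)

lemma homogeneous_add: "p \<in> homogeneous n j \<Longrightarrow> q \<in> homogeneous n j \<Longrightarrow> p + q \<in> homogeneous n j"
  by (simp add: homogeneous_iff add_in_polys_in hom_part_add)

lemma homogeneous_uminus: "p \<in> homogeneous n j \<Longrightarrow> - p \<in> homogeneous n j"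
  by (auto simp: homogeneous_def carrier_poly_ring uminus_in_polys_in)

lemma homogeneous_sign: "p \<in> homogeneous n j \<Longrightarrow> (- 1) ^ k * p \<in> homogeneous n j"
  by (induction k) (auto simp: homogeneous_uminus)

lemma codiff_homogeneous:
  assumes "\<And>s. f s \<in> homogeneous n j" 
  shows "codiff es f t \<in> homogeneous n j"
proof -
  have "(\<Sum>e\<in>A. (- 1) ^ preceding es (t - {e}) e * f (t - {e})) \<in> homogeneous n j" for A
    by (induction A rule: infinite_finite_induct)
      (use assms in \<open>auto intro!: homogeneous_add homogeneous_sign simp: homogeneous_iff[of 0]\<close>)
  then show ?thesis by (simp add: codiff_def)
qed

lemma graded_homomorphism_differential:
  "graded_homomorphism n (\<lambda>a. a) (chain_module G vs i) (chain_module G vs (Suc i)) (differential G vs es i)"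
proof -
  interpret C: graded_module n "chain_module G vs i" by (rule graded_module_chain_module)
  interpret C': graded_module n "chain_module G vs (Suc i)" by (rule graded_module_chain_module)
  show ?thesis
  proof unfold_locales
    show "graded_hom n (\<lambda>a. a) (chain_module G vs i) (chain_module G vs (Suc i)) (differential G vs es i)"
      unfolding graded_hom_def
    proof (intro conjI ballI allI)
      show "differential G vs es i \<in> carrier (chain_module G vs i) \<rightarrow> carrier (chain_module G vs (Suc i))"
        by (auto simp: carrier_chain_module differential_chain codiff_polys)
      show "differential G vs es i ` piece (chain_module G vs i) j \<subseteq> piece (chain_module G vs (Suc i)) j" for j
      proof -
        have "differential G vs es i (chain i f) \<in> piece (chain_module G vs (Suc i)) j"
          if "\<forall>s. f s \<in> homogeneous n j" for f
        proof -
          have "\<forall>s. f s \<in> polys" using that by (simp add: homogeneous_iff)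
          then have "differential G vs es i (chain i f) = chain (Suc i) (codiff es f)"
            by (simp add: differential_chain)
          also have "\<dots> \<in> piece (chain_module G vs (Suc i)) j"
            unfolding piece_chain_module using that by (intro imageI) (simp add: codiff_homogeneous)
          finally show ?thesis .
        qed
        then show ?thesis by (auto simp: piece_chain_module[of i])
      qed
    next
      fix x y assume "x \<in> carrier (chain_module G vs i)" "y \<in> carrier (chain_module G vs i)"
      then obtain f g where "\<forall>s. f s \<in> polys" "x = chain i f" "\<forall>s. g s \<in> polys" "y = chain i g"
        by (auto simp: carrier_chain_module)
      then show "differential G vs es i (x \<oplus>\<^bsub>chain_module G vs i\<^esub> y) = 
          differential G vs es i x \<oplus>\<^bsub>chain_module G vs (Suc i)\<^esub> differential G vs es i y"
        by (simp add: add_chain differential_chain add_in_polys_in codiff_polys codiff_add)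
    next
      fix a x assume "a \<in> carrier (poly_ring n)" "x \<in> carrier (chain_module G vs i)"
      then obtain f where "a \<in> polys" "\<forall>s. f s \<in> polys" "x = chain i f"
        by (auto simp: carrier_chain_module carrier_poly_ring)
      then show "differential G vs es i (a \<odot>\<^bsub>chain_module G vs i\<^esub> x) = 
          a \<odot>\<^bsub>chain_module G vs (Suc i)\<^esub> differential G vs es i x"
        by (simp add: smult_chain differential_chain mult_in_polys_in codiff_polys codiff_smult)
    qed
  qed simp
qed

section \<open>The square of the differential\<close>

lemma preceding_remove:
  assumes "finite u" "e' \<in> u" "pos es e' < pos es e"
  shows "Suc (preceding es (u - {e'}) e) = preceding es u e"
proof -
  have "{a \<in> u. pos es a < pos es e} = insert e' {a \<in> u - {e'}. pos es a < pos es e}"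
    using assms by auto
  then show ?thesis using assms(1) by (simp add: preceding_def)
qed

lemma preceding_remove_not_less:
  assumes "\<not> pos es e' < pos es e"
  shows "preceding es (u - {e'}) e = preceding es u e"
proof -
  have "{a \<in> u. pos es a < pos es e} = {a \<in> u - {e'}. pos es a < pos es e}"
    using assms by auto
  then show ?thesis by (simp add: preceding_def)
qed

text \<open>Each pair of edges of \<open>u\<close> is removed in two orders. Removing the earlier
  edge lowers the number of predecessors of the later one by one, whereas removing the later edge
  leaves the earlier one unaffected. So the two terms have opposite signs.\<close>

lemma codiff_codiff:
  assumes "finite u" "inj_on (pos es) u"
  shows "codiff es (codiff es f) u = 0"
proof -
  define T where "T = (\<lambda>(e, e'). (- 1) ^ preceding es (u - {e}) e *
      ((- 1) ^ preceding es (u - {e} - {e'}) e' * f (u - {e} - {e'})))"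
  define P where "P = (SIGMA e:u. u - {e})"
  have eq: "codiff es (codiff es f) u = sum T P"
    using assms(1) by (simp add: codiff_def T_def P_def sum.Sigma sum_distrib_left)
  have flip: "T (e', e) = - T (e, e')" 
    if e: "e \<in> u" "e' \<in> u" "pos es e < pos es e'" for e e'
  proof -
    have [simp]: "u - {e'} - {e} = u - {e} - {e'}" by blast
    have e1: "preceding es (u - {e}) e = preceding es u e"
      "preceding es (u - {e'}) e' = preceding es u e'"
      using preceding_remove_not_less[of es] by auto
    have e2: "preceding es (u - {e} - {e'}) e = preceding es u e"
      using preceding_remove_not_less[of es e' e "u - {e}"] preceding_remove_not_less[of es e e u] e by simp
    have e3: "preceding es (u - {e} - {e'}) e' = preceding es (u - {e}) e'"
      using preceding_remove_not_less[of es e' e' "u - {e}"] by simp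
    have e4: "preceding es u e' = Suc (preceding es (u - {e}) e')"
      using preceding_remove[OF assms(1) e(1) e(3)] by simp
    show ?thesis
      unfolding T_def using e1 e2 e3 e4 by simp
  qed
  \<comment> \<open>Exchanging the two edges permutes \<open>P\<close> and negates every term, so
    the sum equals its own negative.\<close>
  have "sum T P = (\<Sum>p\<in>P. T (prod.swap p))"
    by (rule sum.reindex_bij_witness[of _ prod.swap prod.swap]) (auto simp: P_def)
  also have "\<dots> = (\<Sum>p\<in>P. - T p)"
  proof (rule sum.cong[OF refl])
    fix p assume "p \<in> P"
    then obtain e e' where p: "p = (e, e')" "e \<in> u" "e' \<in> u" "e \<noteq> e'" by (auto simp: P_def)
    then have "pos es e \<noteq> pos es e'" using assms(2) by (auto dest: inj_onD)
    then consider "pos es e < pos es e'" | "pos es e' < pos es e" by linarith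
    then show "T (prod.swap p) = - T p"
      using flip p by cases simp_all
  qed
  finally have "sum T P = - sum T P" by (simp add: sum_negf)
  \<comment> \<open>Twofold torsion is excluded coefficientwise, where the values are rational
    numbers.\<close>
  then have "Poly_Mapping.lookup (sum T P) m = - Poly_Mapping.lookup (sum T P) m" for m
    by (metis lookup_uminus)
  then have "sum T P = 0" by (intro poly_mapping_eqI) (metis equal_neg_zero lookup_zero)
  then show ?thesis using eq by simp
qed

lemma inj_on_pos: 
  assumes "es \<in> permutations_of_set (edges G)" "t \<subseteq> edges G"
  shows "inj_on (pos es) t"
proof (rule inj_on_inverseI)
  fix e assume "e \<in> t"
  then show "es ! pos es e = e"
    using nth_pos(2)[of es e] permutations_of_setD[OF assms(1)] assms(2) by auto
qed

lemma differential_differential: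
  assumes "es \<in> permutations_of_set (edges G)" "x \<in> carrier (chain_module G vs i)"
  shows "differential G vs es (Suc i) (differential G vs es i x) = \<zero>\<^bsub>chain_module G vs (Suc (Suc i))\<^esub>"
proof -
  obtain f where f: "\<forall>s. f s \<in> polys" "x = chain i f"
    using assms(2) by (auto simp: carrier_chain_module)
  have "codiff es (codiff es f) u = 0" if "u \<in> edge_sets G (Suc (Suc i))" for u
    using edge_sets_subset[OF that] finite_subset[OF _ finite_edges] inj_on_pos[OF assms(1)]
    by (intro codiff_codiff) auto
  then have "chain (Suc (Suc i)) (codiff es (codiff es f)) = chain (Suc (Suc i)) (\<lambda>_. 0)"
    unfolding chain_def by (intro restrict_ext) simp
  then show ?thesis
    using f by (simp add: differential_chain codiff_polys zero_chain)
qed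

section \<open>Cycles and boundaries as graded submodules\<close>

lemma graded_submodule_cycles: "graded_submodule n (chain_module G vs i) (cycles G vs es i)"
  unfolding cycles_def
  by (rule graded_homomorphism.graded_submodule_kernel[OF graded_homomorphism_differential])

lemma graded_submodule_boundaries: "graded_submodule n (chain_module G vs i) (boundaries G vs es i)"
  unfolding boundaries_def
  by (auto split: nat.split intro: graded_submodule_zero graded_module_chain_module
      graded_submodule_image graded_homomorphism_differential)

lemma boundaries_subset_cycles:
  assumes "es \<in> permutations_of_set (edges G)"
  shows "boundaries G vs es i \<subseteq> cycles G vs es i"
proof (cases i)
  case 0
  then show ?thesis
    using graded_submodule_cycles[of 0 es] by (simp add: boundaries_def graded_submodule_def)
next
  case (Suc k)
  then show ?thesis
    using differential_differential[OF assms] graded_homomorphism.closed[OF graded_homomorphism_differential]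
    by (auto simp: boundaries_def cycles_def)
qed

lemma graded_submodule_homology:
  assumes "es \<in> permutations_of_set (edges G)"
  shows "graded_submodule n (submodule_on (chain_module G vs i) (cycles G vs es i)) (boundaries G vs es i)"
  by (intro graded_submodule_of_submodule graded_module_chain_module graded_submodule_cycles
      graded_submodule_boundaries boundaries_subset_cycles assms)

end

section \<open>Change of orderings\<close>

definition reindex :: "'v list \<Rightarrow> 'v list \<Rightarrow> nat \<Rightarrow> nat" where
  "reindex vs vs' k = pos vs' (vs ! k)"

lemma reindex_less:
  assumes "ordered_graph G vs" "ordered_graph G vs'" "k < card (verts G)"
  shows "reindex vs vs' k < card (verts G)" "reindex vs' vs (reindex vs vs' k) = k"
proof -
  interpret V: ordered_graph G vs by fact
  interpret V': ordered_graph G vs' by fact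
  show "reindex vs vs' k < card (verts G)" "reindex vs' vs (reindex vs vs' k) = k"
    using assms(3) V.nth_vs V'.pos_less V'.nth_pos_vs V.pos_nth_vs by (auto simp: reindex_def)
qed

text \<open>The preimage of the target ideal under the substitution is an ideal. It contains every
  generator, because a generator goes to the difference of the same two ends, which the new order
  may at most write with the opposite sign.\<close>

lemma relabel_reindex_edge_ideal:
  assumes "ordered_graph G vs" "ordered_graph G vs'" "s \<subseteq> edges G" "p \<in> edge_ideal G vs s"
  shows "relabel (reindex vs vs') p \<in> edge_ideal G vs' s"
proof -
  interpret V: ordered_graph G vs by fact
  interpret V': ordered_graph G vs' by fact
  let ?\<pi> = "reindex vs vs'"
  let ?J = "{p \<in> V.polys. relabel ?\<pi> p \<in> edge_ideal G vs' s}"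
  have closed: "relabel ?\<pi> q \<in> V.polys" if "q \<in> V.polys" for q
    by (rule relabel_in_polys_in[OF that]) (use reindex_less(1)[OF assms(1,2)] in auto)
  have "ideal ?J V.R"
  proof (rule idealI)
    show "ring V.R" by (rule V.R.ring_axioms)
    show "subgroup ?J (add_monoid V.R)"
    proof (rule V.R.add.subgroupI)
      have "0 \<in> ?J" using V'.edge_ideal_zero[OF assms(3)] by simp
      then show "?J \<noteq> {}" by blast
    next
      fix a assume "a \<in> ?J"
      then show "\<ominus>\<^bsub>V.R\<^esub> a \<in> ?J"
        using V'.edge_ideal_uminus[OF assms(3)]
        by (simp add: carrier_poly_ring uminus_in_polys_in relabel_uminus)
    qed (use V'.edge_ideal_add[OF assms(3)] in \<open>auto simp: carrier_poly_ring relabel_add add_in_polys_in\<close>)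
  next
    fix a x assume a: "a \<in> ?J" and x: "x \<in> carrier V.R"
    then show "x \<otimes>\<^bsub>V.R\<^esub> a \<in> ?J"
      using V'.edge_ideal_mult[OF assms(3) _ closed]
      by (simp add: carrier_poly_ring mult_in_polys_in relabel_mult)
    then show "a \<otimes>\<^bsub>V.R\<^esub> x \<in> ?J" by (simp add: mult.commute)
  qed
  moreover have "edge_poly G vs e \<in> ?J" if e: "e \<in> s" for e
  proof -
    have e': "e \<in> edges G" using assms(3) e by blast
    then obtain u v where uv: "u \<in> ends G e" "v \<in> ends G e"
      "edge_poly G vs e = pvar (pos vs u) - pvar (pos vs v)"
      using V.edge_poly_cases by metis
    then have "u \<in> verts G" "v \<in> verts G" using V.ends_verts[OF e'] by auto
    then have "relabel ?\<pi> (edge_poly G vs e) = pvar (pos vs' u) - pvar (pos vs' v)"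
      using uv(3) by (simp add: relabel_diff reindex_def V.nth_pos_vs)
    then show ?thesis
      using V'.diff_ends_in_ideal[OF assms(3) e uv(1,2)] V.edge_poly_closed[OF e']
      by (simp add: carrier_poly_ring)
  qed
  ultimately have "edge_ideal G vs s \<subseteq> ?J" by (rule V.edge_ideal_minimal[OF assms(3)])
  then show ?thesis using assms(4) by blast
qed

section \<open>The sign correction for a change of the edge order\<close>

definition inversions :: "'e list \<Rightarrow> 'e list \<Rightarrow> 'e set \<Rightarrow> nat" where
  "inversions es es' s =
     card {(a, b) \<in> s \<times> s. pos es a < pos es b \<and> pos es' b < pos es' a}"

text \<open>The inversions lost with \<open>e\<close> correspond to the symmetric difference of its
  two sets of predecessors: a member of \<open>A - B\<close> is paired with \<open>e\<close> on the
  right, a member of \<open>B - A\<close> with \<open>e\<close> on the left. A symmetric difference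
  has the parity of the sum of the two cardinalities.\<close>

lemma inversions_remove:
  assumes "finite t" "e \<in> t" "inj_on (pos es) t" "inj_on (pos es') t"
  shows "even (inversions es es' t + preceding es (t - {e}) e
    + (inversions es es' (t - {e}) + preceding es' (t - {e}) e))"
proof -
  define A where "A = {a \<in> t - {e}. pos es a < pos es e}"
  define B where "B = {a \<in> t - {e}. pos es' a < pos es' e}"
  define I where "I s = {(a, b) \<in> s \<times> s. pos es a < pos es b \<and> pos es' b < pos es' a}" for s
  have inv: "inversions es es' s = card (I s)" for s
    by (simp add: inversions_def I_def)
  have prec: "preceding es (t - {e}) e = card A" "preceding es' (t - {e}) e = card B"
    by (simp_all add: preceding_def A_def B_def)
  have fin: "finite A" "finite B" "finite (I (t - {e}))"
    using assms(1) by (auto simp: A_def B_def I_def intro: finite_subset[of _ "t \<times> t"])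
  have ne: "pos es a \<noteq> pos es e" "pos es' a \<noteq> pos es' e" if "a \<in> t - {e}" for a
    using that assms(2-4) by (auto dest: inj_onD)
  have AB: "A - B = {a \<in> t - {e}. pos es a < pos es e \<and> pos es' e < pos es' a}"
    "B - A = {a \<in> t - {e}. pos es e < pos es a \<and> pos es' a < pos es' e}"
  proof -
    have "\<not> pos es a < pos es e \<longleftrightarrow> pos es e < pos es a"
      "\<not> pos es' a < pos es' e \<longleftrightarrow> pos es' e < pos es' a" if "a \<in> t - {e}" for a
      using ne[OF that] by linarith+
    then show "A - B = {a \<in> t - {e}. pos es a < pos es e \<and> pos es' e < pos es' a}"
      "B - A = {a \<in> t - {e}. pos es e < pos es a \<and> pos es' a < pos es' e}"
      unfolding A_def B_def by blast+
  qed
  have "I t = I (t - {e}) \<union> ((\<lambda>a. (a, e)) ` (A - B) \<union> (\<lambda>a. (e, a)) ` (B - A))"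
    unfolding AB using assms(2) by (auto simp: I_def)
  moreover have "I (t - {e}) \<inter> ((\<lambda>a. (a, e)) ` (A - B) \<union> (\<lambda>a. (e, a)) ` (B - A)) = {}"
    by (auto simp: I_def)
  moreover have "(\<lambda>a. (a, e)) ` (A - B) \<inter> (\<lambda>a. (e, a)) ` (B - A) = {}"
    by (auto simp: A_def)
  ultimately have "card (I t) = card (I (t - {e})) + (card (A - B) + card (B - A))"
    using fin by (simp add: card_Un_disjoint card_image inj_on_def)
  moreover have "card A = card (A \<inter> B) + card (A - B)" "card B = card (A \<inter> B) + card (B - A)"
    using fin card_Int_Diff[of A B] card_Int_Diff[of B A] by (simp_all add: Int_commute)
  ultimately show ?thesis
    unfolding inv prec by presburger
qed

locale reordered_graph = V: ordered_graph G vs + V': ordered_graph G vs'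
  for G :: "('v, 'e) graph" and vs vs' +
  fixes es es' :: "'e list"
  assumes es: "es \<in> permutations_of_set (edges G)" and es': "es' \<in> permutations_of_set (edges G)"
begin

abbreviation "n \<equiv> card (verts G)"
abbreviation "\<pi> \<equiv> reindex vs vs'"

text \<open>Combines both corrections, so that the two orderings can be changed simultaneously by
  one map.\<close>

definition sgn_relabel :: "'e set \<Rightarrow> qpoly \<Rightarrow> qpoly" where
  "sgn_relabel s p = (- 1) ^ inversions es es' s * relabel \<pi> p"

lemma relabel_closed: "p \<in> V.polys \<Longrightarrow> relabel \<pi> p \<in> V.polys"
  by (erule relabel_in_polys_in) (use reindex_less(1)[OF V.ordered_graph_axioms V'.ordered_graph_axioms] in auto)

lemma relabel_inverse_closed: "p \<in> V.polys \<Longrightarrow> relabel (reindex vs' vs) p \<in> V.polys"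
  by (erule relabel_in_polys_in) (use reindex_less(1)[OF V'.ordered_graph_axioms V.ordered_graph_axioms] in auto)

lemma relabel_inverse:
  assumes "p \<in> V.polys"
  shows "relabel (reindex vs' vs) (relabel \<pi> p) = p" "relabel \<pi> (relabel (reindex vs' vs) p) = p"
  unfolding relabel_relabel
  using reindex_less(2)[OF V.ordered_graph_axioms V'.ordered_graph_axioms]
    reindex_less(2)[OF V'.ordered_graph_axioms V.ordered_graph_axioms]
  by (auto intro!: relabel_fixed[OF assms])

lemma sgn_relabel_closed: "p \<in> V.polys \<Longrightarrow> sgn_relabel s p \<in> V.polys"
  by (simp add: sgn_relabel_def mult_in_polys_in relabel_closed V.minus_one_power_polys)

lemma graded_isomorphism_sgn_relabel:
  "graded_isomorphism n (relabel \<pi>) (base_module n) (base_module n) (sgn_relabel s)"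
proof -
  interpret B: graded_module n "base_module n" by (rule graded_module_base)
  have img: "\<pi> ` {..<n} \<subseteq> {..<n}"
    using reindex_less(1)[OF V.ordered_graph_axioms V'.ordered_graph_axioms] by auto
  show ?thesis
  proof unfold_locales
    show "relabel \<pi> \<in> carrier (poly_ring n) \<rightarrow> carrier (poly_ring n)"
      by (simp add: carrier_poly_ring relabel_closed)
    show "graded_hom n (relabel \<pi>) (base_module n) (base_module n) (sgn_relabel s)"
      unfolding graded_hom_def
    proof (intro conjI allI)
      show "sgn_relabel s ` piece (base_module n) j \<subseteq> piece (base_module n) j" for j
        using V.homogeneous_sign[OF homogeneous_relabel[OF _ img]] by (auto simp: sgn_relabel_def)
    qed (auto simp: sgn_relabel_closed, auto simp: sgn_relabel_def relabel_add relabel_mult algebra_simps)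
    show "bij_betw (sgn_relabel s) (carrier (base_module n)) (carrier (base_module n))"
      \<comment> \<open>The sign squares to one and is fixed by relabelling, so the inverse carries
        the same sign together with the reversed reindexing.\<close>
      by (rule bij_betw_byWitness[where f' = "\<lambda>p. (- 1) ^ inversions es es' s * relabel (reindex vs' vs) p"])
        (auto simp: sgn_relabel_def relabel_mult relabel_inverse mult_in_polys_in relabel_closed
          relabel_inverse_closed V.minus_one_power_polys)
  qed
qed

lemma sgn_relabel_edge_ideal:
  assumes "s \<subseteq> edges G"
  shows "sgn_relabel s ` edge_ideal G vs s = edge_ideal G vs' s"
proof
  show "sgn_relabel s ` edge_ideal G vs s \<subseteq> edge_ideal G vs' s"
    using relabel_reindex_edge_ideal[OF V.ordered_graph_axioms V'.ordered_graph_axioms assms] assms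
    by (auto simp: sgn_relabel_def intro!: V'.edge_ideal_mult V.minus_one_power_polys)
  show "edge_ideal G vs' s \<subseteq> sgn_relabel s ` edge_ideal G vs s"
  proof
    fix p assume p: "p \<in> edge_ideal G vs' s"
    let ?q = "(- 1) ^ inversions es es' s * relabel (reindex vs' vs) p"
    have "?q \<in> edge_ideal G vs s"
      using relabel_reindex_edge_ideal[OF V'.ordered_graph_axioms V.ordered_graph_axioms assms p] assms
      by (intro V.edge_ideal_mult V.minus_one_power_polys)
    moreover have "p \<in> V.polys" using V'.edge_ideal_subset[OF assms] p by (auto simp: carrier_poly_ring)
    then have "p = sgn_relabel s ?q"
      by (simp add: sgn_relabel_def relabel_mult relabel_inverse)
    ultimately show "p \<in> sgn_relabel s ` edge_ideal G vs s" by blast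
  qed
qed

section \<open>The isomorphism of chain complexes and of homology\<close>

definition chain_map :: "nat \<Rightarrow> ('e set \<Rightarrow> qpoly set) \<Rightarrow> ('e set \<Rightarrow> qpoly set)" where
  "chain_map i x = (\<lambda>s\<in>edge_sets G i. sgn_relabel s ` x s)"

lemma graded_isomorphism_chain_map:
  "graded_isomorphism n (relabel \<pi>) (chain_module G vs i) (chain_module G vs' i) (chain_map i)"
  unfolding chain_module_def chain_map_def
proof (rule graded_isomorphism_direct_sum[OF V.finite_edge_sets])
  show "relabel \<pi> \<in> carrier (poly_ring n) \<rightarrow> carrier (poly_ring n)"
    by (simp add: carrier_poly_ring relabel_closed)
  fix s assume "s \<in> edge_sets G i"
  then have s: "s \<subseteq> edges G" by (rule V.edge_sets_subset)
  show "graded_isomorphism n (relabel \<pi>) (edge_module G vs s) (edge_module G vs' s) ((`) (sgn_relabel s))"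
    unfolding edge_module_def
    by (rule graded_isomorphism.graded_isomorphism_quotient(1)[OF graded_isomorphism_sgn_relabel
        V.graded_submodule_edge_ideal[OF s] V'.graded_submodule_edge_ideal[OF s] sgn_relabel_edge_ideal[OF s]])
qed

lemma chain_map_chain:
  assumes "\<And>s. f s \<in> V.polys"
  shows "chain_map i (V.chain i f) = V'.chain i (\<lambda>s. sgn_relabel s (f s))"
  unfolding chain_map_def V'.chain_def
proof (rule restrict_ext)
  fix s assume s: "s \<in> edge_sets G i"
  then have "s \<subseteq> edges G" by (rule V.edge_sets_subset)
  then have "sgn_relabel s ` V.cls s (f s) = V'.cls s (sgn_relabel s (f s))"
    using assms
    by (intro graded_isomorphism.graded_isomorphism_quotient(2)[OF graded_isomorphism_sgn_relabel
        V.graded_submodule_edge_ideal V'.graded_submodule_edge_ideal sgn_relabel_edge_ideal]) auto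
  then show "sgn_relabel s ` V.chain i f s = V'.cls s (sgn_relabel s (f s))"
    using s by (simp add: V.chain_def)
qed

text \<open>Compatibility with the differential holds term by term on representatives: by
  \<open>inversions_remove\<close> the total sign is the same whether the correction is made on
  \<open>t - {e}\<close> or on \<open>t\<close>.\<close>

lemma codiff_sgn_relabel:
  assumes "t \<subseteq> edges G"
  shows "V'.codiff es' (\<lambda>s. sgn_relabel s (f s)) t = sgn_relabel t (V.codiff es f t)"
proof -
  have fin: "finite t" using assms V.finite_edges finite_subset by blast
  have "(- 1) ^ preceding es' (t - {e}) e * sgn_relabel (t - {e}) (f (t - {e}))
    = (- 1) ^ inversions es es' t * ((- 1) ^ preceding es (t - {e}) e * relabel \<pi> (f (t - {e})))"
    if "e \<in> t" for e
  proof -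
    have "even (inversions es es' t + preceding es (t - {e}) e)
      \<longleftrightarrow> even (inversions es es' (t - {e}) + preceding es' (t - {e}) e)"
      using inversions_remove[OF fin that V.inj_on_pos[OF es assms] V.inj_on_pos[OF es' assms]] by auto
    then have "(- 1 :: qpoly) ^ (inversions es es' t + preceding es (t - {e}) e)
      = (- 1) ^ (preceding es' (t - {e}) e + inversions es es' (t - {e}))"
      by (simp add: minus_one_power_iff add.commute)
    then show ?thesis
      by (simp add: sgn_relabel_def power_add flip: mult.assoc)
  qed
  then show ?thesis
    by (simp add: V.codiff_def V'.codiff_def sgn_relabel_def[of t] relabel_sum relabel_mult sum_distrib_left)
qed

lemma chain_map_differential:
  assumes "x \<in> carrier (chain_module G vs i)"
  shows "differential G vs' es' i (chain_map i x) = chain_map (Suc i) (differential G vs es i x)"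
proof -
  obtain f where f: "\<forall>s. f s \<in> V.polys" "x = V.chain i f"
    using assms by (auto simp: V.carrier_chain_module)
  have "V'.chain (Suc i) (V'.codiff es' (\<lambda>s. sgn_relabel s (f s)))
    = V'.chain (Suc i) (\<lambda>t. sgn_relabel t (V.codiff es f t))"
    unfolding V'.chain_def by (intro restrict_ext) (simp add: codiff_sgn_relabel V.edge_sets_subset)
  then show ?thesis
    using f by (simp add: chain_map_chain V.differential_chain V'.differential_chain sgn_relabel_closed V.codiff_polys)
qed

text \<open>That cycles come only from cycles rests on injectivity one degree higher, where the
  differential of a preimage is sent to zero.\<close>

lemma chain_map_cycles: "chain_map i ` cycles G vs es i = cycles G vs' es' i"
proof -
  interpret C: graded_isomorphism n "relabel \<pi>" "chain_module G vs i" "chain_module G vs' i" "chain_map i"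
    by (rule graded_isomorphism_chain_map)
  interpret C': graded_isomorphism n "relabel \<pi>" "chain_module G vs (Suc i)" "chain_module G vs' (Suc i)"
    "chain_map (Suc i)"
    by (rule graded_isomorphism_chain_map)
  interpret d: graded_homomorphism n "\<lambda>a. a" "chain_module G vs i" "chain_module G vs (Suc i)"
    "differential G vs es i"
    by (rule V.graded_homomorphism_differential)
  show ?thesis
  proof (intro equalityI subsetI)
    fix y assume "y \<in> chain_map i ` cycles G vs es i"
    then show "y \<in> cycles G vs' es' i"
      using C.closed C'.zero by (auto simp: cycles_def chain_map_differential)
  next
    fix y assume y: "y \<in> cycles G vs' es' i"
    then obtain x where x: "x \<in> carrier (chain_module G vs i)" "y = chain_map i x"
      using bij_betw_imp_surj_on[OF C.bij] by (auto simp: cycles_def)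
    then have "chain_map (Suc i) (differential G vs es i x) = chain_map (Suc i) \<zero>\<^bsub>chain_module G vs (Suc i)\<^esub>"
      using y C'.zero by (simp add: cycles_def chain_map_differential)
    then have "differential G vs es i x = \<zero>\<^bsub>chain_module G vs (Suc i)\<^esub>"
      using inj_onD[OF bij_betw_imp_inj_on[OF C'.bij]] d.closed[OF x(1)] C'.M.M.zero_closed by blast
    then show "y \<in> chain_map i ` cycles G vs es i"
      using x by (auto simp: cycles_def)
  qed
qed

lemma chain_map_boundaries: "chain_map i ` boundaries G vs es i = boundaries G vs' es' i"
proof (cases i)
  case 0
  interpret C: graded_isomorphism n "relabel \<pi>" "chain_module G vs 0" "chain_module G vs' 0" "chain_map 0"
    by (rule graded_isomorphism_chain_map)
  show ?thesis using 0 C.zero by (simp add: boundaries_def)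
next
  case (Suc k)
  interpret C: graded_isomorphism n "relabel \<pi>" "chain_module G vs k" "chain_module G vs' k" "chain_map k"
    by (rule graded_isomorphism_chain_map)
  have "differential G vs' es' k ` carrier (chain_module G vs' k)
    = (\<lambda>x. differential G vs' es' k (chain_map k x)) ` carrier (chain_module G vs k)"
    by (simp only: bij_betw_imp_surj_on[OF C.bij, symmetric] image_image)
  also have "\<dots> = chain_map (Suc k) ` differential G vs es k ` carrier (chain_module G vs k)"
    by (simp add: image_image chain_map_differential cong: image_cong)
  finally show ?thesis using Suc by (simp add: boundaries_def)
qed

theorem graded_isomorphic_homology:
  "graded_isomorphic n (relabel \<pi>) (homology G vs es i) (homology G vs' es' i)"
proof -
  have "graded_isomorphism n (relabel \<pi>) (submodule_on (chain_module G vs i) (cycles G vs es i))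
      (submodule_on (chain_module G vs' i) (cycles G vs' es' i)) (chain_map i)"
    by (rule graded_isomorphism.graded_isomorphism_submodule[OF graded_isomorphism_chain_map
        V.graded_submodule_cycles V'.graded_submodule_cycles chain_map_cycles])
  then have "graded_isomorphism n (relabel \<pi>) (homology G vs es i) (homology G vs' es' i) ((`) (chain_map i))"
    unfolding homology_def
    by (rule graded_isomorphism.graded_isomorphism_quotient(1)[OF _ V.graded_submodule_homology[OF es]
        V'.graded_submodule_homology[OF es'] chain_map_boundaries])
  then show ?thesis by (rule graded_isomorphism.graded_isomorphic)
qed

end

section \<open>Graded dimensions\<close>

text \<open>A dimension count without exhibiting a basis. Coordinates are total functions, compared
  on \<open>B\<close> only; an enumeration of \<open>B\<close> turns them into vectors of length
  \<open>card B\<close> and \<open>\<psi>\<close> into a linear isomorphism.\<close>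

lemma dim_by_coordinates:
  fixes V :: "('a::field, 'v) module" and \<psi> :: "('b \<Rightarrow> 'a) \<Rightarrow> 'v"
  assumes V: "vectorspace class_ring V" and B: "finite B"
    and closed: "\<And>c. \<psi> c \<in> carrier V"
    and add: "\<And>c d. \<psi> (\<lambda>b. c b + d b) = \<psi> c \<oplus>\<^bsub>V\<^esub> \<psi> d"
    and smult: "\<And>r c. \<psi> (\<lambda>b. r * c b) = r \<odot>\<^bsub>V\<^esub> \<psi> c"
    and eq_iff: "\<And>c d. \<psi> c = \<psi> d \<longleftrightarrow> (\<forall>b\<in>B. c b = d b)"
    and surj: "\<And>x. x \<in> carrier V \<Longrightarrow> \<exists>c. x = \<psi> c"
  shows "vectorspace.dim class_ring V = card B"
proof -
  define k where "k = card B"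
  obtain g where g: "bij_betw g B {0..<k}"
    using ex_bij_betw_finite_nat[OF B] by (auto simp: k_def)
  define T where "T v = \<psi> (\<lambda>b. vec_index v (g b))" for v :: "'a vec"
  have gk: "g b < k" if "b \<in> B" for b
    using bij_betw_apply[OF g that] by simp
  have T_add: "T (v + w) = T v \<oplus>\<^bsub>V\<^esub> T w" if "v \<in> carrier_vec k" "w \<in> carrier_vec k" for v w
  proof -
    \<comment> \<open>Entries of a sum of vectors are known only below \<open>k\<close>;
      \<open>eq_iff\<close> confines the comparison to \<open>B\<close>, whose enumeration stays
      below \<open>k\<close>.\<close>
    have "T (v + w) = \<psi> (\<lambda>b. vec_index v (g b) + vec_index w (g b))"
      unfolding T_def eq_iff using that gk by simp
    then show ?thesis by (simp add: add T_def)
  qed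
  have T_smult: "T (r \<cdot>\<^sub>v v) = r \<odot>\<^bsub>V\<^esub> T v" if "v \<in> carrier_vec k" for r v
  proof -
    have "T (r \<cdot>\<^sub>v v) = \<psi> (\<lambda>b. r * vec_index v (g b))"
      unfolding T_def eq_iff using that gk by simp
    then show ?thesis by (simp add: smult T_def)
  qed
  interpret K: vec_space "TYPE('a)" k .
  interpret linear_map "class_ring :: 'a ring" "module_vec TYPE('a) k" V T
  proof (intro linear_map.intro mod_hom.intro mod_hom_axioms.intro vec_vs V)
    show "Module.module class_ring V" using V by (simp add: vectorspace_def)
    show "Module.module class_ring (module_vec TYPE('a) k)" by (rule vec_module)
    show "T \<in> module_hom class_ring (module_vec TYPE('a) k) V"
      using T_add T_smult closed by (auto simp: module_hom_def module_vec_simps T_def)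
  qed
  have inj: "inj_on T (carrier_vec k)"
  proof (rule inj_onI)
    fix v w :: "'a vec" assume vw: "v \<in> carrier_vec k" "w \<in> carrier_vec k" "T v = T w"
    have "vec_index v i = vec_index w i" if "i < k" for i
    proof -
      have "i \<in> g ` B" using bij_betw_imp_surj_on[OF g] that by simp
      then show ?thesis using vw(3) by (auto simp: T_def eq_iff)
    qed
    then show "v = w" using vw by (intro eq_vecI) auto
  qed
  have "carrier V \<subseteq> T ` carrier_vec k"
  proof
    fix x assume "x \<in> carrier V"
    then obtain c where c: "x = \<psi> c" using surj by blast
    have "T (vec k (\<lambda>i. c (inv_into B g i))) = \<psi> c"
      unfolding T_def eq_iff using gk bij_betw_inv_into_left[OF g] by simp
    then show "x \<in> T ` carrier_vec k" using c by (metis image_eqI vec_carrier)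
  qed
  then have "T ` carrier_vec k = carrier V" using closed by (auto simp: T_def)
  then have "K.dim = vectorspace.dim class_ring V"
    using inj by (intro dim_eq) (simp_all add: module_vec_simps)
  then show ?thesis using K.dim_is_n by (simp add: k_def)
qed

section \<open>Graded pieces as rational vector spaces\<close>

lemma pconst_add: "pconst (c + d) = pconst c + pconst d"
  by (simp add: pconst_def single_add)

lemma pconst_mult: "pconst (c * d) = pconst c * pconst d"
  by (simp add: pconst_def mult_single)

lemma pconst_homogeneous: "pconst c \<in> homogeneous n 0"
  by (auto simp: homogeneous_def carrier_poly_ring) (simp add: pconst_def split: if_splits)

text \<open>Constants are homogeneous of degree zero, so scalar multiplication by rationals does not
  leave a piece.\<close>

lemma (in graded_module) vectorspace_piece_space: "vectorspace class_ring (piece_space M j)"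
proof -
  have piece_closed: "pconst c \<odot> x \<in> piece M j" if "x \<in> piece M j" for c x
    using piece_smult[OF pconst_homogeneous that] by simp
  have [simp]: "pconst c \<in> carrier (poly_ring n)" for c
    by (simp add: carrier_poly_ring)
  have "Module.module class_ring (piece_space M j)"
  proof (rule moduleI)
    show "abelian_group (piece_space M j)"
    proof (rule abelian_groupI)
      fix x assume "x \<in> carrier (piece_space M j)"
      then show "\<exists>y\<in>carrier (piece_space M j). y \<oplus>\<^bsub>piece_space M j\<^esub> x = \<zero>\<^bsub>piece_space M j\<^esub>"
        using piece_a_inv piece_carrier
        by (intro bexI[of _ "\<ominus> x"]) (simp_all add: piece_space_def M.l_neg)
    qed (auto simp: piece_space_def piece_add piece_carrier M.a_assoc intro: M.a_comm)
  next
    fix c d :: rat and x y assume x: "x \<in> carrier (piece_space M j)"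
    then have x': "x \<in> carrier M" by (simp add: piece_space_def piece_carrier)
    show "(c \<oplus>\<^bsub>class_ring\<^esub> d) \<odot>\<^bsub>piece_space M j\<^esub> x =
        c \<odot>\<^bsub>piece_space M j\<^esub> x \<oplus>\<^bsub>piece_space M j\<^esub> d \<odot>\<^bsub>piece_space M j\<^esub> x"
      using smult_l_distr[of "pconst c" "pconst d" x] x' by (simp add: piece_space_def pconst_add)
    show "(c \<otimes>\<^bsub>class_ring\<^esub> d) \<odot>\<^bsub>piece_space M j\<^esub> x =
        c \<odot>\<^bsub>piece_space M j\<^esub> (d \<odot>\<^bsub>piece_space M j\<^esub> x)"
      using smult_assoc1[of "pconst c" "pconst d" x] x' by (simp add: piece_space_def pconst_mult)
    show "\<one>\<^bsub>class_ring\<^esub> \<odot>\<^bsub>piece_space M j\<^esub> x = x"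
      using smult_one[OF x'] by (simp add: piece_space_def pconst_def)
    show "c \<odot>\<^bsub>piece_space M j\<^esub> x \<in> carrier (piece_space M j)"
      using x piece_closed by (simp add: piece_space_def)
    assume "y \<in> carrier (piece_space M j)"
    then show "c \<odot>\<^bsub>piece_space M j\<^esub> (x \<oplus>\<^bsub>piece_space M j\<^esub> y) =
        c \<odot>\<^bsub>piece_space M j\<^esub> x \<oplus>\<^bsub>piece_space M j\<^esub> c \<odot>\<^bsub>piece_space M j\<^esub> y"
      using x' piece_carrier by (simp add: piece_space_def smult_r_distr)
  qed (rule class_cring.cring_axioms)
  then show ?thesis
    using class_field by (simp add: vectorspace_def)
qed

section \<open>Counting monomials\<close>

definition mons :: "nat set \<Rightarrow> nat \<Rightarrow> (nat \<Rightarrow>\<^sub>0 nat) set" where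
  "mons S j = {m. Poly_Mapping.keys m \<subseteq> S \<and> monom_deg m = j}"

text \<open>Splits off the exponent \<open>i\<close> of the new variable, leaving degree
  \<open>j - i\<close> for the others; this is the combinatorial form of a Cauchy product.\<close>

lemma bij_betw_mons_insert:
  assumes "a \<notin> S"
  shows "bij_betw (\<lambda>(i, m). m + Poly_Mapping.single a i) (SIGMA i:{0..j}. mons S (j - i)) (mons (insert a S) j)"
proof (rule bij_betw_byWitness[where f' = "\<lambda>m. (Poly_Mapping.lookup m a, Poly_Mapping.update a 0 m)"])
  have zero: "Poly_Mapping.lookup m a = 0" if "m \<in> mons S i" for m i
    using that assms by (auto simp: mons_def in_keys_iff)
  have update: "Poly_Mapping.update a 0 (m + Poly_Mapping.single a i) = m" if "m \<in> mons S i'" for m i i'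
    using zero[OF that]
    by (intro poly_mapping_eqI) (auto simp: lookup_update lookup_add lookup_single when_def)
  have split: "Poly_Mapping.update a 0 m + Poly_Mapping.single a (Poly_Mapping.lookup m a) = m" 
    for m :: "nat \<Rightarrow>\<^sub>0 nat"
    by (intro poly_mapping_eqI) (auto simp: lookup_update lookup_add lookup_single when_def)
  show "\<forall>p\<in>SIGMA i:{0..j}. mons S (j - i).
      (Poly_Mapping.lookup (case p of (i, m) \<Rightarrow> m + Poly_Mapping.single a i) a,
       Poly_Mapping.update a 0 (case p of (i, m) \<Rightarrow> m + Poly_Mapping.single a i)) = p"
    using zero update by (auto simp: lookup_add)
  show "\<forall>m\<in>mons (insert a S) j.
      (case (Poly_Mapping.lookup m a, Poly_Mapping.update a 0 m) of (i, m) \<Rightarrow> m + Poly_Mapping.single a i) = m"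
    using split by simp
  show "(\<lambda>(i, m). m + Poly_Mapping.single a i) ` (SIGMA i:{0..j}. mons S (j - i)) \<subseteq> mons (insert a S) j"
  proof (clarify)
    fix i m assume "i \<in> {0..j}" "m \<in> mons S (j - i)"
    moreover have "Poly_Mapping.keys (m + Poly_Mapping.single a i) \<subseteq> Poly_Mapping.keys m \<union> {a}"
      using keys_add[of m "Poly_Mapping.single a i"] by (auto split: if_splits)
    ultimately show "m + Poly_Mapping.single a i \<in> mons (insert a S) j"
      by (auto simp: mons_def monom_deg_add)
  qed
  show "(\<lambda>m. (Poly_Mapping.lookup m a, Poly_Mapping.update a 0 m)) ` mons (insert a S) j
      \<subseteq> (SIGMA i:{0..j}. mons S (j - i))"
  proof
    fix p assume "p \<in> (\<lambda>m. (Poly_Mapping.lookup m a, Poly_Mapping.update a 0 m)) ` mons (insert a S) j"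
    then obtain m where m: "m \<in> mons (insert a S) j" and 
      p: "p = (Poly_Mapping.lookup m a, Poly_Mapping.update a 0 m)" by blast
    have "monom_deg (Poly_Mapping.update a 0 m) + Poly_Mapping.lookup m a = j"
      using arg_cong[OF split[of m], of monom_deg] m by (simp add: monom_deg_add mons_def)
    then show "p \<in> (SIGMA i:{0..j}. mons S (j - i))"
      using m p by (auto simp: mons_def keys_update)
  qed
qed


text \<open>A further variable convolves the counts with the coefficients of
  \<open>inverse (1 - fps_X)\<close>, all of which are one. Finiteness is proved along with the
  count because the cardinality of the disjoint union relies on it.\<close>

lemma card_mons:
  assumes "finite S"
  shows "finite (mons S j) \<and> of_nat (card (mons S j)) = fps_nth (inverse (1 - fps_X :: rat fps) ^ card S) j"
  using assms
proof (induction S arbitrary: j rule: finite_induct)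
  case empty
  have "mons {} j = (if j = 0 then {0} else {})"
    by (auto simp: mons_def)
  then show ?case by simp
next
  case (insert a S)
  have fin: "finite (SIGMA i:{0..j}. mons S (j - i))" using insert.IH by simp
  have bij: "bij_betw (\<lambda>(i, m). m + Poly_Mapping.single a i) (SIGMA i:{0..j}. mons S (j - i)) (mons (insert a S) j)"
    by (rule bij_betw_mons_insert[OF insert.hyps(2)])
  have "card (mons (insert a S) j) = (\<Sum>i=0..j. card (mons S (j - i)))"
    using bij_betw_same_card[OF bij] insert.IH by simp
  then have "of_nat (card (mons (insert a S) j))
      = (\<Sum>i=0..j. fps_nth (inverse (1 - fps_X :: rat fps) ^ card S) (j - i))"
    using insert.IH by simp
  also have "\<dots> = fps_nth (inverse (1 - fps_X) * inverse (1 - fps_X) ^ card S) j"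
    unfolding fps_mult_nth by (simp add: fps_inverse_one_minus_fps_X)
  finally show ?case
    using insert.hyps fin bij_betw_finite[OF bij] by simp
qed

lemma sum_single_lookup:
  assumes "finite A" "Poly_Mapping.keys p \<subseteq> A"
  shows "(\<Sum>m\<in>A. Poly_Mapping.single m (Poly_Mapping.lookup p m)) = p"
proof -
  have "(\<Sum>m\<in>A. Poly_Mapping.single m (Poly_Mapping.lookup p m))
      = (\<Sum>m\<in>Poly_Mapping.keys p. Poly_Mapping.single m (Poly_Mapping.lookup p m))"
    using assms by (intro sum.mono_neutral_right) (auto simp: in_keys_iff)
  then show ?thesis by (simp add: sum_keys_eq)
qed

lemma lookup_sum_single:
  "finite A \<Longrightarrow> m \<in> A \<Longrightarrow> Poly_Mapping.lookup (\<Sum>m\<in>A. Poly_Mapping.single m (c m)) m = c m"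
  by (simp add: lookup_sum lookup_single when_def)

section \<open>Monomial coordinates on the chain modules\<close>

context ordered_graph
begin

abbreviation rep_mons :: "'e set \<Rightarrow> nat \<Rightarrow> (nat \<Rightarrow>\<^sub>0 nat) set" where
  "rep_mons s j \<equiv> mons (rep s ` {..<n}) j"

text \<open>Coordinates are indexed by an edge set together with a monomial, so a single function
  describes a whole chain. The value zero for other index sets keeps the family homogeneous at every
  index, as the facts about \<open>chain\<close> require.\<close>

definition rep_poly :: "nat \<Rightarrow> ('e set \<times> (nat \<Rightarrow>\<^sub>0 nat) \<Rightarrow> rat) \<Rightarrow> 'e set \<Rightarrow> qpoly" where
  "rep_poly j c s = (if s \<subseteq> edges G then \<Sum>m\<in>rep_mons s j. Poly_Mapping.single m (c (s, m)) else 0)"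

lemma finite_rep_mons [simp]: "finite (rep_mons s j)"
  using card_mons by blast

lemma rep_poly_polys_in: "rep_poly j c s \<in> polys_in (rep s ` {..<n})"
  by (auto simp: rep_poly_def mons_def intro!: sum_in_polys_in single_in_polys_in)

lemma rep_image_subset: "s \<subseteq> edges G \<Longrightarrow> rep s ` {..<n} \<subseteq> {..<n}"
  using rep_less by auto

lemma rep_poly_homogeneous: "rep_poly j c s \<in> homogeneous n j"
proof (cases "s \<subseteq> edges G")
  case True
  have "hom_part j (\<Sum>m\<in>A. Poly_Mapping.single m (c (s, m))) = (\<Sum>m\<in>A. Poly_Mapping.single m (c (s, m)))"
    if "A \<subseteq> rep_mons s j" for A
  proof -
    have "finite A" using that finite_rep_mons finite_subset by blast
    then show ?thesis
      using that by (induction A rule: finite_induct) (auto simp: hom_part_add mons_def)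
  qed
  then show ?thesis
    using rep_poly_polys_in[of j c s] polys_in_mono[OF rep_image_subset[OF True]] True
    by (auto simp: homogeneous_iff rep_poly_def)
qed (simp add: rep_poly_def homogeneous_iff)

lemma rep_poly_polys: "rep_poly j c s \<in> polys"
  using rep_poly_homogeneous homogeneous_iff by blast

lemma rep_poly_add: "rep_poly j (\<lambda>b. c b + d b) s = rep_poly j c s + rep_poly j d s"
  by (simp add: rep_poly_def single_add sum.distrib)

lemma rep_poly_smult: "rep_poly j (\<lambda>b. r * c b) s = pconst r * rep_poly j c s"
  by (simp add: rep_poly_def sum_distrib_left pconst_def mult_single)

lemma relabel_rep_fixed:
  "s \<subseteq> edges G \<Longrightarrow> p \<in> polys_in (rep s ` {..<n}) \<Longrightarrow> relabel (rep s) p = p"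
  by (erule relabel_fixed) (auto simp: rep_rep)

text \<open>The retraction kills the ideal and fixes polynomials in the representative variables, so
  a class contains at most one of them. What remains is a comparison of coefficients.\<close>

lemma cls_rep_poly_eq_iff:
  assumes "s \<subseteq> edges G"
  shows "cls s (rep_poly j c s) = cls s (rep_poly j d s) \<longleftrightarrow> (\<forall>m\<in>rep_mons s j. c (s, m) = d (s, m))"
proof -
  have "cls s (rep_poly j c s) = cls s (rep_poly j d s)
      \<longleftrightarrow> rep_poly j c s - rep_poly j d s \<in> edge_ideal G vs s"
    by (rule cls_eq_iff[OF assms rep_poly_polys rep_poly_polys])
  also have "\<dots> \<longleftrightarrow> relabel (rep s) (rep_poly j c s - rep_poly j d s) = 0"
    by (simp add: edge_ideal_eq_kernel[OF assms] rep_poly_polys diff_in_polys_in)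
  also have "\<dots> \<longleftrightarrow> rep_poly j c s = rep_poly j d s"
    using relabel_rep_fixed[OF assms diff_in_polys_in[OF rep_poly_polys_in rep_poly_polys_in]] by simp
  also have "\<dots> \<longleftrightarrow> (\<forall>m\<in>rep_mons s j. c (s, m) = d (s, m))"
  proof
    assume eq: "rep_poly j c s = rep_poly j d s"
    show "\<forall>m\<in>rep_mons s j. c (s, m) = d (s, m)"
    proof
      fix m assume "m \<in> rep_mons s j"
      then show "c (s, m) = d (s, m)"
        using arg_cong[OF eq, of "\<lambda>p. Poly_Mapping.lookup p m"] assms
          lookup_sum_single[of "rep_mons s j" m "\<lambda>m. c (s, m)"]
          lookup_sum_single[of "rep_mons s j" m "\<lambda>m. d (s, m)"]
        by (simp add: rep_poly_def)
    qed
  qed (simp add: rep_poly_def)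
  finally show ?thesis .
qed

text \<open>The existence of normal forms: the retraction of \<open>p\<close> lies in the class of
  \<open>p\<close>, uses only representative variables and has the same degree.\<close>

lemma cls_eq_rep_poly:
  assumes "s \<subseteq> edges G" "p \<in> homogeneous n j" "\<And>m. c (s, m) = Poly_Mapping.lookup (relabel (rep s) p) m"
  shows "cls s p = cls s (rep_poly j c s)"
proof -
  have p: "p \<in> polys" using assms(2) by (simp add: homogeneous_iff)
  have q: "relabel (rep s) p \<in> polys_in (rep s ` {..<n})"
    by (rule relabel_in_polys_in[OF p]) simp
  have "relabel (rep s) p \<in> homogeneous n j"
    using homogeneous_relabel[OF assms(2) rep_image_subset[OF assms(1)]] .
  then have "Poly_Mapping.keys (relabel (rep s) p) \<subseteq> rep_mons s j"
    using q by (auto simp: homogeneous_def polys_in_def mons_def)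
  then have "rep_poly j c s = relabel (rep s) p"
    using assms(1,3) by (simp add: rep_poly_def sum_single_lookup)
  then show ?thesis
    using cls_eq_iff[OF assms(1) p] diff_relabel_rep_in_ideal[OF assms(1) p] rep_poly_polys[of j c s] by simp
qed

lemma dim_piece_chain_module:
  "vectorspace.dim class_ring (piece_space (chain_module G vs i) j) = (\<Sum>s\<in>edge_sets G i. card (rep_mons s j))"
proof -
  interpret C: graded_module n "chain_module G vs i" by (rule graded_module_chain_module)
  have "vectorspace.dim class_ring (piece_space (chain_module G vs i) j) 
    = card (SIGMA s:edge_sets G i. rep_mons s j)"
  proof (rule dim_by_coordinates[where \<psi> = "\<lambda>c. chain i (rep_poly j c)"])
    show "vectorspace class_ring (piece_space (chain_module G vs i) j)"
      by (rule C.vectorspace_piece_space)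
    show "finite (SIGMA s:edge_sets G i. rep_mons s j)"
      using finite_edge_sets by simp
    show "chain i (rep_poly j c) \<in> carrier (piece_space (chain_module G vs i) j)" for c
      using rep_poly_homogeneous by (auto simp: piece_space_def piece_chain_module)
    show "chain i (rep_poly j (\<lambda>b. c b + d b)) = 
        chain i (rep_poly j c) \<oplus>\<^bsub>piece_space (chain_module G vs i) j\<^esub> chain i (rep_poly j d)" for c d
      by (simp add: piece_space_def add_chain rep_poly_polys rep_poly_add[abs_def])
    show "chain i (rep_poly j (\<lambda>b. r * c b)) = 
        r \<odot>\<^bsub>piece_space (chain_module G vs i) j\<^esub> chain i (rep_poly j c)" for r c
      by (simp add: piece_space_def smult_chain rep_poly_polys rep_poly_smult[abs_def])
    show "chain i (rep_poly j c) = chain i (rep_poly j d) \<longleftrightarrow>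
        (\<forall>b\<in>SIGMA s:edge_sets G i. rep_mons s j. c b = d b)" for c d
    proof -
      have "chain i (rep_poly j c) = chain i (rep_poly j d) \<longleftrightarrow>
          (\<forall>s\<in>edge_sets G i. cls s (rep_poly j c s) = cls s (rep_poly j d s))"
      proof
        assume eq: "chain i (rep_poly j c) = chain i (rep_poly j d)"
        show "\<forall>s\<in>edge_sets G i. cls s (rep_poly j c s) = cls s (rep_poly j d s)"
          using fun_cong[OF eq] by (simp add: chain_def) metis
      qed (auto simp: chain_def intro!: restrict_ext)
      then show ?thesis by (simp add: cls_rep_poly_eq_iff edge_sets_subset)
    qed
    show "\<exists>c. x = chain i (rep_poly j c)" if x: "x \<in> carrier (piece_space (chain_module G vs i) j)" for x
    proof -
      obtain f where f: "\<forall>s. f s \<in> homogeneous n j" "x = chain i f"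
        using x by (auto simp: piece_space_def piece_chain_module)
      \<comment> \<open>The coordinates of a chain are the coefficients of its retracted
        representatives.\<close>
      define c where "c = (\<lambda>(s, m). Poly_Mapping.lookup (relabel (rep s) (f s)) m)"
      have "chain i f = chain i (rep_poly j c)"
        unfolding chain_def using f(1)
        by (intro restrict_ext cls_eq_rep_poly) (auto simp: c_def edge_sets_subset)
      then show ?thesis using f(2) by blast
    qed
  qed
  then show ?thesis using finite_edge_sets by simp
qed

lemma qdim_chain_module:
  "qdim (chain_module G vs i) = (\<Sum>s\<in>edge_sets G i. inverse (1 - fps_X) ^ ncomp (verts G) (ends G ` s))"
proof (rule fps_ext)
  fix j
  have "of_nat (card (rep_mons s j)) = fps_nth (inverse (1 - fps_X :: rat fps) ^ ncomp (verts G) (ends G ` s)) j"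
    if "s \<in> edge_sets G i" for s
    using card_mons[of "rep s ` {..<n}" j] card_rep_image[OF edge_sets_subset[OF that]] by simp
  then show "fps_nth (qdim (chain_module G vs i)) j =
      fps_nth (\<Sum>s\<in>edge_sets G i. inverse (1 - fps_X) ^ ncomp (verts G) (ends G ` s)) j"
    by (simp add: qdim_def dim_piece_chain_module fps_sum_nth)
qed

text \<open>The alternating sum is the state sum with its states grouped by number of edges. No edge
  set is larger than \<open>edges G\<close>, so the finite range accounts for every state.\<close>

lemma euler_characteristic: 
  "(\<Sum>i\<le>card (edges G). (-1) ^ i * qdim (chain_module G vs i)) = chromatic G"
proof -
  have "(\<Sum>i\<le>card (edges G). (-1) ^ i * qdim (chain_module G vs i))
    = (\<Sum>i\<le>card (edges G). \<Sum>s\<in>{s \<in> Pow (edges G). card s = i}.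
        (-1) ^ card s * inverse (1 - fps_X) ^ ncomp (verts G) (ends G ` s))"
    unfolding qdim_chain_module sum_distrib_left
    by (intro sum.cong) (auto simp: edge_sets_def)
  also have "\<dots> = state_sum G"
    unfolding state_sum_def using finite_edges by (intro sum.group) (auto intro: card_mono)
  finally show ?thesis using chromatic_eq_state_sum[OF finite_graph_axioms] by simp
qed

end

theorem theorem2:
  fixes G :: "('v, 'e) graph"
  assumes "finite_graph G"
  shows "(\<forall>vs \<in> permutations_of_set (verts G). \<forall>vs' \<in> permutations_of_set (verts G).
          \<forall>es \<in> permutations_of_set (edges G). \<forall>es' \<in> permutations_of_set (edges G). \<forall>i.
            graded_isomorphic (card (verts G)) (relabel (\<lambda>k. pos vs' (vs ! k)))
              (homology G vs es i) (homology G vs' es' i)) \<and>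
         (\<forall>vs \<in> permutations_of_set (verts G).
            (\<Sum>i\<le>card (edges G). (-1) ^ i * qdim (chain_module G vs i)) = chromatic G)"
proof (intro conjI ballI allI)
  have ordered: "ordered_graph G vs" if "vs \<in> permutations_of_set (verts G)" for vs
    using assms that by (simp add: ordered_graph_def ordered_graph_axioms_def)
  fix vs assume vs: "vs \<in> permutations_of_set (verts G)"
  show "(\<Sum>i\<le>card (edges G). (-1) ^ i * qdim (chain_module G vs i)) = chromatic G"
    by (rule ordered_graph.euler_characteristic[OF ordered[OF vs]])
  fix vs' es es' i
  assume "vs' \<in> permutations_of_set (verts G)" "es \<in> permutations_of_set (edges G)"
    "es' \<in> permutations_of_set (edges G)"
  then have "reordered_graph G vs vs' es es'"
    using ordered[OF vs] ordered by (simp add: reordered_graph_def reordered_graph_axioms_def)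
  then show "graded_isomorphic (card (verts G)) (relabel (\<lambda>k. pos vs' (vs ! k)))
      (homology G vs es i) (homology G vs' es' i)"
    using reordered_graph.graded_isomorphic_homology unfolding reindex_def[abs_def] by blast
qed

end
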